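(* Let $W$ be a Coxeter group (possibly infinite or non-crystallographic) with Bruhat order, $W_P\subseteq W$ a parabolic subgroup, and $\pi:W\to W/W_P$ the natural projection. For any Bruhat interval $[u,w]$ in $W$, the simplicial complex $\pi(\Delta([u,w]))$ is shellable.
   Context: A parabolic subgroup $W_P$ is a subgroup generated by a subset of the simple generators. For a finite poset $Q$, the order complex $\Delta(Q)$ is the simplicial complex of chains in $Q$. $\pi(\Delta([u,w]))$ is the simplicial complex with vertices in $W/W_P$ (identified with the set $W^P$ of minimal length coset representatives) whose faces are the images under $\pi$ of the chains in $[u,w]$. Given a simplicial complex with maximal faces $\sigma_1,\dots,\sigma_N$ all of the same dimension $d-1$, the ordering $\sigma_1,\dots,\sigma_N$ is a shelling order if for each $i\ge 2$, $\sigma_i\cap\bigcup_{j<i}\sigma_j$ is pure of dimension $d-2$. A simplicial complex is shellable if its maximal faces (all of the same dimension) can be put into a shelling order. *)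

theory Defs
  imports "HOL-Algebra.Algebra"
begin

section \<open>Coxeter systems\<close>

text \<open>
  A Coxeter system is a group with a presentation
  \<open>\<langle>S | (s t)^m(s,t) = 1\<rangle>\<close> for a Coxeter matrix \<open>m\<close>.  The entry \<open>m s t = 0\<close> encodes
  \<open>m(s,t) = \<infinity>\<close>: the corresponding relator is the empty word.  Because \<open>m s s = 1\<close>
  gives \<open>s s = 1\<close>, formal inverses of generators are not needed, and the presented group is
  the quotient of the monoid of words over \<open>S\<close> by the congruence generated by the relators.
\<close>

definition coxeter_relator :: "('a \<Rightarrow> 'a \<Rightarrow> nat) \<Rightarrow> 'a \<Rightarrow> 'a \<Rightarrow> 'a list" where
  "coxeter_relator m s t = concat (replicate (m s t) [s, t])"

inductive coxeter_equiv :: "'a set \<Rightarrow> ('a \<Rightarrow> 'a \<Rightarrow> nat) \<Rightarrow> 'a list \<Rightarrow> 'a list \<Rightarrow> bool"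
  for S :: "'a set" and m :: "'a \<Rightarrow> 'a \<Rightarrow> nat" where
  relator: "\<lbrakk>xs \<in> lists S; ys \<in> lists S; s \<in> S; t \<in> S\<rbrakk>
    \<Longrightarrow> coxeter_equiv S m (xs @ coxeter_relator m s t @ ys) (xs @ ys)"
| refl: "xs \<in> lists S \<Longrightarrow> coxeter_equiv S m xs xs"
| sym: "coxeter_equiv S m xs ys \<Longrightarrow> coxeter_equiv S m ys xs"
| trans: "\<lbrakk>coxeter_equiv S m xs ys; coxeter_equiv S m ys zs\<rbrakk> \<Longrightarrow> coxeter_equiv S m xs zs"

definition word_prod :: "('a, 'b) monoid_scheme \<Rightarrow> 'a list \<Rightarrow> 'a" where
  "word_prod G ws = foldr (\<otimes>\<^bsub>G\<^esub>) ws \<one>\<^bsub>G\<^esub>"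

text \<open>The set \<open>S\<close> of simple generators may be infinite.\<close>

locale coxeter_system = group G for G (structure) +
  fixes S :: "'a set" and m :: "'a \<Rightarrow> 'a \<Rightarrow> nat"
  assumes matrix_diag: "s \<in> S \<Longrightarrow> m s s = 1"
    and matrix_off_diag: "\<lbrakk>s \<in> S; t \<in> S; s \<noteq> t\<rbrakk> \<Longrightarrow> m s t \<noteq> 1"
    and matrix_sym: "\<lbrakk>s \<in> S; t \<in> S\<rbrakk> \<Longrightarrow> m s t = m t s"
    and gens_closed: "S \<subseteq> carrier G"
    and gens_generate: "generate G S = carrier G"
    and presentation: "\<lbrakk>xs \<in> lists S; ys \<in> lists S\<rbrakk>
      \<Longrightarrow> word_prod G xs = word_prod G ys \<longleftrightarrow> coxeter_equiv S m xs ys"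

section \<open>Bruhat order\<close>

definition cox_length :: "('a, 'b) monoid_scheme \<Rightarrow> 'a set \<Rightarrow> 'a \<Rightarrow> nat" where
  "cox_length G S x = (LEAST n. \<exists>ws \<in> lists S. length ws = n \<and> word_prod G ws = x)"

definition reflections :: "('a, 'b) monoid_scheme \<Rightarrow> 'a set \<Rightarrow> 'a set" where
  "reflections G S = {x \<otimes>\<^bsub>G\<^esub> s \<otimes>\<^bsub>G\<^esub> inv\<^bsub>G\<^esub> x | x s. x \<in> carrier G \<and> s \<in> S}"

definition bruhat_step :: "('a, 'b) monoid_scheme \<Rightarrow> 'a set \<Rightarrow> 'a \<Rightarrow> 'a \<Rightarrow> bool" where
  "bruhat_step G S x y \<longleftrightarrow> x \<in> carrier G \<and>
    (\<exists>t \<in> reflections G S. y = x \<otimes>\<^bsub>G\<^esub> t) \<and> cox_length G S x < cox_length G S y"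

definition bruhat_le :: "('a, 'b) monoid_scheme \<Rightarrow> 'a set \<Rightarrow> 'a \<Rightarrow> 'a \<Rightarrow> bool" where
  "bruhat_le G S = rtranclp (bruhat_step G S)"

definition bruhat_interval :: "('a, 'b) monoid_scheme \<Rightarrow> 'a set \<Rightarrow> 'a \<Rightarrow> 'a \<Rightarrow> 'a set" where
  "bruhat_interval G S u w = {x \<in> carrier G. bruhat_le G S u x \<and> bruhat_le G S x w}"

section \<open>Simplicial complexes and shellability\<close>

text \<open>
  Complexes are given by their sets of faces and contain the empty face, which has
  dimension \<open>-1\<close>.
\<close>

definition abstract_complex :: "'v set set \<Rightarrow> bool" where
  "abstract_complex K \<longleftrightarrow> {} \<in> K \<and> (\<forall>F \<in> K. finite F \<and> (\<forall>F'. F' \<subseteq> F \<longrightarrow> F' \<in> K))"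

definition face_dim :: "'v set \<Rightarrow> int" where
  "face_dim F = int (card F) - 1"

definition facets :: "'v set set \<Rightarrow> 'v set set" where
  "facets K = {F \<in> K. \<forall>F' \<in> K. F \<subseteq> F' \<longrightarrow> F' = F}"

definition pure_of_dim :: "'v set set \<Rightarrow> int \<Rightarrow> bool" where
  "pure_of_dim K e \<longleftrightarrow> (\<forall>F \<in> facets K. face_dim F = e)"

text \<open>
  A facet \<open>\<sigma>\<close> is regarded as the subcomplex \<open>Pow \<sigma>\<close>.  List positions start at \<open>0\<close>.
\<close>

definition shelling_order :: "'v set set \<Rightarrow> 'v set list \<Rightarrow> bool" where
  "shelling_order K \<sigma> \<longleftrightarrow> distinct \<sigma> \<and> set \<sigma> = facets K \<and>
    (\<exists>d. pure_of_dim K (d - 1) \<and>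
      (\<forall>i. 1 \<le> i \<and> i < length \<sigma> \<longrightarrow>
        pure_of_dim (Pow (\<sigma> ! i) \<inter> (\<Union>j<i. Pow (\<sigma> ! j))) (d - 2)))"

text \<open>
  Finiteness is required because an infinite complex may lack facets, in which case the
  empty list would be a shelling order.
\<close>

definition shellable :: "'v set set \<Rightarrow> bool" where
  "shellable K \<longleftrightarrow> abstract_complex K \<and> finite K \<and> (\<exists>\<sigma>. shelling_order K \<sigma>)"

section \<open>Projections of order complexes\<close>

definition order_complex :: "('a \<Rightarrow> 'a \<Rightarrow> bool) \<Rightarrow> 'a set \<Rightarrow> 'a set set" where
  "order_complex R Q = {C. finite C \<and> C \<subseteq> Q \<and> (\<forall>x \<in> C. \<forall>y \<in> C. R x y \<or> R y x)}"

definition image_complex :: "('a \<Rightarrow> 'v) \<Rightarrow> 'a set set \<Rightarrow> 'v set set" where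
  "image_complex f K = (\<lambda>F. f ` F) ` K"

definition parabolic :: "('a, 'b) monoid_scheme \<Rightarrow> 'a set \<Rightarrow> 'a set" where
  "parabolic G J = generate G J"

text \<open>
  With left cosets, the minimal length representatives are the elements \<open>x\<close> for which
  \<open>x s\<close> is longer than \<open>x\<close> for all \<open>s \<in> J\<close>.
\<close>

definition coset_proj :: "('a, 'b) monoid_scheme \<Rightarrow> 'a set \<Rightarrow> 'a \<Rightarrow> 'a set" where
  "coset_proj G J x = x <#\<^bsub>G\<^esub> parabolic G J"

end

theory Submission
  imports Defs Complex_Main
begin

text \<open>
  Label a Bruhat cover \<open>x < x t\<close> by the reflection \<open>t\<close>, and order the reflections by their normalized
  roots so that those of \<open>W\<^sub>P\<close> come last. Every Bruhat interval then has a unique chain with increasing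
  labels; this follows by induction from left multiplication by a descent \<open>s\<close> of the upper end,
  because a step \<open>t\<close> that is not a crossing \<open>x < s x\<close> compares with the label \<open>inv x s x\<close> of that
  crossing in the way dictated by the signs of the roots.

  Replacing \<open>w\<close> by \<open>w s < w\<close> and \<open>u\<close> by the smaller of \<open>u\<close> and \<open>u s\<close>, for a generator \<open>s\<close> of \<open>W\<^sub>P\<close>, does not
  change the projected complex, so \<open>w\<close> may be taken minimal in its coset. The facets are then the images of the
  saturated chains from \<open>u\<close> to \<open>w\<close> without labels in \<open>W\<^sub>P\<close>. Flipping a descent of such a chain, and
  pushing a label in \<open>W\<^sub>P\<close> that may appear upwards until it disappears, yields a facet that contains
  all other vertices and whose label sequence, read from the top, is lexicographically larger.
  Since a face lies in only one facet all of whose descents belong to the face, listing the larger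
  label sequences first is a shelling.
\<close>

section \<open>Words and the geometric representation\<close>

text \<open>The faces are images of chains of the interval, not chains in a poset of cosets, so a
  face comes without a canonical lift, and facets have to be told apart through the labels of
  suitably chosen lifts. The order on reflections has to cope with infinite \<open>S\<close> and
  arbitrary real coefficients. It therefore compares coefficient functions at their first difference
  along a well-order of the type. Geometry enters the chain arguments through one fact: the labels
  of the crossing by \<open>s\<close> before and after a step \<open>t\<close> are conjugate under
  \<open>t\<close>, so their roots lie in one plane with the root of \<open>t\<close>, and the signs
  in the linear relation decide which of the three is the middle one. Placing the reflections of the
  parabolic subgroup last has two effects. In an increasing chain the labels that fix the coset form
  its upper end, so a chain that ends at a shortest coset representative has none. And a flip can
  create such a label only in its upper position, from where it can be pushed on towards the
  top.\<close>

context coxeter_system begin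

section \<open>Words, length and parity\<close>

abbreviation len :: "'a \<Rightarrow> nat" where "len \<equiv> cox_length G S"
abbreviation T :: "'a set" where "T \<equiv> reflections G S"
abbreviation wp :: "'a list \<Rightarrow> 'a" where "wp \<equiv> word_prod G"

lemma gen_carrier [simp, intro]: "s \<in> S \<Longrightarrow> s \<in> carrier G"
  using gens_closed by blast

lemma wp_Nil [simp]: "wp [] = \<one>" and wp_Cons [simp]: "wp (x # xs) = x \<otimes> wp xs"
  by (simp_all add: word_prod_def)

lemma wp_closed [simp, intro]: "set xs \<subseteq> S \<Longrightarrow> wp xs \<in> carrier G"
  by (induction xs) auto

lemma wp_append: "set xs \<subseteq> S \<Longrightarrow> set ys \<subseteq> S \<Longrightarrow> wp (xs @ ys) = wp xs \<otimes> wp ys"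
  by (induction xs) (auto simp: m_assoc)

lemma word_presentation:
  "set xs \<subseteq> S \<Longrightarrow> set ys \<subseteq> S \<Longrightarrow> wp xs = wp ys \<longleftrightarrow> coxeter_equiv S m xs ys"
  using presentation[of xs ys] by (auto simp: in_lists_conv_set)

lemma gen_sq [simp]: assumes "s \<in> S" shows "s \<otimes> s = \<one>"
proof -
  have "coxeter_equiv S m ([] @ coxeter_relator m s s @ []) ([] @ [])"
    using assms by (intro coxeter_equiv.relator) auto
  then have "coxeter_equiv S m [s, s] []"
    using assms by (simp add: coxeter_relator_def matrix_diag)
  then have "wp [s, s] = wp []" using assms word_presentation[of "[s,s]" "[]"] by auto
  then show ?thesis using assms by simp
qed

lemma gen_inv [simp]: "s \<in> S \<Longrightarrow> inv s = s"
  by (simp add: inv_equality)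

lemma gen_cancel [simp]: assumes "s \<in> S" "x \<in> carrier G"
  shows "s \<otimes> (s \<otimes> x) = x" "x \<otimes> s \<otimes> s = x"
  using assms by (simp_all add: m_assoc flip: m_assoc[of s s x])

lemma wp_rev: "set xs \<subseteq> S \<Longrightarrow> wp (rev xs) = inv (wp xs)"
  by (induction xs) (auto simp: wp_append inv_mult_group)

lemma generate_words:
  assumes "K \<subseteq> S"
  shows "generate G K = {wp xs | xs. set xs \<subseteq> K}"
proof (intro equalityI subsetI)
  fix x assume "x \<in> generate G K"
  then have "\<exists>xs. set xs \<subseteq> K \<and> x = wp xs"
  proof induction
    case one show ?case by (intro exI[of _ "[]"]) auto
  next
    case (incl h) then show ?case using assms by (intro exI[of _ "[h]"]) auto
  next
    case (inv h) then show ?case using assms by (intro exI[of _ "[h]"]) (auto simp: subset_iff)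
  next
    case (eng h1 h2)
    then obtain xs ys where xy: "set xs \<subseteq> K" "set ys \<subseteq> K" "h1 = wp xs" "h2 = wp ys" by blast
    then have "set xs \<subseteq> S" "set ys \<subseteq> S" using assms by auto
    then show ?case using xy by (intro exI[of _ "xs @ ys"]) (auto simp: wp_append)
  qed
  then show "x \<in> {wp xs | xs. set xs \<subseteq> K}" by blast
next
  fix x assume "x \<in> {wp xs | xs. set xs \<subseteq> K}"
  then obtain xs where "set xs \<subseteq> K" "x = wp xs" by blast
  then show "x \<in> generate G K"
    by (induction xs arbitrary: x) (auto intro: generate.intros)
qed

lemma word_exists: "x \<in> carrier G \<Longrightarrow> \<exists>xs. set xs \<subseteq> S \<and> wp xs = x"
  using generate_words[of S] gens_generate by auto

lemma len_le: "set xs \<subseteq> S \<Longrightarrow> len (wp xs) \<le> length xs"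
  unfolding cox_length_def by (rule Least_le) (auto simp: in_lists_conv_set)

lemma reduced_word: assumes "x \<in> carrier G" obtains xs where "set xs \<subseteq> S" "wp xs = x" "length xs = len x"
proof -
  have "\<exists>ws \<in> lists S. length ws = len x \<and> wp ws = x"
    unfolding cox_length_def by (rule LeastI_ex) (use word_exists[OF assms] in \<open>auto simp: in_lists_conv_set\<close>)
  then show ?thesis using that by (auto simp: in_lists_conv_set)
qed

lemma len_one [simp]: "len \<one> = 0" using len_le[of "[]"] by simp

text \<open>All relators have even length \<open>2 * m s t\<close>, also the empty one that encodes
  an infinite entry. This replaces the sign character.\<close>

lemma equiv_parity: "coxeter_equiv S m xs ys \<Longrightarrow> even (length xs) = even (length ys)"
proof (induction rule: coxeter_equiv.induct)
  case (relator xs ys s t)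
  have "length (concat (replicate k [s, t])) = 2 * k" for k by (induction k) auto
  then show ?case by (simp add: coxeter_relator_def)
qed auto

lemma word_parity: "set xs \<subseteq> S \<Longrightarrow> even (len (wp xs)) = even (length xs)"
  by (metis equiv_parity word_presentation reduced_word wp_closed)

lemma len_inv: assumes "x \<in> carrier G" shows "len (inv x) = len x"
proof -
  have le: "len (inv y) \<le> len y" if y: "y \<in> carrier G" for y
  proof -
    obtain xs where "set xs \<subseteq> S" "wp xs = y" "length xs = len y" using reduced_word[OF y] .
    then show ?thesis using len_le[of "rev xs"] by (simp add: wp_rev)
  qed
  show ?thesis using le[of x] le[of "inv x"] assms by simp
qed

lemma len_mult_le: assumes "x \<in> carrier G" "y \<in> carrier G" shows "len (x \<otimes> y) \<le> len x + len y"
proof -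
  obtain xs where "set xs \<subseteq> S" "wp xs = x" "length xs = len x" using reduced_word[OF assms(1)] .
  moreover obtain ys where "set ys \<subseteq> S" "wp ys = y" "length ys = len y" using reduced_word[OF assms(2)] .
  ultimately show ?thesis using len_le[of "xs @ ys"] by (simp add: wp_append)
qed

lemma len_gen: "s \<in> S \<Longrightarrow> len s \<le> 1" using len_le[of "[s]"] by simp

lemma len_parity_mult: assumes "x \<in> carrier G" "y \<in> carrier G"
  shows "even (len (x \<otimes> y)) = (even (len x) = even (len y))"
proof -
  obtain xs where "set xs \<subseteq> S" "wp xs = x" "length xs = len x" using reduced_word[OF assms(1)] .
  moreover obtain ys where "set ys \<subseteq> S" "wp ys = y" "length ys = len y" using reduced_word[OF assms(2)] .
  ultimately show ?thesis using word_parity[of "xs @ ys"] by (simp add: wp_append)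
qed

lemma odd_len_gen: "s \<in> S \<Longrightarrow> odd (len s)" using word_parity[of "[s]"] by simp

text \<open>A generator changes the length by at most one, and parity excludes no change.\<close>

lemma len_right_cases: assumes "x \<in> carrier G" "s \<in> S"
  shows "len (x \<otimes> s) = Suc (len x) \<or> len x = Suc (len (x \<otimes> s))"
proof -
  have "len (x \<otimes> s) \<le> len x + 1" using len_mult_le[of x s] len_gen[of s] assms by simp
  moreover have "len x \<le> len (x \<otimes> s) + 1" using len_mult_le[of "x \<otimes> s" s] len_gen[of s] assms by simp
  moreover have "len (x \<otimes> s) \<noteq> len x" using len_parity_mult[of x s] odd_len_gen[of s] assms by auto
  ultimately show ?thesis by linarith
qed

lemma len_left_right: assumes "x \<in> carrier G" "s \<in> S" shows "len (s \<otimes> x) = len (inv x \<otimes> s)"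
  using assms len_inv[of "s \<otimes> x"] by (simp add: inv_mult_group)

lemma len_left_cases: assumes "x \<in> carrier G" "s \<in> S"
  shows "len (s \<otimes> x) = Suc (len x) \<or> len x = Suc (len (s \<otimes> x))"
  using len_right_cases[of "inv x" s] assms len_left_right len_inv by auto

lemma ex_left_descent: assumes "x \<in> carrier G" "x \<noteq> \<one>" obtains s where "s \<in> S" "len x = Suc (len (s \<otimes> x))"
proof -
  obtain xs where xs: "set xs \<subseteq> S" "wp xs = x" "length xs = len x" using reduced_word[OF assms(1)] .
  then obtain s ys where "xs = s # ys" using assms by (cases xs) auto
  then have "s \<in> S" "len (s \<otimes> x) \<le> length ys" "len x = Suc (length ys)"
    using xs len_le[of ys] by auto
  then show ?thesis using that len_left_cases[OF assms(1)] by (metis Suc_n_not_le_n le_Suc_eq)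
qed

lemma ex_right_descent: assumes "x \<in> carrier G" "x \<noteq> \<one>" obtains s where "s \<in> S" "len x = Suc (len (x \<otimes> s))"
proof -
  obtain s where "s \<in> S" "len (inv x) = Suc (len (s \<otimes> inv x))"
    using ex_left_descent[of "inv x"] assms by (metis inv_closed inv_inv inv_one)
  then show ?thesis using that[of s] assms len_left_right[of "inv x" s] len_inv[of x] by simp
qed

text \<open>The contragredient of the geometric representation, acting on functions on the generators.\<close>

definition cox_cf :: "'a \<Rightarrow> 'a \<Rightarrow> real" where
  "cox_cf s t = (if s = t then 2 else if m s t = 0 then -2 else - 2 * cos (pi / m s t))"

text \<open>A function \<open>\<phi>\<close> stands for a linear form on the root space, given by
  its values on the simple roots. Since \<open>cox_cf\<close> is twice the Coxeter bilinear form,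
  this is the dual of the reflection in the simple root of \<open>s\<close>. All functions are
  allowed, so infinite \<open>S\<close> causes no support conditions here.\<close>

definition sact :: "'a \<Rightarrow> ('a \<Rightarrow> real) \<Rightarrow> ('a \<Rightarrow> real)" where
  "sact s \<phi> = (\<lambda>u. \<phi> u - cox_cf s u * \<phi> s)"

definition wact :: "'a list \<Rightarrow> ('a \<Rightarrow> real) \<Rightarrow> ('a \<Rightarrow> real)" where
  "wact ws = foldr sact ws"

lemma wact_append: "wact (xs @ ys) \<phi> = wact xs (wact ys \<phi>)"
  by (simp add: wact_def)

lemma cox_cf_sym: "s \<in> S \<Longrightarrow> t \<in> S \<Longrightarrow> cox_cf s t = cox_cf t s"
  by (simp add: cox_cf_def matrix_sym)

lemma sact_sact: "sact s (sact s \<phi>) = \<phi>"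
  by (auto simp: sact_def cox_cf_def)

text \<open>The values \<open>q\<close> fired by an alternating word satisfy the Chebyshev recursion, hence are
  \<open>2m\<close>-periodic, and their sums over a period vanish separately over even and odd indices.\<close>

lemma wact_relator:
  assumes S: "s \<in> S" "t \<in> S"
  shows "wact (coxeter_relator m s t) \<phi> = \<phi>"
proof (cases "s = t \<or> m s t = 0")
  case True
  then show ?thesis using S by (auto simp: coxeter_relator_def matrix_diag wact_def sact_sact)
next
  case False
  define n where "n = m s t"
  have n2: "n \<ge> 2" using False matrix_off_diag[OF S] unfolding n_def by linarith
  define \<theta> where "\<theta> = pi / n"
  define k where "k = 2 * cos \<theta>"
  have cf: "cox_cf s t = -k" "cox_cf t s = -k" "cox_cf s s = 2" "cox_cf t t = 2"
    using False cox_cf_sym[OF S] by (simp_all add: cox_cf_def k_def \<theta>_def n_def)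
  have th: "0 < \<theta>" "\<theta> < pi" using n2 by (simp_all add: \<theta>_def field_simps)
  have sin: "sin \<theta> > 0" using th by (simp add: sin_gt_zero)
  \<comment> \<open>\<open>A\<close> and \<open>B\<close> are the coefficients of the solution of
    the recursion with initial values \<open>- \<phi> s\<close> and \<open>\<phi> t\<close>.\<close>
  define A where "A = - \<phi> s"
  define B where "B = (\<phi> t - A * cos \<theta>) / sin \<theta>"
  define q where "q i = A * cos (real i * \<theta>) + B * sin (real i * \<theta>)" for i :: nat
  have q0: "q 0 = - \<phi> s" and q1: "q 1 = \<phi> t"
    using sin by (simp_all add: q_def A_def B_def)
  have rec: "q (Suc (Suc i)) = k * q (Suc i) - q i" for i
  proof -
    define x where "x = real (Suc i) * \<theta>"
    have e: "real (Suc (Suc i)) * \<theta> = x + \<theta>" "real i * \<theta> = x - \<theta>" by (simp_all add: x_def algebra_simps)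
    show ?thesis unfolding q_def e x_def[symmetric] k_def cos_add cos_diff sin_add sin_diff
      by (simp add: algebra_simps)
  qed
  have per: "q (i + 2 * n) = q i" for i
  proof -
    have "real (i + 2 * n) * \<theta> = real i * \<theta> + 2 * pi" using n2 by (simp add: \<theta>_def field_simps)
    then show ?thesis by (simp add: q_def)
  qed
  define E where "E j = (\<Sum>i<j. q (2 * i + 2))" for j
  define D where "D j = (\<Sum>i<j. q (2 * i + 1))" for j
  \<comment> \<open>\<open>D j\<close> and \<open>E j\<close> accumulate what the letters
    \<open>t\<close> and \<open>s\<close> subtract. The other two conjuncts are the current values
    at \<open>s\<close> and \<open>t\<close>, which determine the next increments.\<close>
  have st: "wact (concat (replicate j [s, t])) \<phi> = (\<lambda>u. \<phi> u - cox_cf t u * D j - cox_cf s u * E j)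
      \<and> \<phi> s + k * D j - 2 * E j = - q (2 * j) \<and> \<phi> t - 2 * D j + k * E j = q (2 * j + 1)" for j
  proof (induction j)
    case 0 then show ?case using q0 q1 by (simp add: wact_def E_def D_def)
  next
    case (Suc j)
    let ?p = "\<lambda>u. \<phi> u - cox_cf t u * D j - cox_cf s u * E j"
    have DE: "D (Suc j) = D j + q (2 * j + 1)" "E (Suc j) = E j + q (2 * j + 2)" by (simp_all add: D_def E_def)
    have ps: "?p s = - q (2 * j)" and pt: "?p t = q (2 * j + 1)" using Suc cf by simp_all
    have r1: "q (2 * j + 2) = k * q (2 * j + 1) - q (2 * j)" using rec[of "2 * j"] by simp
    have r2: "q (2 * Suc j + 1) = k * q (2 * j + 2) - q (2 * j + 1)" using rec[of "2 * j + 1"] by simp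
    have "wact (concat (replicate (Suc j) [s, t])) \<phi> = wact [s, t] ?p"
    proof -
      have "concat (replicate (Suc j) [s, t]) = [s, t] @ concat (replicate j [s, t])" by simp
      then show ?thesis using Suc by (simp only: wact_append)
    qed
    also have "\<dots> = (\<lambda>u. \<phi> u - cox_cf t u * D (Suc j) - cox_cf s u * E (Suc j))"
    proof
      fix u
      have a: "sact t ?p = (\<lambda>u. ?p u - cox_cf t u * q (2 * j + 1))" unfolding sact_def pt ..
      have b: "sact t ?p s = q (2 * j + 2)" unfolding a using ps cf r1 by simp
      have "wact [s, t] ?p u = sact s (sact t ?p) u" by (simp add: wact_def)
      also have "\<dots> = sact t ?p u - cox_cf s u * q (2 * j + 2)" by (subst sact_def) (simp only: b)
      finally show "wact [s, t] ?p u = \<phi> u - cox_cf t u * D (Suc j) - cox_cf s u * E (Suc j)"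
        unfolding a DE by (simp add: algebra_simps)
    qed
    finally have 1: "wact (concat (replicate (Suc j) [s, t])) \<phi>
      = (\<lambda>u. \<phi> u - cox_cf t u * D (Suc j) - cox_cf s u * E (Suc j))" .
    have 2: "\<phi> s + k * D (Suc j) - 2 * E (Suc j) = - q (2 * Suc j)"
      using ps cf r1 unfolding DE by (simp add: algebra_simps)
    have 3: "\<phi> t - 2 * D (Suc j) + k * E (Suc j) = q (2 * Suc j + 1)"
      using pt cf unfolding DE r2 by (simp add: algebra_simps)
    from 1 2 3 show ?case by blast
  qed
  \<comment> \<open>By periodicity the values at \<open>s\<close> and \<open>t\<close> are back at
    their start after \<open>n\<close> rounds. This gives a homogeneous system for
    \<open>D n\<close> and \<open>E n\<close> with determinant \<open>4 - k\<^sup>2\<close>, which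
    is nonzero because \<open>sin \<theta>\<close> is.\<close>
  have "k * D n = 2 * E n"
  proof -
    have "\<phi> s + k * D n - 2 * E n = - q (2 * n)" using st by blast
    then show ?thesis using per[of 0] q0 by simp
  qed
  moreover have "2 * D n = k * E n"
  proof -
    have "\<phi> t - 2 * D n + k * E n = q (2 * n + 1)" using st by blast
    then show ?thesis using per[of 1] q1 by (simp add: add.commute)
  qed
  ultimately have kk: "k * D n = 2 * E n" "k * E n = 2 * D n" by simp_all
  have "k * (k * E n) = k * (2 * D n)" "k * (k * D n) = k * (2 * E n)" unfolding kk by simp_all
  then have "k * (k * E n) = 4 * E n" "k * (k * D n) = 4 * D n"
    unfolding mult.left_commute[of k 2] kk by simp_all
  then have "(4 - k\<^sup>2) * E n = 0" "(4 - k\<^sup>2) * D n = 0"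
    by (simp_all add: left_diff_distrib power2_eq_square)
  moreover have "4 - k\<^sup>2 = 4 * (sin \<theta>)\<^sup>2" by (simp add: k_def sin_squared_eq power_mult_distrib)
  ultimately have "E n = 0" "D n = 0" using sin by auto
  then show ?thesis using st[of n] by (simp add: coxeter_relator_def n_def)
qed

lemma wact_equiv: "coxeter_equiv S m xs ys \<Longrightarrow> wact xs \<phi> = wact ys \<phi>"
proof (induction arbitrary: \<phi> rule: coxeter_equiv.induct)
  case (relator xs ys s t)
  then show ?case by (simp add: wact_append wact_relator)
qed auto

definition act :: "'a \<Rightarrow> ('a \<Rightarrow> real) \<Rightarrow> ('a \<Rightarrow> real)" where
  "act x = wact (SOME ws. set ws \<subseteq> S \<and> wp ws = x)"

lemma act_wp: assumes "set ws \<subseteq> S" shows "act (wp ws) \<phi> = wact ws \<phi>"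
proof -
  have "\<exists>xs. set xs \<subseteq> S \<and> wp xs = wp ws" using assms by blast
  then have "set (SOME xs. set xs \<subseteq> S \<and> wp xs = wp ws) \<subseteq> S \<and> wp (SOME xs. set xs \<subseteq> S \<and> wp xs = wp ws) = wp ws"
    by (rule someI_ex)
  then show ?thesis unfolding act_def using assms word_presentation wact_equiv by blast
qed

lemma act_mult: "x \<in> carrier G \<Longrightarrow> y \<in> carrier G \<Longrightarrow> act (x \<otimes> y) \<phi> = act x (act y \<phi>)"
  using word_exists[of x] word_exists[of y] by (auto simp: act_wp wact_append simp flip: wp_append)

lemma act_one [simp]: "act \<one> \<phi> = \<phi>" using act_wp[of "[]"] by (simp add: wact_def)

lemma act_gen: "s \<in> S \<Longrightarrow> act s = sact s" using act_wp[of "[s]"] by (auto simp: wact_def)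

lemma act_linear: assumes "x \<in> carrier G"
  shows "act x (\<lambda>u. \<phi> u + c * \<psi> u) = (\<lambda>u. act x \<phi> u + c * act x \<psi> u)"
proof -
  obtain ws where "set ws \<subseteq> S" "wp ws = x" using word_exists[OF assms] by blast
  moreover have "wact ws (\<lambda>u. \<phi> u + c * \<psi> u) = (\<lambda>u. wact ws \<phi> u + c * wact ws \<psi> u)"
    by (induction ws) (auto simp: wact_def sact_def algebra_simps)
  ultimately show ?thesis using act_wp[of ws] by auto
qed

end

section \<open>Roots\<close>

text \<open>Vectors of the root space are represented by functionals, the simple root of
  \<open>s\<close> being evaluation at \<open>s\<close>. This is the cone spanned by the simple
  roots of \<open>K\<close>; the induction guarantees finite support.\<close>

inductive pos_comb :: "'a set \<Rightarrow> (('a \<Rightarrow> real) \<Rightarrow> real) \<Rightarrow> bool" for K where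
  zero: "pos_comb K (\<lambda>\<phi>. 0)"
| step: "pos_comb K f \<Longrightarrow> s \<in> K \<Longrightarrow> 0 \<le> c \<Longrightarrow> pos_comb K (\<lambda>\<phi>. f \<phi> + c * \<phi> s)"

text \<open>Test functions: on a combination of simple roots, \<open>delta_fun u\<close> reads off
  the coefficient at \<open>u\<close>, \<open>one_fun\<close> the sum of all coefficients and
  \<open>off_fun L\<close> the sum of those outside \<open>L\<close>.\<close>

abbreviation delta_fun :: "'a \<Rightarrow> 'a \<Rightarrow> real" where "delta_fun u \<equiv> (\<lambda>v. if v = u then 1 else 0)"
abbreviation one_fun :: "'a \<Rightarrow> real" where "one_fun \<equiv> (\<lambda>_. 1)"
abbreviation off_fun :: "'a set \<Rightarrow> 'a \<Rightarrow> real" where "off_fun L \<equiv> (\<lambda>v. if v \<in> L then 0 else 1)"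

lemma pos_comb_gen: "s \<in> K \<Longrightarrow> 0 \<le> c \<Longrightarrow> pos_comb K (\<lambda>\<phi>. c * \<phi> s)"
  using pos_comb.step[OF pos_comb.zero, of s K c] by simp

lemma pos_comb_add: "pos_comb K f \<Longrightarrow> pos_comb K g \<Longrightarrow> pos_comb K (\<lambda>\<phi>. g \<phi> + f \<phi>)"
proof (induction rule: pos_comb.induct)
  case (step f s c)
  then show ?case using pos_comb.step[of K "\<lambda>\<phi>. g \<phi> + f \<phi>" s c] by (simp add: add.assoc)
qed simp

lemma pos_comb_scale: "pos_comb K f \<Longrightarrow> 0 \<le> c \<Longrightarrow> pos_comb K (\<lambda>\<phi>. c * f \<phi>)"
proof (induction rule: pos_comb.induct)
  case (step f s d)
  then show ?case using pos_comb.step[of K "\<lambda>\<phi>. c * f \<phi>" s "c * d"] by (simp add: distrib_left mult.assoc)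
qed (simp add: pos_comb.zero)

lemma pos_comb_nonneg: "pos_comb K f \<Longrightarrow> (\<And>s. s \<in> K \<Longrightarrow> 0 \<le> \<phi> s) \<Longrightarrow> 0 \<le> f \<phi>"
  by (induction rule: pos_comb.induct) auto

text \<open>The coefficients outside \<open>L\<close> are non-negative with sum zero.\<close>

lemma pos_comb_restrict: "pos_comb K f \<Longrightarrow> f (off_fun L) = 0 \<Longrightarrow> pos_comb L f"
proof (induction rule: pos_comb.induct)
  case (step f s c)
  have "0 \<le> f (off_fun L)" using step.hyps(1) by (rule pos_comb_nonneg) simp
  moreover have "0 \<le> c * off_fun L s" using step by simp
  ultimately have "f (off_fun L) = 0" "c * off_fun L s = 0" using step.prems by linarith+
  then have "pos_comb L f" "c = 0 \<or> s \<in> L" using step.IH by (auto split: if_splits)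
  then show ?case using step.hyps by (auto intro: pos_comb.step)
qed (simp add: pos_comb.zero)

lemma pos_comb_singleton: "pos_comb {s} f \<Longrightarrow> f = (\<lambda>\<phi>. f one_fun * \<phi> s)"
proof (induction rule: pos_comb.induct)
  case (step f t c)
  show ?case
  proof
    fix \<phi>
    have "f \<phi> = f one_fun * \<phi> s" using step.IH by metis
    then show "f \<phi> + c * \<phi> t = (f one_fun + c * 1) * \<phi> s" using step.hyps by (simp add: algebra_simps)
  qed
qed simp

lemma pos_comb_zero: assumes "pos_comb K f" "f one_fun = 0" shows "f = (\<lambda>_. 0)"
proof -
  have "pos_comb {} f" using pos_comb_restrict[of K f "{}"] assms by simp
  then show ?thesis by (induction rule: pos_comb.induct) simp_all
qed

text \<open>Quantifying over all finite supersets \<open>B\<close> lets two functionals be expanded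
  over a common index set.\<close>

definition expands_on :: "'a set \<Rightarrow> (('a \<Rightarrow> real) \<Rightarrow> real) \<Rightarrow> bool" where
  "expands_on A f \<longleftrightarrow> (\<forall>B \<phi>. finite B \<longrightarrow> A \<subseteq> B \<longrightarrow> f \<phi> = (\<Sum>u\<in>B. f (delta_fun u) * \<phi> u))"

lemma expands_onD:
  "expands_on A f \<Longrightarrow> finite B \<Longrightarrow> A \<subseteq> B \<Longrightarrow> f \<phi> = (\<Sum>u\<in>B. f (delta_fun u) * \<phi> u)"
  unfolding expands_on_def by iprover

lemma pos_comb_expand: "pos_comb K f \<Longrightarrow> \<exists>A. finite A \<and> expands_on A f"
proof (induction rule: pos_comb.induct)
  case zero show ?case by (intro exI[of _ "{}"]) (simp add: expands_on_def)
next
  case (step f s c)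
  then obtain A where A: "finite A" "expands_on A f" by (elim exE conjE)
  have "expands_on (insert s A) (\<lambda>\<phi>. f \<phi> + c * \<phi> s)"
    unfolding expands_on_def
  proof (intro allI impI)
    fix B and \<phi> :: "'a \<Rightarrow> real" assume B: "finite B" "insert s A \<subseteq> B"
    have "(\<Sum>u\<in>B. (f (delta_fun u) + c * delta_fun u s) * \<phi> u)
      = (\<Sum>u\<in>B. f (delta_fun u) * \<phi> u) + (\<Sum>u\<in>B. c * delta_fun u s * \<phi> u)"
      by (simp add: distrib_right sum.distrib)
    also have "(\<Sum>u\<in>B. c * delta_fun u s * \<phi> u) = (\<Sum>u\<in>B. if u = s then c * \<phi> s else 0)"
      by (rule sum.cong) auto
    also have "\<dots> = c * \<phi> s" using B by simp
    also have "(\<Sum>u\<in>B. f (delta_fun u) * \<phi> u) = f \<phi>"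
      using B by (intro expands_onD[OF A(2), symmetric]) auto
    finally show "f \<phi> + c * \<phi> s = (\<Sum>u\<in>B. (f (delta_fun u) + c * delta_fun u s) * \<phi> u)" ..
  qed
  then show ?case using A by (intro exI[of _ "insert s A"]) simp
qed

lemma pos_comb_eqI:
  assumes "pos_comb K f" "pos_comb L g" "\<And>u. f (delta_fun u) = g (delta_fun u)"
  shows "f = g"
proof
  fix \<phi>
  obtain A B where A: "finite A" "expands_on A f" and B: "finite B" "expands_on B g"
    using pos_comb_expand[OF assms(1)] pos_comb_expand[OF assms(2)] by (elim exE conjE)
  have "f \<phi> = (\<Sum>u\<in>A \<union> B. f (delta_fun u) * \<phi> u)"
    using A(1) B(1) by (intro expands_onD[OF A(2)]) auto
  also have "\<dots> = (\<Sum>u\<in>A \<union> B. g (delta_fun u) * \<phi> u)" by (simp only: assms(3))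
  also have "\<dots> = g \<phi>" 
    using A(1) B(1) by (intro expands_onD[OF B(2), symmetric]) auto
  finally show "f \<phi> = g \<phi>" .
qed

definition lin_fun :: "(('a \<Rightarrow> real) \<Rightarrow> real) \<Rightarrow> bool" where
  "lin_fun f \<longleftrightarrow> (\<forall>\<phi> \<psi> c. f (\<lambda>u. \<phi> u + c * \<psi> u) = f \<phi> + c * f \<psi>)"

section \<open>The geometric representation on roots\<close>

context coxeter_system begin

abbreviation simple :: "'a \<Rightarrow> ('a \<Rightarrow> real) \<Rightarrow> real" where "simple s \<equiv> (\<lambda>\<phi>. \<phi> s)"

text \<open>The dual of the contragredient action, hence the geometric representation itself, with
  roots as functionals.\<close>

definition gact :: "'a \<Rightarrow> (('a \<Rightarrow> real) \<Rightarrow> real) \<Rightarrow> ('a \<Rightarrow> real) \<Rightarrow> real" where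
  "gact x f = (\<lambda>\<phi>. f (act (inv x) \<phi>))"

lemma gact_mult: "x \<in> carrier G \<Longrightarrow> y \<in> carrier G \<Longrightarrow> gact (x \<otimes> y) f = gact x (gact y f)"
  by (simp add: gact_def inv_mult_group act_mult)

lemma gact_one [simp]: "gact \<one> f = f" by (simp add: gact_def)

lemma gact_inv [simp]: assumes "x \<in> carrier G" shows "gact (inv x) (gact x f) = f" "gact x (gact (inv x) f) = f"
  using assms by (simp_all flip: gact_mult)

lemma gact_comb: "gact x (\<lambda>\<phi>. f \<phi> + c * g \<phi>) = (\<lambda>\<phi>. gact x f \<phi> + c * gact x g \<phi>)"
  and gact_cmult: "gact x (\<lambda>\<phi>. c * g \<phi>) = (\<lambda>\<phi>. c * gact x g \<phi>)"
  and gact_minus: "gact x (\<lambda>\<phi>. - g \<phi>) = (\<lambda>\<phi>. - gact x g \<phi>)"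
  by (simp_all add: gact_def)

lemma lin_gact: "x \<in> carrier G \<Longrightarrow> lin_fun f \<Longrightarrow> lin_fun (gact x f)"
  by (simp add: lin_fun_def gact_def act_linear)

lemma lin_simple [simp]: "lin_fun (simple s)" by (simp add: lin_fun_def)

lemma gact_gen_simple: "s \<in> S \<Longrightarrow> gact s (simple t) = (\<lambda>\<phi>. \<phi> t - cox_cf s t * \<phi> s)"
  by (simp add: gact_def act_gen sact_def)

text \<open>The reflection formula along an arbitrary root: \<open>cox_cf s\<close> is the simple
  coroot, and \<open>act x\<close> transports it.\<close>

lemma gact_reflection:
  assumes "x \<in> carrier G" "s \<in> S" "lin_fun f"
  shows "gact (x \<otimes> s \<otimes> inv x) f = (\<lambda>\<phi>. f \<phi> - f (act x (cox_cf s)) * gact x (simple s) \<phi>)"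
proof
  fix \<phi>
  let ?\<psi> = "act (inv x) \<phi>"
  have "inv (x \<otimes> s \<otimes> inv x) = x \<otimes> (s \<otimes> inv x)" using assms by (simp add: inv_mult_group m_assoc)
  then have "gact (x \<otimes> s \<otimes> inv x) f \<phi> = f (act x (sact s ?\<psi>))"
    using assms by (simp add: gact_def act_mult act_gen)
  also have "sact s ?\<psi> = (\<lambda>u. ?\<psi> u + (- ?\<psi> s) * cox_cf s u)" by (simp add: sact_def mult.commute)
  also have "act x \<dots> = (\<lambda>u. act x ?\<psi> u + (- ?\<psi> s) * act x (cox_cf s) u)" by (rule act_linear) fact
  also have "act x ?\<psi> = \<phi>" using assms by (simp flip: act_mult)
  also have "f (\<lambda>u. \<phi> u + (- ?\<psi> s) * act x (cox_cf s) u) = f \<phi> + (- ?\<psi> s) * f (act x (cox_cf s))"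
    using assms(3) unfolding lin_fun_def by blast
  finally show "gact (x \<otimes> s \<otimes> inv x) f \<phi> = f \<phi> - f (act x (cox_cf s)) * gact x (simple s) \<phi>"
    by (simp add: gact_def)
qed

lemma gact_pos_comb:
  assumes "pos_comb K f" "\<And>s. s \<in> K \<Longrightarrow> pos_comb S (gact x (simple s))"
  shows "pos_comb S (gact x f)"
  using assms(1)
proof (induction rule: pos_comb.induct)
  case zero then show ?case by (simp add: gact_def pos_comb.zero)
next
  case (step f s c)
  then show ?case unfolding gact_comb using assms(2) by (intro pos_comb_add pos_comb_scale) auto
qed

section \<open>Alternating words and dihedral roots\<close>

definition altw :: "'a \<Rightarrow> 'a \<Rightarrow> nat \<Rightarrow> 'a list" where
  "altw s t k = rev (map (\<lambda>i. if even i then t else s) [0..<k])"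

lemma altw_Suc: "altw s t (Suc k) = (if even k then t else s) # altw s t k" and altw_0 [simp]: "altw s t 0 = []"
  by (simp_all add: altw_def)

lemma altw_set: "set (altw s t k) \<subseteq> {s, t}" by (auto simp: altw_def)

lemma length_altw [simp]: "length (altw s t k) = k" by (simp add: altw_def)

lemma altw_snoc: "altw s t (Suc k) = altw t s k @ [t]"
  by (induction k) (auto simp: altw_Suc)

lemma altw_split: "altw s t (n + k) = rev (map (\<lambda>i. if even i then t else s) [n..<n+k]) @ altw s t n"
  unfolding altw_def by (subst upt_add_eq_append) auto

lemma altw_relator: "coxeter_relator m s t = altw s t (2 * m s t)"
proof -
  have "concat (replicate k [s, t]) = altw s t (2 * k)" for k by (induction k) (auto simp: altw_Suc)
  then show ?thesis by (simp add: coxeter_relator_def)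
qed

lemma relator_one: assumes "s \<in> S" "t \<in> S" shows "wp (coxeter_relator m s t) = \<one>"
proof -
  have "coxeter_equiv S m ([] @ coxeter_relator m s t @ []) ([] @ [])"
    using assms by (intro coxeter_equiv.relator) auto
  moreover have "set (coxeter_relator m s t) \<subseteq> S" using assms altw_set[of s t] by (auto simp: altw_relator)
  ultimately show ?thesis using word_presentation[of "coxeter_relator m s t" "[]"] by simp
qed

lemma braid: assumes "s \<in> S" "t \<in> S" shows "wp (altw s t (m s t)) = wp (altw t s (m s t))"
proof -
  let ?n = "m s t" and ?f = "\<lambda>i. if even i then t else s"
  have set: "set (altw s t ?n) \<subseteq> S" "set (altw t s ?n) \<subseteq> S" using assms altw_set[of s t] altw_set[of t s] by blast+
  have "map ?f [?n..<?n+?n] = altw t s ?n"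
  proof (rule nth_equalityI)
    fix i assume "i < length (map ?f [?n..<?n+?n])"
    then show "map ?f [?n..<?n+?n] ! i = altw t s ?n ! i"
      by (auto simp: altw_def rev_nth)
  qed simp
  then have "altw s t (2 * ?n) = rev (altw t s ?n) @ altw s t ?n"
    using altw_split[of s t ?n ?n] by (simp add: mult_2)
  then have "inv (wp (altw t s ?n)) \<otimes> wp (altw s t ?n) = \<one>"
    using relator_one[OF assms] set by (simp add: altw_relator wp_append wp_rev)
  then show ?thesis using set by (metis inv_equality inv_inv inv_closed wp_closed)
qed

text \<open>These are the values \<open>U_(k-1) (cos \<theta>)\<close> of the Chebyshev polynomials
  of the second kind, with \<open>\<theta> = pi / m s t\<close>; an infinite entry is the limit as
  the angle tends to zero. They are the coefficients of the roots of a dihedral group.\<close>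

definition cheb :: "'a \<Rightarrow> 'a \<Rightarrow> nat \<Rightarrow> real" where
  "cheb s t k = (if m s t = 0 then real k else sin (real k * (pi / m s t)) / sin (pi / m s t))"

lemma cheb:
  assumes "s \<in> S" "t \<in> S" "s \<noteq> t"
  shows "cheb s t 0 = 0" "cheb s t 1 = 1" "cheb s t (Suc (Suc k)) = - cox_cf s t * cheb s t (Suc k) - cheb s t k"
    and "m s t = 0 \<or> k \<le> m s t \<Longrightarrow> 0 \<le> cheb s t k"
proof -
  have m2: "m s t = 0 \<or> m s t \<ge> 2" using matrix_off_diag[OF assms] by linarith
  define \<theta> where "\<theta> = pi / m s t"
  have sin: "sin \<theta> > 0" if "m s t \<noteq> 0"
    using m2 that by (intro sin_gt_zero) (auto simp: \<theta>_def field_simps)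
  show "cheb s t 0 = 0" by (simp add: cheb_def)
  show "cheb s t 1 = 1"
  proof (cases "m s t = 0")
    case False
    then show ?thesis using sin[OF False] by (simp add: cheb_def \<theta>_def)
  qed (simp add: cheb_def)
  show "cheb s t (Suc (Suc k)) = - cox_cf s t * cheb s t (Suc k) - cheb s t k"
  proof (cases "m s t = 0")
    case True then show ?thesis using assms by (simp add: cheb_def cox_cf_def)
  next
    case False
    define x where "x = real (Suc k) * \<theta>"
    have e: "real (Suc (Suc k)) * \<theta> = x + \<theta>" "real k * \<theta> = x - \<theta>" by (simp_all add: x_def algebra_simps)
    have "sin (x + \<theta>) = 2 * cos \<theta> * sin x - sin (x - \<theta>)" by (simp add: sin_add sin_diff)
    then have "sin (x + \<theta>) / sin \<theta> = 2 * cos \<theta> * (sin x / sin \<theta>) - sin (x - \<theta>) / sin \<theta>"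
      by (simp add: diff_divide_distrib)
    then show ?thesis using False assms
      unfolding cheb_def \<theta>_def[symmetric] e x_def[symmetric] by (simp add: cox_cf_def \<theta>_def)
  qed
  show "0 \<le> cheb s t k" if "m s t = 0 \<or> k \<le> m s t"
  proof (cases "m s t = 0")
    case True then show ?thesis by (simp add: cheb_def)
  next
    case False
    then have "real k * \<theta> \<le> pi" using that by (simp add: \<theta>_def field_simps)
    then have "sin (real k * \<theta>) \<ge> 0" by (intro sin_ge_zero) (auto simp: \<theta>_def)
    then show ?thesis using sin False by (simp add: cheb_def \<theta>_def)
  qed
qed

lemma gact_altw:
  assumes "s \<in> S" "t \<in> S" "s \<noteq> t"
  shows "gact (wp (altw s t k)) (simple s) = (\<lambda>\<phi>. cheb s t (Suc k) * \<phi> (if even k then s else t)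
     + cheb s t k * \<phi> (if even k then t else s))"
proof (induction k)
  case 0 then show ?case using cheb[OF assms] by simp
next
  case (Suc k)
  let ?a = "if even k then s else t" and ?b = "if even k then t else s"
  have ab: "?a \<in> S" "?b \<in> S" "cox_cf ?b ?a = cox_cf s t" "cox_cf ?b ?b = 2"
    using assms cox_cf_sym[OF assms(2,1)] by (auto simp: cox_cf_def[of s s] cox_cf_def[of t t])
  have "set (altw s t k) \<subseteq> S" using altw_set[of s t k] assms by blast
  then have "gact (wp (altw s t (Suc k))) (simple s) = gact ?b (gact (wp (altw s t k)) (simple s))"
    using ab by (simp add: altw_Suc gact_mult)
  also have "\<dots> = (\<lambda>\<phi>. cheb s t (Suc k) * (\<phi> ?a - cox_cf s t * \<phi> ?b) + cheb s t k * (\<phi> ?b - 2 * \<phi> ?b))"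
    unfolding Suc gact_comb gact_cmult gact_gen_simple[OF ab(2)] ab(3,4) ..
  also have "\<dots> = (\<lambda>\<phi>. cheb s t (Suc (Suc k)) * \<phi> ?b + cheb s t (Suc k) * \<phi> ?a)"
    unfolding cheb(3)[OF assms, of k] by (simp add: algebra_simps)
  finally show ?case by simp
qed

text \<open>The element \<open>x\<close> is factored as a minimal coset representative times an alternating word in a
  descent \<open>t\<close> of \<open>x\<close> and the ascent \<open>s\<close>.\<close>

theorem ascent_pos:
  assumes "x \<in> carrier G" "s \<in> S" "len x < len (x \<otimes> s)"
  shows "pos_comb S (gact x (simple s))"
  using assms
proof (induction "len x" arbitrary: x s rule: less_induct)
  case less
  show ?case
  proof (cases "x = \<one>")
    case True then show ?thesis using less.prems pos_comb_gen[of s S 1] by simp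
  next
    case False
    obtain t where t: "t \<in> S" "len x = Suc (len (x \<otimes> t))" using ex_right_descent[OF less.prems(1) False] .
    have st: "s \<noteq> t" using t less.prems by auto
    have setw: "set (altw s t k) \<subseteq> S" "set (altw t s k) \<subseteq> S" for k
      using altw_set[of s t k] altw_set[of t s k] less.prems t by blast+
    \<comment> \<open>Length-additive factorizations of \<open>x\<close> whose alternating tail ends
      in \<open>t\<close>. A tail of maximal length is taken; \<open>p\<close> is the letter that
      would prolong it on the left and \<open>q\<close> its first letter.\<close>
    define P where "P k \<longleftrightarrow> (\<exists>v \<in> carrier G. x = v \<otimes> wp (altw s t k) \<and> len x = len v + k)" for k
    have "P 1" unfolding P_def using t less.prems
      by (intro bexI[of _ "x \<otimes> t"]) (auto simp: altw_Suc[of s t 0, simplified])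
    moreover have "\<And>k. P k \<Longrightarrow> k \<le> len x" by (auto simp: P_def)
    ultimately obtain k where k: "P k" "\<And>j. P j \<Longrightarrow> j \<le> k" using Nat.ex_has_greatest_nat[of P 1 "len x"] by blast
    then have k1: "k \<ge> 1" using \<open>P 1\<close> by blast
    obtain v where v: "v \<in> carrier G" "x = v \<otimes> wp (altw s t k)" "len x = len v + k" using k(1) P_def by blast
    define p where "p = (if even k then t else s)"
    define q where "q = (if even k then s else t)"
    have pq: "p \<in> S" "q \<in> S" using t less.prems by (auto simp: p_def q_def)
    \<comment> \<open>A descent of \<open>v\<close> at \<open>p\<close> would prolong the tail,
      against maximality.\<close>
    have up_p: "len v < len (v \<otimes> p)"
    proof (rule ccontr)
      assume "\<not> len v < len (v \<otimes> p)"
      then have l: "len v = Suc (len (v \<otimes> p))" using len_right_cases[OF v(1) pq(1)] by linarith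
      have "P (Suc k)" unfolding P_def
      proof (intro bexI[of _ "v \<otimes> p"] conjI)
        show "v \<otimes> p \<in> carrier G" using v pq by simp
        have "altw s t (Suc k) = p # altw s t k" by (simp add: altw_Suc p_def)
        then show "x = v \<otimes> p \<otimes> wp (altw s t (Suc k))" using v pq setw[of k]
          by (simp add: m_assoc)
        show "len x = len (v \<otimes> p) + Suc k" using v l by simp
      qed
      then show False using k(2) by fastforce
    qed
    \<comment> \<open>A descent of \<open>v\<close> at \<open>q\<close> would absorb the first
      letter of the tail, against additivity of the lengths.\<close>
    have up_q: "len v < len (v \<otimes> q)"
    proof (rule ccontr)
      assume "\<not> len v < len (v \<otimes> q)"
      then have l: "len v = Suc (len (v \<otimes> q))" using len_right_cases[OF v(1) pq(2)] by linarith
      obtain j where j: "k = Suc j" using k1 by (cases k) auto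
      have "altw s t k = q # altw s t j" by (simp add: altw_Suc q_def j)
      then have "x = v \<otimes> q \<otimes> wp (altw s t j)" using v pq setw[of j] by (simp add: m_assoc)
      then have "len x \<le> len (v \<otimes> q) + j"
        using len_mult_le[of "v \<otimes> q" "wp (altw s t j)"] len_le[OF setw(1)[of j]] v pq setw[of j] by simp
      then show False using v l j by simp
    qed
    \<comment> \<open>Otherwise the last \<open>m s t\<close> letters of the tail can be rewritten
      by the braid relation so as to end in \<open>s\<close>, and \<open>s\<close> would be a
      descent of \<open>x\<close>. The bound makes both Chebyshev coefficients non-negative.\<close>
    have km: "k < m s t" if "m s t \<noteq> 0"
    proof (rule ccontr)
      let ?n = "m s t"
      assume "\<not> k < ?n"
      then obtain j where j: "k = ?n + j" by (metis add.commute le_Suc_ex not_less)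
      define zs where "zs = rev (map (\<lambda>i. if even i then t else s) [?n..<?n+j])"
      have zs: "set zs \<subseteq> S" "length zs = j" "altw s t k = zs @ altw s t ?n"
        using less.prems t altw_split[of s t ?n j] by (auto simp: zs_def j)
      from that have "\<exists>n'. ?n = Suc n'" by (rule not0_implies_Suc)
      then obtain n' where n': "?n = Suc n'" by (rule exE)
      have "x = v \<otimes> (wp zs \<otimes> wp (altw t s ?n))" using v zs setw[of ?n] braid[of s t] less.prems t by (simp add: wp_append)
      also have "wp (altw t s ?n) = wp (altw s t n') \<otimes> s"
        using setw[of n'] less.prems by (simp add: n' altw_snoc wp_append)
      finally have "x \<otimes> s = v \<otimes> wp (zs @ altw s t n')"
        using v zs setw[of n'] less.prems by (simp add: m_assoc wp_append)
      then have "len (x \<otimes> s) \<le> len v + (j + n')"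
        using len_mult_le[of v "wp (zs @ altw s t n')"] len_le[of "zs @ altw s t n'"] v zs setw[of n'] by simp
      then show False using v j n' less.prems by simp
    qed
    have km': "m s t = 0 \<or> k \<le> m s t" "m s t = 0 \<or> Suc k \<le> m s t"
      using km by (cases "m s t = 0"; simp)+
    have lv: "len v < len x" using v k1 by simp
    have "pos_comb {s, t} (gact (wp (altw s t k)) (simple s))"
      unfolding gact_altw[OF less.prems(2) t(1) st] using km'
      by (intro pos_comb_add pos_comb_gen cheb(4)[OF less.prems(2) t(1) st]) auto
    moreover have "pos_comb S (gact v (simple r))" if "r \<in> {s, t}" for r
    proof -
      have "r = p \<or> r = q" using that by (auto simp: p_def q_def)
      then show ?thesis using less.hyps[OF lv v(1)] up_p up_q pq by blast
    qed
    ultimately have "pos_comb S (gact v (gact (wp (altw s t k)) (simple s)))" by (rule gact_pos_comb)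
    then show ?thesis using v setw by (simp add: gact_mult)
  qed
qed


section \<open>Roots and their reflections\<close>

definition is_root :: "(('a \<Rightarrow> real) \<Rightarrow> real) \<Rightarrow> bool" where
  "is_root f \<longleftrightarrow> (\<exists>x \<in> carrier G. \<exists>s \<in> S. f = gact x (simple s))"

text \<open>A relation rather than a function: a root has two signs, and that it determines its
  reflection, independently of \<open>x\<close> and \<open>s\<close>, is a result still to
  come.\<close>

definition root_of :: "'a \<Rightarrow> (('a \<Rightarrow> real) \<Rightarrow> real) \<Rightarrow> bool" where
  "root_of t f \<longleftrightarrow> (\<exists>x \<in> carrier G. \<exists>s \<in> S. t = x \<otimes> s \<otimes> inv x \<and> f = gact x (simple s))"

lemma root_of_is_root: "root_of t f \<Longrightarrow> is_root f" unfolding root_of_def is_root_def by blast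

lemma is_root_gact: "is_root f \<Longrightarrow> x \<in> carrier G \<Longrightarrow> is_root (gact x f)"
  unfolding is_root_def by (metis gact_mult m_closed)

lemma is_root_lin: "is_root f \<Longrightarrow> lin_fun f"
  unfolding is_root_def by (auto intro: lin_gact)

lemma gact_gen_self: "s \<in> S \<Longrightarrow> gact s (simple s) = (\<lambda>\<phi>. - \<phi> s)"
  by (simp add: gact_gen_simple cox_cf_def)

lemma gact_mult_gen: "x \<in> carrier G \<Longrightarrow> s \<in> S \<Longrightarrow> gact (x \<otimes> s) (simple s) = (\<lambda>\<phi>. - gact x (simple s) \<phi>)"
  by (simp add: gact_mult gact_gen_self gact_minus)

lemma root_nonzero: assumes "is_root f" shows "f \<noteq> (\<lambda>_. 0)"
proof
  assume 0: "f = (\<lambda>_. 0)"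
  obtain x s where x: "x \<in> carrier G" "s \<in> S" "f = gact x (simple s)" using assms is_root_def by blast
  then have "simple s = gact (inv x) f" by simp
  also have "\<dots> = (\<lambda>_. 0)" unfolding 0 by (simp add: gact_def)
  finally have "simple s = (\<lambda>_. 0)" .
  from fun_cong[OF this, of one_fun] show False by simp
qed

text \<open>Either \<open>x\<close> or \<open>x \<otimes> s\<close> ascends at \<open>s\<close>, and
  the two choices give opposite roots. Roots being nonzero, the value at \<open>one_fun\<close> is a
  faithful test of the sign.\<close>

lemma root_cases:
  assumes "is_root f"
  shows "pos_comb S f \<and> f one_fun > 0 \<or> pos_comb S (\<lambda>\<phi>. - f \<phi>) \<and> f one_fun < 0"
proof -
  obtain x s where x: "x \<in> carrier G" "s \<in> S" "f = gact x (simple s)" using assms is_root_def by blast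
  have pc: "pos_comb S f \<or> pos_comb S (\<lambda>\<phi>. - f \<phi>)"
  proof (cases "len x < len (x \<otimes> s)")
    case True then show ?thesis using ascent_pos x by blast
  next
    case False
    then have "len (x \<otimes> s) < len (x \<otimes> s \<otimes> s)" using len_right_cases[OF x(1,2)] x by auto
    then have "pos_comb S (gact (x \<otimes> s) (simple s))" using ascent_pos x by blast
    then show ?thesis using x by (simp add: gact_mult_gen)
  qed
  have nz: "f one_fun \<noteq> 0"
  proof
    assume "f one_fun = 0"
    then have "f = (\<lambda>_. 0) \<or> (\<lambda>\<phi>. - f \<phi>) = (\<lambda>_. 0)" using pc pos_comb_zero[of S f] pos_comb_zero[of S "\<lambda>\<phi>. - f \<phi>"] by auto
    then show False using root_nonzero[OF assms] by (auto simp: fun_eq_iff)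
  qed
  have "0 \<le> f one_fun" if "pos_comb S f" by (rule pos_comb_nonneg[OF that]) simp
  moreover have "0 \<le> - f one_fun" if "pos_comb S (\<lambda>\<phi>. - f \<phi>)"
    using pos_comb_nonneg[OF that, of one_fun] by simp
  ultimately show ?thesis using pc nz by fastforce
qed

lemma root_posD: "is_root f \<Longrightarrow> f one_fun > 0 \<Longrightarrow> pos_comb S f"
  and root_negD: "is_root f \<Longrightarrow> f one_fun < 0 \<Longrightarrow> pos_comb S (\<lambda>\<phi>. - f \<phi>)"
  using root_cases by fastforce+

lemma root_one_nz: "is_root f \<Longrightarrow> f one_fun \<noteq> 0" using root_cases by fastforce

text \<open>The reflection \<open>s\<close> alters only the coefficient at \<open>s\<close>. The
  others are non-negative in \<open>f\<close> and non-positive in its image, hence zero.\<close>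

lemma simple_flip:
  assumes f: "is_root f" "f one_fun > 0" and s: "s \<in> S" and neg: "gact s f one_fun < 0"
  shows "f = (\<lambda>\<phi>. f one_fun * \<phi> s)"
proof -
  have pos: "pos_comb S f" using f root_posD by blast
  have "pos_comb S (\<lambda>\<phi>. - gact s f \<phi>)" using root_negD neg is_root_gact f s by blast
  then have "0 \<le> - gact s f (off_fun {s})" by (rule pos_comb_nonneg[where f = "\<lambda>\<phi>. - gact s f \<phi>"]) simp
  moreover have "gact s f (off_fun {s}) = f (off_fun {s})"
    using s by (simp add: gact_def act_gen sact_def)
  moreover have "0 \<le> f (off_fun {s})" by (rule pos_comb_nonneg[OF pos]) simp
  ultimately have "pos_comb {s} f" using pos_comb_restrict[OF pos, of "{s}"] by simp
  then show ?thesis by (rule pos_comb_singleton)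
qed

lemma descent_neg: assumes "x \<in> carrier G" "s \<in> S" "len (x \<otimes> s) < len x"
  shows "gact x (simple s) one_fun < 0"
proof -
  have "pos_comb S (gact (x \<otimes> s) (simple s))" using assms by (intro ascent_pos) auto
  then have "0 \<le> gact (x \<otimes> s) (simple s) one_fun" by (rule pos_comb_nonneg) simp
  then have "gact x (simple s) one_fun \<le> 0" using assms by (simp add: gact_mult_gen)
  moreover have "gact x (simple s) one_fun \<noteq> 0" using assms root_one_nz is_root_def by blast
  ultimately show ?thesis by simp
qed

text \<open>If \<open>p = y q y\<^sup>-\<^sup>1\<close> had root proportional to \<open>s\<close>, then \<open>s p\<close> would be unipotent with all simple
  roots staying positive, hence trivial.\<close>

lemma root_determines_reflection:
  assumes y: "y \<in> carrier G" and q: "q \<in> S" and s: "s \<in> S"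
    and c: "gact y (simple q) = (\<lambda>\<phi>. c * \<phi> s)"
  shows "y \<otimes> q \<otimes> inv y = s"
proof -
  let ?p = "y \<otimes> q \<otimes> inv y"
  have pc: "?p \<in> carrier G" using y q by simp
  have "is_root (gact y (simple q))" using y q is_root_def by blast
  from root_nonzero[OF this] have c0: "c \<noteq> 0" unfolding c by (rule contrapos_nn) simp
  have "s \<otimes> ?p = \<one>"
  proof (rule ccontr)
    assume "s \<otimes> ?p \<noteq> \<one>"
    then obtain u where u: "u \<in> S" "len (s \<otimes> ?p) = Suc (len (s \<otimes> ?p \<otimes> u))"
      using ex_right_descent[of "s \<otimes> ?p"] s pc by auto
    let ?f = "gact (s \<otimes> ?p) (simple u)"
    have neg: "?f one_fun < 0" using descent_neg[of "s \<otimes> ?p" u] u s pc by simp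
    have fr: "is_root ?f" using u s pc unfolding is_root_def by blast
    show False
    proof (cases "u = s")
      case True
      have "gact ?p (gact y (simple q)) = gact (y \<otimes> q) (simple q)"
        using y q by (simp add: m_assoc flip: gact_mult)
      also have "\<dots> = (\<lambda>\<phi>. - (c * \<phi> s))" using y q c by (simp add: gact_mult_gen)
      finally have "(\<lambda>\<phi>. c * gact ?p (simple s) \<phi>) = (\<lambda>\<phi>. c * (- \<phi> s))" unfolding c gact_cmult by simp
      then have "c * gact ?p (simple s) \<phi> = c * (- \<phi> s)" for \<phi> by (rule fun_cong)
      then have "gact ?p (simple s) = (\<lambda>\<phi>. - \<phi> s)" using c0 by (intro ext) (metis mult_left_cancel)
      then have "?f = (\<lambda>\<phi>. \<phi> s)" using True s pc by (simp add: gact_mult gact_minus gact_gen_self)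
      then show False using neg by simp
    next
      case False
      \<comment> \<open>Both \<open>?p\<close> and \<open>s\<close> change only the coefficient at
        \<open>s\<close>, so the coefficient at \<open>u\<close> stays one, which no negative root
        allows.\<close>
      have "gact ?p (simple u) = (\<lambda>\<phi>. \<phi> u - act y (cox_cf q) u * (c * \<phi> s))"
        using gact_reflection[OF y q lin_simple, of u] unfolding c by blast
      then have "?f = gact s (\<lambda>\<phi>. \<phi> u + (- act y (cox_cf q) u * c) * \<phi> s)"
        using s pc by (simp add: gact_mult mult.assoc)
      also have "\<dots> = (\<lambda>\<phi>. gact s (simple u) \<phi> + (- act y (cox_cf q) u * c) * gact s (simple s) \<phi>)"
        by (rule gact_comb)
      finally have "?f (delta_fun u) = 1" using False s by (simp add: gact_gen_simple)
      moreover have "0 \<le> - ?f (delta_fun u)"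
        using pos_comb_nonneg[OF root_negD[OF fr neg], of "delta_fun u"] by simp
      ultimately show False by simp
    qed
  qed
  then show ?thesis using s pc by (metis gen_inv inv_equality inv_inv gen_carrier)
qed

lemma root_of_simple:
  assumes "root_of t f" "f = (\<lambda>\<phi>. c * \<phi> s)" "s \<in> S"
  shows "t = s"
  using assms root_determines_reflection unfolding root_of_def by blast

lemma root_of_gact:
  assumes "root_of t f" "x \<in> carrier G" shows "root_of (x \<otimes> t \<otimes> inv x) (gact x f)"
proof -
  obtain y q where y: "y \<in> carrier G" "q \<in> S" "t = y \<otimes> q \<otimes> inv y" "f = gact y (simple q)"
    using assms root_of_def by blast
  then show ?thesis unfolding root_of_def using assms(2)
    by (intro bexI[of _ "x \<otimes> y"] bexI[of _ q]) (auto simp: gact_mult inv_mult_group m_assoc)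
qed

lemma root_of_neg:
  assumes "root_of t f" shows "root_of t (\<lambda>\<phi>. - f \<phi>)"
proof -
  obtain y q where y: "y \<in> carrier G" "q \<in> S" "t = y \<otimes> q \<otimes> inv y" "f = gact y (simple q)"
    using assms root_of_def by blast
  have "inv (y \<otimes> q) = q \<otimes> inv y" using y by (simp add: inv_mult_group)
  then have "t = y \<otimes> q \<otimes> q \<otimes> inv (y \<otimes> q)" using y by (simp add: m_assoc)
  moreover have "(\<lambda>\<phi>. - f \<phi>) = gact (y \<otimes> q) (simple q)" unfolding gact_mult_gen[OF y(1,2)] y(4) ..
  moreover have "y \<otimes> q \<in> carrier G" using y by simp
  ultimately show ?thesis unfolding root_of_def using y(2) by blast
qed

lemma T_carrier [simp, intro]: "t \<in> T \<Longrightarrow> t \<in> carrier G" by (auto simp: reflections_def)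

lemma T_iff_root: "t \<in> T \<longleftrightarrow> (\<exists>f. root_of t f)"
  unfolding reflections_def root_of_def by blast

lemma T_conj: "t \<in> T \<Longrightarrow> x \<in> carrier G \<Longrightarrow> x \<otimes> t \<otimes> inv x \<in> T"
  using T_iff_root root_of_gact by blast

lemma gen_in_T: "s \<in> S \<Longrightarrow> s \<in> T"
  using T_iff_root[of s] unfolding root_of_def by (auto intro!: bexI[of _ \<one>] bexI[of _ s])

lemma T_sq [simp]: assumes "t \<in> T" shows "t \<otimes> t = \<one>"
proof -
  obtain y q where "y \<in> carrier G" "q \<in> S" "t = y \<otimes> q \<otimes> inv y" using assms unfolding reflections_def by blast
  then show ?thesis by (simp add: m_assoc) (simp flip: m_assoc)
qed

lemma T_inv [simp]: "t \<in> T \<Longrightarrow> inv t = t" by (simp add: inv_equality)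

lemma T_cancel [simp]: "t \<in> T \<Longrightarrow> x \<in> carrier G \<Longrightarrow> x \<otimes> t \<otimes> t = x"
  "t \<in> T \<Longrightarrow> x \<in> carrier G \<Longrightarrow> t \<otimes> (t \<otimes> x) = x"
  by (simp_all add: m_assoc flip: m_assoc[of t t x])

lemma root_of_self: assumes "root_of t f" shows "gact t f = (\<lambda>\<phi>. - f \<phi>)"
proof -
  obtain y q where y: "y \<in> carrier G" "q \<in> S" "t = y \<otimes> q \<otimes> inv y" "f = gact y (simple q)"
    using assms root_of_def by blast
  then have "gact t f = gact (y \<otimes> q) (simple q)" by (simp add: m_assoc flip: gact_mult)
  then show ?thesis using y by (simp add: gact_mult_gen)
qed

lemma root_of_reflection: assumes "root_of t f" "lin_fun g"
  obtains k where "gact t g = (\<lambda>\<phi>. g \<phi> - k * f \<phi>)"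
proof -
  obtain y q where y: "y \<in> carrier G" "q \<in> S" "t = y \<otimes> q \<otimes> inv y" "f = gact y (simple q)"
    using assms root_of_def by blast
  show ?thesis by (rule that) (unfold y(3,4), rule gact_reflection[OF y(1,2) assms(2)])
qed

text \<open>The reflection sends \<open>f\<close> to \<open>- f\<close> when computed with its own
  root, and to \<open>f - k g\<close> when computed with \<open>g\<close>.\<close>

lemma root_of_unique: assumes "root_of t f" "root_of t g"
  obtains c where "c \<noteq> 0" "f = (\<lambda>\<phi>. c * g \<phi>)"
proof -
  obtain k where "gact t f = (\<lambda>\<phi>. f \<phi> - k * g \<phi>)"
    using root_of_reflection[OF assms(2) is_root_lin[OF root_of_is_root[OF assms(1)]]] .
  then have "- f \<phi> = f \<phi> - k * g \<phi>" for \<phi> using fun_cong[OF root_of_self[OF assms(1)], of \<phi>] by simp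
  then have "2 * f \<phi> = k * g \<phi>" for \<phi> by (metis add.commute add_uminus_conv_diff diff_add_cancel diff_minus_eq_add mult_2)
  then have "f \<phi> = (k / 2) * g \<phi>" for \<phi> by (metis mult.commute nonzero_mult_div_cancel_left times_divide_eq_right zero_neq_numeral)
  then have f: "f = (\<lambda>\<phi>. (k / 2) * g \<phi>)" by (rule ext)
  have "k / 2 \<noteq> 0"
  proof
    assume "k / 2 = 0"
    then have "f = (\<lambda>_. 0)" using f by simp
    then show False using root_nonzero[OF root_of_is_root[OF assms(1)]] by simp
  qed
  then show ?thesis using that f by blast
qed

lemma root_of_inj: assumes f: "root_of t f" and g: "root_of t' g" and c: "f = (\<lambda>\<phi>. c * g \<phi>)"
  shows "t = t'"
proof -
  obtain y q where y: "y \<in> carrier G" "q \<in> S" "t' = y \<otimes> q \<otimes> inv y" "g = gact y (simple q)"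
    using g root_of_def by blast
  have tc: "t \<in> carrier G" using f T_iff_root by blast
  have "root_of (inv y \<otimes> t \<otimes> inv (inv y)) (gact (inv y) f)" using root_of_gact f y by blast
  moreover have "gact (inv y) f = (\<lambda>\<phi>. c * \<phi> q)" using y unfolding c by (simp add: gact_cmult)
  ultimately have "inv y \<otimes> t \<otimes> y = q" using root_of_simple y by fastforce
  then show ?thesis using y tc by (metis inv_closed inv_solve_left' inv_solve_right m_assoc m_closed)
qed

text \<open>Strong exchange: when the letters act from right to left, the root turns negative at
  some letter, and just before it is a multiple of the simple root of that letter.\<close>

lemma exchange_split:
  assumes "root_of t f" "f one_fun > 0" "set ws \<subseteq> S" "gact (wp ws) f one_fun < 0"
  shows "\<exists>as s bs. ws = as @ s # bs \<and> wp bs \<otimes> t \<otimes> inv (wp bs) = s"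
  using assms(3,4)
proof (induction ws)
  case Nil then show ?case using assms by simp
next
  case (Cons a ws)
  have c: "a \<in> S" "set ws \<subseteq> S" using Cons.prems by auto
  show ?case
  proof (cases "gact (wp ws) f one_fun < 0")
    case True
    then obtain as s bs where "ws = as @ s # bs" "wp bs \<otimes> t \<otimes> inv (wp bs) = s" using Cons.IH c by blast
    then show ?thesis by (intro exI[of _ "a # as"] exI[of _ s] exI[of _ bs]) simp
  next
    case False
    let ?g = "gact (wp ws) f"
    have g: "root_of (wp ws \<otimes> t \<otimes> inv (wp ws)) ?g" using root_of_gact assms(1) c by blast
    then have r: "is_root ?g" by (rule root_of_is_root)
    have "?g one_fun > 0" using False root_one_nz[OF r] by linarith
    moreover have "gact a ?g one_fun < 0" using Cons.prems c by (simp add: gact_mult)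
    ultimately have "?g = (\<lambda>\<phi>. ?g one_fun * \<phi> a)" using simple_flip r c by blast
    then have "wp ws \<otimes> t \<otimes> inv (wp ws) = a" using root_of_simple g c by blast
    then show ?thesis by (intro exI[of _ "[]"]) auto
  qed
qed

lemma root_neg_len:
  assumes "root_of t f" "f one_fun > 0" "x \<in> carrier G" "gact x f one_fun < 0"
  shows "len (x \<otimes> t) < len x"
proof -
  obtain ws where ws: "set ws \<subseteq> S" "wp ws = x" "length ws = len x" using reduced_word[OF assms(3)] .
  then obtain as s bs where sp: "ws = as @ s # bs" "wp bs \<otimes> t \<otimes> inv (wp bs) = s"
    using exchange_split[OF assms(1,2), of ws] assms(4) by auto
  have tc: "t \<in> carrier G" using assms T_iff_root by blast
  have c: "set as \<subseteq> S" "s \<in> S" "set bs \<subseteq> S" using ws sp by auto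
  have "wp bs \<otimes> t = s \<otimes> wp bs" using sp(2) tc c by (metis inv_solve_right m_closed wp_closed gen_carrier)
  then have "x \<otimes> t = wp (as @ bs)" using c tc ws sp(1)
    by (auto simp: wp_append m_assoc)
  then show ?thesis using len_le[of "as @ bs"] c ws sp by simp
qed

text \<open>The choice is determined up to a positive factor, which the normalization in
  \<open>nrt\<close> cancels.\<close>

definition rt :: "'a \<Rightarrow> ('a \<Rightarrow> real) \<Rightarrow> real" where
  "rt t = (SOME f. root_of t f \<and> f one_fun > 0)"

lemma rt: assumes "t \<in> T" shows "root_of t (rt t)" "rt t one_fun > 0"
proof -
  obtain f where f: "root_of t f" using assms T_iff_root by blast
  then have "f one_fun > 0 \<or> (- f one_fun) > 0" using root_one_nz[OF root_of_is_root] by fastforce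
  then have "\<exists>f. root_of t f \<and> f one_fun > 0"
    using f root_of_neg[OF f] by (elim disjE) (rule exI[of _ f], simp, rule exI[of _ "\<lambda>\<phi>. - f \<phi>"], simp)
  then have "root_of t (rt t) \<and> rt t one_fun > 0" unfolding rt_def by (rule someI_ex)
  then show "root_of t (rt t)" "rt t one_fun > 0" by auto
qed

lemma rt_is_root: "t \<in> T \<Longrightarrow> is_root (rt t)" using rt root_of_is_root by blast

lemma gact_rt_nz: assumes "t \<in> T" "x \<in> carrier G" shows "gact x (rt t) one_fun \<noteq> 0"
  by (rule root_one_nz[OF is_root_gact[OF rt_is_root]]) fact+

text \<open>The dictionary between Bruhat steps and roots. Strong exchange covers a negative image;
  a positive one is reduced to it by passing to \<open>x \<otimes> t\<close>, since \<open>t\<close>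
  negates its root.\<close>

lemma rt_sign:
  assumes "t \<in> T" "x \<in> carrier G"
  shows "gact x (rt t) one_fun > 0 \<longleftrightarrow> len x < len (x \<otimes> t)"
proof -
  have neg: "len (y \<otimes> t) < len y" if "y \<in> carrier G" "gact y (rt t) one_fun < 0" for y
    using root_neg_len rt[OF assms(1)] that by blast
  have "gact x (rt t) one_fun \<noteq> 0" using gact_rt_nz assms .
  moreover have "gact (x \<otimes> t) (rt t) one_fun = - gact x (rt t) one_fun"
    using assms rt[OF assms(1)] by (simp add: gact_mult root_of_self gact_minus)
  then have "len x < len (x \<otimes> t)" if "gact x (rt t) one_fun > 0"
    using neg[of "x \<otimes> t"] assms that by simp
  ultimately show ?thesis using neg[of x] assms by fastforce
qed

text \<open>Left multiplication by \<open>s\<close> changes the sign only of roots proportional to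
  the simple root of \<open>s\<close>, and such a step is the crossing from \<open>x\<close> to
  \<open>s \<otimes> x\<close>. This is the core of the lifting property.\<close>

lemma step_left:
  assumes "x \<in> carrier G" "t \<in> T" "s \<in> S" "len x < len (x \<otimes> t)" "x \<otimes> t \<noteq> s \<otimes> x"
  shows "len (s \<otimes> x) < len (s \<otimes> x \<otimes> t)"
proof (rule ccontr)
  assume "\<not> ?thesis"
  then have "\<not> gact (s \<otimes> x) (rt t) one_fun > 0" using rt_sign assms by simp
  moreover have "gact (s \<otimes> x) (rt t) one_fun \<noteq> 0"
    using gact_rt_nz assms by simp
  ultimately have neg: "gact s (gact x (rt t)) one_fun < 0" using assms by (simp add: gact_mult)
  have r: "root_of (x \<otimes> t \<otimes> inv x) (gact x (rt t))" using root_of_gact rt assms by blast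
  have "gact x (rt t) = (\<lambda>\<phi>. gact x (rt t) one_fun * \<phi> s)"
    using neg r root_of_is_root rt_sign assms by (intro simple_flip) auto
  then have "x \<otimes> t \<otimes> inv x = s" using root_of_simple r assms by blast
  then show False using assms by (metis inv_solve_right T_carrier gen_carrier m_closed)
qed

section \<open>Parabolic subgroups and their roots\<close>

lemma parabolic_word:
  assumes "J \<subseteq> S" shows "h \<in> parabolic G J \<longleftrightarrow> (\<exists>ws. set ws \<subseteq> J \<and> h = wp ws)"
  unfolding parabolic_def generate_words[OF assms] by auto

lemma parabolic_subgroup: "J \<subseteq> S \<Longrightarrow> subgroup (parabolic G J) G"
  unfolding parabolic_def using gens_closed by (intro generate_is_subgroup) auto

lemma parabolic_neg_root:
  assumes J: "J \<subseteq> S" and b: "b \<in> parabolic G J" and f: "root_of t f" "f one_fun > 0" "gact b f one_fun < 0"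
  shows "t \<in> parabolic G J"
proof -
  interpret H: subgroup "parabolic G J" G using parabolic_subgroup[OF J] .
  obtain ws where ws: "set ws \<subseteq> J" "b = wp ws" using parabolic_word[OF J] b by blast
  then obtain as s bs where sp: "ws = as @ s # bs" "wp bs \<otimes> t \<otimes> inv (wp bs) = s"
    using exchange_split[OF f(1,2), of ws] f(3) J by (metis subset_trans)
  have c: "set bs \<subseteq> S" "s \<in> S" using ws sp J by auto
  have tc: "t \<in> carrier G" using f T_iff_root by blast
  have "set bs \<subseteq> J" "set [s] \<subseteq> J" using ws sp by auto
  then have "wp bs \<in> parabolic G J" "wp [s] \<in> parabolic G J" using parabolic_word[OF J] by blast+
  moreover have "t = inv (wp bs) \<otimes> wp [s] \<otimes> wp bs" using sp(2)[symmetric] tc c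
    by (simp add: m_assoc) (simp flip: m_assoc)
  ultimately show ?thesis by simp
qed

text \<open>The function \<open>off_fun J\<close> vanishes on \<open>J\<close> and is therefore
  fixed by every generator in \<open>J\<close>.\<close>

lemma gact_parabolic_off:
  assumes J: "J \<subseteq> S" and b: "b \<in> parabolic G J" shows "gact b f (off_fun J) = f (off_fun J)"
proof -
  interpret H: subgroup "parabolic G J" G using parabolic_subgroup[OF J] .
  obtain ws where ws: "set ws \<subseteq> J" "inv b = wp ws" using parabolic_word[OF J] b H.m_inv_closed by blast
  have "wact ws (off_fun J) = off_fun J" using ws(1)
    by (induction ws) (auto simp: wact_def sact_def)
  then show ?thesis using ws J by (simp add: gact_def act_wp)
qed

lemma parabolic_min_rep:
  assumes J: "J \<subseteq> S" and x: "x \<in> carrier G"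
  obtains a b where "a \<in> carrier G" "b \<in> parabolic G J" "x = a \<otimes> b" "\<And>s. s \<in> J \<Longrightarrow> len a < len (a \<otimes> s)"
proof -
  interpret H: subgroup "parabolic G J" G using parabolic_subgroup[OF J] .
  define P where "P n \<longleftrightarrow> (\<exists>h \<in> parabolic G J. len (x \<otimes> h) = n)" for n
  have "P (len (x \<otimes> \<one>))" unfolding P_def using H.one_closed by blast
  then have "P (LEAST n. P n)" by (rule LeastI)
  then obtain h where h: "h \<in> parabolic G J" "len (x \<otimes> h) = (LEAST n. P n)" unfolding P_def by blast
  have le: "len (x \<otimes> h) \<le> len (x \<otimes> g)" if "g \<in> parabolic G J" for g
    unfolding h(2) by (rule Least_le) (use that P_def in blast)
  show ?thesis
  proof (rule that)
    show "x \<otimes> h \<in> carrier G" "inv h \<in> parabolic G J" using x h by auto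
    show "x = x \<otimes> h \<otimes> inv h" using x h H.mem_carrier by (simp add: m_assoc)
    fix s assume s: "s \<in> J"
    then have "s \<in> parabolic G J" unfolding parabolic_def by (rule generate.incl)
    then have "len (x \<otimes> h) \<le> len (x \<otimes> h \<otimes> s)" using le[of "h \<otimes> s"] h x H.mem_carrier by (simp add: m_assoc)
    then show "len (x \<otimes> h) < len (x \<otimes> h \<otimes> s)"
      using len_right_cases[of "x \<otimes> h" s] s J x h H.mem_carrier by auto
  qed
qed

text \<open>For the converse write \<open>t = a \<otimes> b\<close> with \<open>a\<close> shortest
  in its coset. The image under \<open>b\<close> of the root is supported on \<open>J\<close>. If it
  were positive, \<open>a\<close> would keep it positive, although \<open>t\<close> negates the
  root; so \<open>b\<close> makes it negative, and strong exchange within a word over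
  \<open>J\<close> exhibits \<open>t\<close> as an element of the subgroup.\<close>

lemma rt_off_parabolic:
  assumes J: "J \<subseteq> S" and t: "t \<in> T"
  shows "rt t (off_fun J) = 0 \<longleftrightarrow> t \<in> parabolic G J"
proof
  interpret H: subgroup "parabolic G J" G using parabolic_subgroup[OF J] .
  show "rt t (off_fun J) = 0" if "t \<in> parabolic G J"
    using gact_parabolic_off[OF J that, of "rt t"] root_of_self[OF rt(1)[OF t]] by simp
  assume z: "rt t (off_fun J) = 0"
  obtain a b where ab: "a \<in> carrier G" "b \<in> parabolic G J" "t = a \<otimes> b" "\<And>s. s \<in> J \<Longrightarrow> len a < len (a \<otimes> s)"
    using parabolic_min_rep[OF J, of t] t by blast
  let ?g = "gact b (rt t)"
  have bc: "b \<in> carrier G" using ab H.mem_carrier by blast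
  have gr: "is_root ?g" using is_root_gact rt_is_root t bc by blast
  have "?g one_fun < 0"
  proof (rule ccontr)
    assume "\<not> ?g one_fun < 0"
    then have "?g one_fun > 0" using root_one_nz[OF gr] by linarith
    then have "pos_comb S ?g" using root_posD gr by blast
    then have "pos_comb J ?g" by (rule pos_comb_restrict) (simp add: gact_parabolic_off[OF J ab(2)] z)
    then have "pos_comb S (gact a ?g)" by (rule gact_pos_comb) (use ab J ascent_pos in blast)
    then have "0 \<le> gact a ?g one_fun" by (rule pos_comb_nonneg) simp
    moreover have "gact a ?g = (\<lambda>\<phi>. - rt t \<phi>)"
      using root_of_self[OF rt(1)[OF t]] ab bc by (metis gact_mult)
    ultimately show False using rt(2)[OF t] by simp
  qed
  then show "t \<in> parabolic G J" using parabolic_neg_root[OF J ab(2)] rt[OF t] by blast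
qed

section \<open>Left multiplication seen as a step with a label\<close>

definition lab :: "'a \<Rightarrow> 'a \<Rightarrow> 'a" where "lab s x = inv x \<otimes> s \<otimes> x"
definition asc :: "'a \<Rightarrow> 'a \<Rightarrow> bool" where "asc s x \<longleftrightarrow> len x < len (s \<otimes> x)"

lemma lab_T: "s \<in> S \<Longrightarrow> x \<in> carrier G \<Longrightarrow> lab s x \<in> T"
  unfolding lab_def using T_conj[of s "inv x"] gen_in_T by simp

lemma mult_lab: "s \<in> S \<Longrightarrow> x \<in> carrier G \<Longrightarrow> x \<otimes> lab s x = s \<otimes> x"
  unfolding lab_def by (simp flip: m_assoc)

lemma lab_left: "s \<in> S \<Longrightarrow> x \<in> carrier G \<Longrightarrow> lab s (s \<otimes> x) = lab s x"
  unfolding lab_def by (simp add: inv_mult_group m_assoc)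

lemma lab_mult: "s \<in> S \<Longrightarrow> x \<in> carrier G \<Longrightarrow> t \<in> T \<Longrightarrow> lab s (x \<otimes> t) = t \<otimes> lab s x \<otimes> inv t"
  unfolding lab_def by (simp add: inv_mult_group m_assoc)

text \<open>The labels are conjugate under \<open>t\<close>, which gives the linear relation.
  Applying \<open>x \<otimes> t\<close> to the reflected root is the same as applying
  \<open>x\<close> to the original one, so the sign of \<open>d\<close> records whether
  \<open>s\<close> behaves alike at both ends of the step.\<close>

lemma rt_lab_relation:
  assumes x: "x \<in> carrier G" and s: "s \<in> S" and t: "t \<in> T"
  obtains k d where "d \<noteq> 0" "\<And>\<phi>. rt (lab s x) \<phi> - k * rt t \<phi> = d * rt (lab s (x \<otimes> t)) \<phi>"
    "d > 0 \<longleftrightarrow> asc s x = asc s (x \<otimes> t)"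
proof -
  let ?r = "lab s x" and ?r' = "lab s (x \<otimes> t)"
  have T: "?r \<in> T" "?r' \<in> T" using lab_T x s t by auto
  obtain k where k: "gact t (rt ?r) = (\<lambda>\<phi>. rt ?r \<phi> - k * rt t \<phi>)"
    using root_of_reflection[OF rt(1)[OF t] is_root_lin[OF rt_is_root[OF T(1)]]] .
  have "root_of ?r' (gact t (rt ?r))" using root_of_gact[OF rt(1)[OF T(1)], of t] t lab_mult x s by simp
  then obtain d where d: "d \<noteq> 0" "gact t (rt ?r) = (\<lambda>\<phi>. d * rt ?r' \<phi>)"
    using root_of_unique rt(1)[OF T(2)] by metis
  have "gact (x \<otimes> t) (gact t (rt ?r)) = gact x (rt ?r)" using x t by (simp flip: gact_mult)
  then have e: "gact x (rt ?r) one_fun = d * gact (x \<otimes> t) (rt ?r') one_fun"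
    unfolding d gact_cmult by metis
  have 1: "gact x (rt ?r) one_fun > 0 \<longleftrightarrow> asc s x" 
    using rt_sign[OF T(1) x] mult_lab x s by (simp add: asc_def)
  have 2: "gact (x \<otimes> t) (rt ?r') one_fun > 0 \<longleftrightarrow> asc s (x \<otimes> t)"
    using rt_sign[OF T(2), of "x \<otimes> t"] mult_lab[of s "x \<otimes> t"] x s t by (simp add: asc_def)
  have "gact x (rt ?r) one_fun \<noteq> 0" using gact_rt_nz T x by blast
  moreover have "gact (x \<otimes> t) (rt ?r') one_fun \<noteq> 0" using gact_rt_nz T x t by simp
  ultimately have "d > 0 \<longleftrightarrow> asc s x = asc s (x \<otimes> t)" using 1 2 e d(1)
    by (smt (verit) mult_less_0_iff zero_less_mult_iff)
  then show ?thesis using that[OF d(1)] k d(2) by metis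
qed

end

section \<open>A total order on the reflections\<close>

definition lexless :: "'a rel \<Rightarrow> ('a \<Rightarrow> real) \<Rightarrow> ('a \<Rightarrow> real) \<Rightarrow> bool" where
  "lexless W f g \<longleftrightarrow> (\<exists>u. f u < g u \<and> (\<forall>v. (v, u) \<in> W \<and> v \<noteq> u \<longrightarrow> f v = g v))"

lemma lexless_trans:
  assumes W: "well_order_on UNIV W" and "lexless W f g" "lexless W g h"
  shows "lexless W f h"
proof -
  have lin: "linear_order_on UNIV W" using W by (simp add: well_order_on_def)
  have tr: "trans W" and tot: "total W" and an: "antisym W"
    using lin by (auto simp: linear_order_on_def partial_order_on_def preorder_on_def)
  obtain u where u: "f u < g u" "\<And>v. (v, u) \<in> W \<Longrightarrow> v \<noteq> u \<Longrightarrow> f v = g v" using assms lexless_def by metis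
  obtain v where v: "g v < h v" "\<And>x. (x, v) \<in> W \<Longrightarrow> x \<noteq> v \<Longrightarrow> g x = h x" using assms lexless_def by metis
  consider "u = v" | "(u, v) \<in> W" "u \<noteq> v" | "(v, u) \<in> W" "u \<noteq> v" using tot by (auto simp: total_on_def)
  then show ?thesis
  proof cases
    case 1 then show ?thesis unfolding lexless_def using u v by (intro exI[of _ u]) auto
  next
    case 2
    have "f x = h x" if "(x, u) \<in> W" "x \<noteq> u" for x
      using u(2)[OF that] v(2)[of x] transD[OF tr that(1) 2(1)] antisymD[OF an] that 2 by auto
    then show ?thesis unfolding lexless_def using u(1) v(2)[OF 2] by (intro exI[of _ u]) auto
  next
    case 3
    have "f x = h x" if "(x, v) \<in> W" "x \<noteq> v" for x
      using v(2)[OF that] u(2)[of x] transD[OF tr that(1) 3(1)] antisymD[OF an] that 3 by auto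
    then show ?thesis unfolding lexless_def using v(1) u(2)[OF 3(1)] 3(2) by (intro exI[of _ v]) auto
  qed
qed

lemma lexless_total:
  assumes W: "well_order_on UNIV W" and "f \<noteq> g"
  shows "lexless W f g \<or> lexless W g f"
proof -
  have wf: "wf (W - Id)" using W by (simp add: well_order_on_def)
  obtain z where "f z \<noteq> g z" using assms(2) by auto
  then obtain u where u: "f u \<noteq> g u" "\<And>v. (v, u) \<in> W - Id \<Longrightarrow> \<not> f v \<noteq> g v"
    using wfE_min[OF wf, of z "{z. f z \<noteq> g z}"] by auto
  then show ?thesis unfolding lexless_def by (metis DiffI IdE linorder_neqE_linordered_idom prod.inject)
qed

text \<open>A proper convex combination first differs from either end at the very index that
  separates the ends.\<close>

lemma lexless_mix:
  assumes "lexless W f g" "a > 0" "b > 0" "a + b = 1" "\<And>u. h u = a * f u + b * g u"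
  shows "lexless W f h" "lexless W h g"
proof -
  obtain u where u: "f u < g u" "\<And>v. (v, u) \<in> W \<Longrightarrow> v \<noteq> u \<Longrightarrow> f v = g v" using assms lexless_def by metis
  have a: "a = 1 - b" using assms by simp
  have h1: "h v = f v + b * (g v - f v)" for v unfolding assms(5) a by (simp add: algebra_simps)
  have h2: "h v = g v - a * (g v - f v)" for v unfolding assms(5) a by (simp add: algebra_simps)
  show "lexless W f h" unfolding lexless_def using u assms(3) by (intro exI[of _ u]) (auto simp: h1)
  show "lexless W h g" unfolding lexless_def using u assms(2) by (intro exI[of _ u]) (auto simp: h2)
qed

text \<open>The interface between roots and chains. In \<open>prec_same\<close> the crossing label
  stays on the same side of \<open>t\<close>; in \<open>prec_opp\<close> the label \<open>t\<close>
  lies between the old and the new crossing label.\<close>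

locale labelled_coxeter = coxeter_system +
  fixes J :: "'a set" and prec :: "'a \<Rightarrow> 'a \<Rightarrow> bool" (infix "\<ll>" 50)
  assumes J_sub: "J \<subseteq> S"
    and prec_irrefl: "\<not> t \<ll> t"
    and prec_trans: "t \<ll> t' \<Longrightarrow> t' \<ll> t'' \<Longrightarrow> t \<ll> t''"
    and prec_total: "t \<in> T \<Longrightarrow> t' \<in> T \<Longrightarrow> t \<noteq> t' \<Longrightarrow> t \<ll> t' \<or> t' \<ll> t"
    and prec_same: "x \<in> carrier G \<Longrightarrow> s \<in> S \<Longrightarrow> t \<in> T \<Longrightarrow> t \<noteq> lab s x \<Longrightarrow> asc s x = asc s (x \<otimes> t)
      \<Longrightarrow> t \<ll> lab s x \<longleftrightarrow> t \<ll> lab s (x \<otimes> t)"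
    and prec_opp: "x \<in> carrier G \<Longrightarrow> s \<in> S \<Longrightarrow> t \<in> T \<Longrightarrow> t \<noteq> lab s x \<Longrightarrow> asc s x \<noteq> asc s (x \<otimes> t)
      \<Longrightarrow> t \<ll> lab s x \<longleftrightarrow> lab s (x \<otimes> t) \<ll> t"
    and prec_parabolic: "t \<in> T \<Longrightarrow> t \<in> parabolic G J \<Longrightarrow> r \<in> T \<Longrightarrow> r \<notin> parabolic G J \<Longrightarrow> r \<ll> t"

text \<open>Reflections are compared through their normalized roots: first by the total weight outside \<open>J\<close>,
  then lexicographically. Since the order is compatible with convex combinations, a reflection whose
  root is a positive combination of two others lies between them.\<close>

context coxeter_system begin

definition nrt :: "'a \<Rightarrow> ('a \<Rightarrow> real) \<Rightarrow> real" where "nrt t \<phi> = rt t \<phi> / rt t one_fun"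

text \<open>The first comparison is reversed: more weight outside \<open>J\<close> means earlier, so
  that the parabolic reflections, of weight zero, come last.\<close>

definition root_prec :: "'a rel \<Rightarrow> 'a set \<Rightarrow> 'a \<Rightarrow> 'a \<Rightarrow> bool" where
  "root_prec W J t r \<longleftrightarrow> nrt r (off_fun J) < nrt t (off_fun J) \<or>
    nrt r (off_fun J) = nrt t (off_fun J) \<and> lexless W (\<lambda>u. nrt t (delta_fun u)) (\<lambda>u. nrt r (delta_fun u))"

lemma root_prec_mix:
  assumes T: "t \<in> T" "r \<in> T" "q \<in> T" and "A > 0" "B > 0" "C > 0"
    and eq: "\<And>\<phi>. C * rt q \<phi> = A * rt t \<phi> + B * rt r \<phi>"
    and prec: "root_prec W J t r"
  shows "root_prec W J t q" "root_prec W J q r"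
proof -
  define c where "c = C * rt q one_fun"
  define a where "a = A * rt t one_fun / c"
  define b where "b = B * rt r one_fun / c"
  note p = rt(2)[OF T(1)] rt(2)[OF T(2)] rt(2)[OF T(3)]
  have c: "c > 0" using p(3) assms(6) unfolding c_def by (rule mult_pos_pos[rotated])
  have ab: "a > 0" "b > 0" using p c assms by (simp_all add: a_def b_def)
  have "c = A * rt t one_fun + B * rt r one_fun" unfolding c_def by (rule eq)
  then have sum: "a + b = 1" using c unfolding a_def b_def by (simp flip: add_divide_distrib)
  have mix: "nrt q \<phi> = a * nrt t \<phi> + b * nrt r \<phi>" for \<phi>
  proof -
    have "nrt q \<phi> = C * rt q \<phi> / c" using assms(6) by (simp add: nrt_def c_def)
    also have "\<dots> = A * rt t \<phi> / c + B * rt r \<phi> / c" unfolding eq by (rule add_divide_distrib)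
    also have "\<dots> = a * nrt t \<phi> + b * nrt r \<phi>" using p by (simp add: nrt_def a_def b_def)
    finally show ?thesis .
  qed
  have a1: "a = 1 - b" using sum by simp
  have h1: "nrt q \<phi> = nrt t \<phi> + b * (nrt r \<phi> - nrt t \<phi>)" for \<phi> unfolding mix a1 by (simp add: algebra_simps)
  have h2: "nrt q \<phi> = nrt r \<phi> - a * (nrt r \<phi> - nrt t \<phi>)" for \<phi> unfolding mix a1 by (simp add: algebra_simps)
  have "root_prec W J t q \<and> root_prec W J q r"
  proof (cases "nrt r (off_fun J) < nrt t (off_fun J)")
    case True
    then have "nrt q (off_fun J) < nrt t (off_fun J)" unfolding h1 using ab by (simp add: mult_less_0_iff)
    moreover have "nrt r (off_fun J) < nrt q (off_fun J)" unfolding h2 using ab True by (simp add: mult_less_0_iff)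
    ultimately show ?thesis unfolding root_prec_def by blast
  next
    case False
    then have e: "nrt r (off_fun J) = nrt t (off_fun J)"
      and l: "lexless W (\<lambda>u. nrt t (delta_fun u)) (\<lambda>u. nrt r (delta_fun u))"
      using prec unfolding root_prec_def by auto
    have "nrt q (off_fun J) = nrt t (off_fun J)" unfolding h1 e by simp
    then show ?thesis unfolding root_prec_def
      using e lexless_mix[OF l ab sum, of "\<lambda>u. nrt q (delta_fun u)", OF mix] by simp
  qed
  then show "root_prec W J t q" "root_prec W J q r" by auto
qed

text \<open>Incomparable reflections have the same normalized coefficients, hence proportional
  roots.\<close>

lemma root_prec_total:
  assumes W: "well_order_on UNIV W" and T: "t \<in> T" "r \<in> T" "t \<noteq> r"
  shows "root_prec W J t r \<or> root_prec W J r t"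
proof (rule ccontr)
  assume "\<not> ?thesis"
  then have "\<not> lexless W (\<lambda>u. nrt t (delta_fun u)) (\<lambda>u. nrt r (delta_fun u))"
    "\<not> lexless W (\<lambda>u. nrt r (delta_fun u)) (\<lambda>u. nrt t (delta_fun u))"
    unfolding root_prec_def by auto
  then have "(\<lambda>u. nrt t (delta_fun u)) = (\<lambda>u. nrt r (delta_fun u))" using lexless_total[OF W] by blast
  then have e: "nrt t (delta_fun u) = nrt r (delta_fun u)" for u by (rule fun_cong)
  note p = rt(2)[OF T(1)] rt(2)[OF T(2)]
  let ?c = "rt t one_fun / rt r one_fun"
  have "rt t = (\<lambda>\<phi>. ?c * rt r \<phi>)"
  proof (rule pos_comb_eqI)
    show "pos_comb S (rt t)" using root_posD rt_is_root p T by blast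
    have "pos_comb S (rt r)" using root_posD rt_is_root p T by blast
    then show "pos_comb S (\<lambda>\<phi>. ?c * rt r \<phi>)" using p by (intro pos_comb_scale) auto
    fix u show "rt t (delta_fun u) = ?c * rt r (delta_fun u)"
      using e[of u] p by (simp add: nrt_def field_simps)
  qed
  then show False using root_of_inj[OF rt(1)[OF T(1)] rt(1)[OF T(2)]] T(3) by blast
qed

lemma lab_neq_self:
  assumes "x \<in> carrier G" "s \<in> S" "t \<in> T" "t \<noteq> lab s x" shows "t \<noteq> lab s (x \<otimes> t)"
proof
  assume "t = lab s (x \<otimes> t)"
  then have "x \<otimes> t \<otimes> t = s \<otimes> (x \<otimes> t)" using mult_lab[of s "x \<otimes> t"] assms by simp
  then have "x = s \<otimes> (x \<otimes> t)" using assms by simp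
  then have "s \<otimes> x = s \<otimes> (s \<otimes> (x \<otimes> t))" by (rule arg_cong)
  then have "s \<otimes> x = x \<otimes> t" using assms by simp
  then show False using assms mult_lab[of s x] lab_T by simp
qed

theorem ex_reflection_order:
  assumes J: "J \<subseteq> S"
  shows "\<exists>prec. labelled_coxeter G S m J prec"
proof -
  obtain W :: "'a rel" where W: "well_order_on UNIV W" using well_order_on by blast
  define P where "P = root_prec W J"
  have irr: "\<not> P t t" for t by (simp add: P_def root_prec_def lexless_def)
  have tr: "P t t'" if "P t t0" "P t0 t'" for t t0 t'
    using that lexless_trans[OF W] unfolding P_def root_prec_def by fastforce
  have tot: "P t r \<or> P r t" if "t \<in> T" "r \<in> T" "t \<noteq> r" for t r
    unfolding P_def by (rule root_prec_total[OF W that])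
  have mix: "P t r \<Longrightarrow> P t q \<and> P q r" "P r t \<Longrightarrow> P r q \<and> P q t"
    if "t \<in> T" "r \<in> T" "q \<in> T" "A > 0" "B > 0" "C > 0" "\<And>\<phi>. C * rt q \<phi> = A * rt t \<phi> + B * rt r \<phi>" for t r q A B C
    using root_prec_mix[of t r q A B C W J] root_prec_mix[of r t q B A C W J] that
    unfolding P_def by (auto simp: add.commute)
  have "labelled_coxeter G S m J P"
  proof (unfold_locales, goal_cases)
    case 1 show ?case by (rule J)
  next
    case (2 t) show ?case by (rule irr)
  next
    case (3 t t' t'') then show ?case using tr by blast
  next
    case (4 t t') then show ?case by (rule tot)
  next
    case (5 x s t)
    let ?r = "lab s x" and ?r' = "lab s (x \<otimes> t)"
    have T: "?r \<in> T" "?r' \<in> T" using lab_T 5 by auto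
    have ne: "t \<noteq> ?r'" using lab_neq_self 5 by blast
    obtain k d where kd: "d \<noteq> 0" "\<And>\<phi>. rt ?r \<phi> - k * rt t \<phi> = d * rt ?r' \<phi>" "d > 0 \<longleftrightarrow> asc s x = asc s (x \<otimes> t)"
      using rt_lab_relation[OF 5(1,2,3)] by metis
    have d: "d > 0" using kd 5 by simp
    \<comment> \<open>For \<open>k = 0\<close> the labels agree. For negative \<open>k\<close> the
      new label lies between the old one and \<open>t\<close>; for positive \<open>k\<close> the old
      one lies between the new one and \<open>t\<close>.\<close>
    consider "k = 0" | "k < 0" | "k > 0" by linarith
    then show ?case
    proof cases
      case 1
      then have "rt ?r = (\<lambda>\<phi>. d * rt ?r' \<phi>)" using kd(2) by (intro ext) simp
      then have "?r = ?r'" using root_of_inj[OF rt(1)[OF T(1)] rt(1)[OF T(2)]] by blast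
      then show ?thesis by simp
    next
      case 2
      have e: "d * rt ?r' \<phi> = 1 * rt ?r \<phi> + (- k) * rt t \<phi>" for \<phi> using kd(2)[of \<phi>] by simp
      have "P t ?r \<Longrightarrow> P t ?r'" "P ?r t \<Longrightarrow> P ?r' t"
        using mix[OF T(1) 5(3) T(2) zero_less_one _ d e] 2 by auto
      then show ?thesis using tot[OF 5(3) T(1) 5(4)] irr tr by blast
    next
      case 3
      have e: "1 * rt ?r \<phi> = d * rt ?r' \<phi> + k * rt t \<phi>" for \<phi> using kd(2)[of \<phi>] by simp
      have "P t ?r' \<Longrightarrow> P t ?r" "P ?r' t \<Longrightarrow> P ?r t"
        using mix[OF T(2) 5(3) T(1) d 3 zero_less_one e] by auto
      then show ?thesis using tot[OF 5(3) T(2) ne] irr tr by blast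
    qed
  next
    case (6 x s t)
    let ?r = "lab s x" and ?r' = "lab s (x \<otimes> t)"
    have T: "?r \<in> T" "?r' \<in> T" using lab_T 6 by auto
    obtain k d where kd: "d \<noteq> 0" "\<And>\<phi>. rt ?r \<phi> - k * rt t \<phi> = d * rt ?r' \<phi>" "d > 0 \<longleftrightarrow> asc s x = asc s (x \<otimes> t)"
      using rt_lab_relation[OF 6(1,2,3)] by metis
    have d: "- d > 0" using kd 6 by simp
    \<comment> \<open>With \<open>d\<close> negative it is the root of \<open>t\<close> that is a
      positive combination of the other two; positivity of \<open>k\<close> follows by evaluating at
      \<open>one_fun\<close>.\<close>
    have e: "k * rt t \<phi> = 1 * rt ?r \<phi> + (- d) * rt ?r' \<phi>" for \<phi> using kd(2)[of \<phi>] by simp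
    have "k * rt t one_fun > 0" unfolding e using d rt(2)[OF T(1)] rt(2)[OF T(2)]
      by (intro add_pos_pos mult_pos_pos) auto
    then have k: "k > 0" using rt(2)[OF 6(3)] by (simp add: zero_less_mult_iff)
    have ne: "?r \<noteq> ?r'"
    proof
      assume "?r = ?r'"
      then have "k * rt t \<phi> = (1 - d) * rt ?r \<phi>" for \<phi> using e[of \<phi>] by (simp add: algebra_simps)
      then have "rt t \<phi> = ((1 - d) / k) * rt ?r \<phi>" for \<phi> using k by (simp add: field_simps)
      then have "rt t = (\<lambda>\<phi>. ((1 - d) / k) * rt ?r \<phi>)" by (rule ext)
      then show False using root_of_inj[OF rt(1)[OF 6(3)] rt(1)[OF T(1)]] 6 by blast
    qed
    have "P ?r ?r' \<Longrightarrow> P ?r t \<and> P t ?r'" "P ?r' ?r \<Longrightarrow> P ?r' t \<and> P t ?r"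
      using mix[OF T 6(3) zero_less_one d k e] by auto
    then show ?case using tot[OF T ne] irr tr by blast
  next
    case (7 t r)
    have "nrt t (off_fun J) = 0" using rt_off_parabolic[OF J] 7 by (simp add: nrt_def)
    moreover have "rt r (off_fun J) \<noteq> 0" using rt_off_parabolic[OF J] 7 by blast
    moreover have "rt r (off_fun J) \<ge> 0"
      by (rule pos_comb_nonneg[of S]) (use root_posD rt_is_root rt 7 in auto)
    ultimately have "nrt r (off_fun J) > 0" using rt(2)[OF 7(3)] by (simp add: nrt_def)
    then have "nrt t (off_fun J) < nrt r (off_fun J)" using \<open>nrt t (off_fun J) = 0\<close> by (simp only:)
    then show ?case unfolding P_def root_prec_def by blast
  qed
  then show ?thesis by blast
qed

end

section \<open>Bruhat order\<close>

context coxeter_system begin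

abbreviation ble :: "'a \<Rightarrow> 'a \<Rightarrow> bool" where "ble \<equiv> bruhat_le G S"
abbreviation bstep :: "'a \<Rightarrow> 'a \<Rightarrow> bool" where "bstep \<equiv> bruhat_step G S"

lemma bstep_iff: "bstep x y \<longleftrightarrow> x \<in> carrier G \<and> (\<exists>t \<in> T. y = x \<otimes> t) \<and> len x < len y"
  by (simp add: bruhat_step_def)

lemma ble_refl [simp, intro]: "ble x x" and ble_trans: "ble x y \<Longrightarrow> ble y z \<Longrightarrow> ble x z"
  and bstep_ble: "bstep x y \<Longrightarrow> ble x y"
  by (auto simp: bruhat_le_def)

lemma ble_induct [consumes 1, case_names refl step]:
  assumes "ble x y" "P x" "\<And>y z. ble x y \<Longrightarrow> bstep y z \<Longrightarrow> P y \<Longrightarrow> P z" shows "P y"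
  using assms(1) unfolding bruhat_le_def
proof (induction rule: rtranclp_induct)
  case (step y z) then show ?case using assms(3)[of y z] by (simp add: bruhat_le_def)
qed (rule assms)

lemma ble_carrier: "ble x y \<Longrightarrow> x \<in> carrier G \<Longrightarrow> y \<in> carrier G"
  by (induction rule: ble_induct) (auto simp: bstep_iff)

lemma ble_len: "ble x y \<Longrightarrow> len x < len y \<or> x = y"
  by (induction rule: ble_induct) (auto simp: bstep_iff)

lemma ble_antisym: "ble x y \<Longrightarrow> ble y x \<Longrightarrow> x = y"
  using ble_len[of x y] ble_len[of y x] by auto

lemma bstep_inv: assumes "bstep x y" shows "bstep (inv x) (inv y)"
proof -
  obtain t where t: "x \<in> carrier G" "t \<in> T" "y = x \<otimes> t" "len x < len y" using assms bstep_iff by blast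
  have "inv y = inv x \<otimes> (x \<otimes> t \<otimes> inv x)" using t by (simp add: inv_mult_group m_assoc) (simp flip: m_assoc)
  moreover have "x \<otimes> t \<otimes> inv x \<in> T" using T_conj t by blast
  moreover have "len (inv x) < len (inv y)" using t len_inv[of x] len_inv[of "x \<otimes> t"] by simp
  ultimately show ?thesis using t(1) unfolding bstep_iff by blast
qed

lemma ble_inv: "ble x y \<Longrightarrow> ble (inv x) (inv y)"
  by (induction rule: ble_induct) (auto intro: ble_trans bstep_ble bstep_inv)

lemma not_asc: "x \<in> carrier G \<Longrightarrow> s \<in> S \<Longrightarrow> \<not> asc s x \<longleftrightarrow> len x = Suc (len (s \<otimes> x))"
  and asc_len: "x \<in> carrier G \<Longrightarrow> s \<in> S \<Longrightarrow> asc s x \<longleftrightarrow> len (s \<otimes> x) = Suc (len x)"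
  using len_left_cases[of x s] by (auto simp: asc_def)

lemma asc_left: "x \<in> carrier G \<Longrightarrow> s \<in> S \<Longrightarrow> asc s (s \<otimes> x) \<longleftrightarrow> \<not> asc s x"
  using len_left_cases[of x s] by (auto simp: asc_def)

lemma bstep_left: assumes "bstep x y" "s \<in> S" "y \<noteq> s \<otimes> x" shows "bstep (s \<otimes> x) (s \<otimes> y)"
proof -
  obtain t where t: "x \<in> carrier G" "t \<in> T" "y = x \<otimes> t" "len x < len y" using assms bstep_iff by blast
  have "len (s \<otimes> x) < len (s \<otimes> x \<otimes> t)" by (rule step_left) (use t assms in auto)
  moreover have "s \<otimes> y = s \<otimes> x \<otimes> t" using t assms by (simp add: m_assoc)
  ultimately show ?thesis using t assms unfolding bstep_iff by auto
qed

lemma bstep_gen: assumes "x \<in> carrier G" "s \<in> S" "asc s x" shows "bstep x (s \<otimes> x)"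
proof -
  have "x \<otimes> lab s x = s \<otimes> x" "lab s x \<in> T" using assms by (auto simp: mult_lab lab_T)
  then show ?thesis unfolding bstep_iff using assms asc_def by metis
qed

text \<open>The smaller and the larger element of the pair \<open>x\<close>,
  \<open>s \<otimes> x\<close>. That both maps are monotone is the lifting property in a form free
  of cases.\<close>

definition ldown :: "'a \<Rightarrow> 'a \<Rightarrow> 'a" where "ldown s x = (if asc s x then x else s \<otimes> x)"
definition lup :: "'a \<Rightarrow> 'a \<Rightarrow> 'a" where "lup s x = (if asc s x then s \<otimes> x else x)"

lemma ldown_le: "x \<in> carrier G \<Longrightarrow> s \<in> S \<Longrightarrow> ble (ldown s x) x"
  using bstep_gen[of "s \<otimes> x" s] by (auto simp: ldown_def asc_left bstep_ble)

lemma lup_ge: "x \<in> carrier G \<Longrightarrow> s \<in> S \<Longrightarrow> ble x (lup s x)"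
  using bstep_gen[of x s] by (auto simp: lup_def bstep_ble)

lemma ldown_lup_mono_step: assumes "bstep x y" "s \<in> S"
  shows "ble (ldown s x) (ldown s y)" "ble (lup s x) (lup s y)"
proof -
  have c: "x \<in> carrier G" "y \<in> carrier G" using assms(1) bstep_iff by auto
  have "ble (ldown s x) (ldown s y) \<and> ble (lup s x) (lup s y)"
  proof (cases "y = s \<otimes> x")
    case True then show ?thesis using c assms by (auto simp: ldown_def lup_def asc_left)
  next
    case False
    then have 1: "ble (s \<otimes> x) (s \<otimes> y)" and 2: "ble x y" using bstep_left assms bstep_ble by blast+
    have 3: "ble (ldown s x) x" "ble y (lup s y)" using ldown_le lup_ge c assms by auto
    show ?thesis
    proof (cases "asc s x"; cases "asc s y")
      assume a: "asc s x" "\<not> asc s y"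
      have "ble x (s \<otimes> x)" "ble (s \<otimes> y) y" using lup_ge[OF c(1) assms(2)] ldown_le[OF c(2) assms(2)] a by (auto simp: lup_def ldown_def)
      then show ?thesis using a ble_trans[OF _ 1] ble_trans[OF 1] by (simp add: ldown_def lup_def)
    next
      assume a: "\<not> asc s x" "asc s y"
      then show ?thesis using ble_trans[OF 3(1) 2] ble_trans[OF 2 3(2)] by (simp add: ldown_def lup_def)
    qed (use 1 2 in \<open>auto simp: ldown_def lup_def\<close>)
  qed
  then show "ble (ldown s x) (ldown s y)" "ble (lup s x) (lup s y)" by auto
qed

lemma ldown_mono: "ble x y \<Longrightarrow> s \<in> S \<Longrightarrow> ble (ldown s x) (ldown s y)"
  and lup_mono: "ble x y \<Longrightarrow> s \<in> S \<Longrightarrow> ble (lup s x) (lup s y)"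
  by (induction rule: ble_induct) (auto intro: ble_trans ldown_lup_mono_step)

text \<open>Otherwise \<open>s \<otimes> x\<close> would be shorter than
  \<open>s \<otimes> x \<otimes> t\<close>; but the former has length \<open>len x + 1\<close> and
  the latter \<open>len x\<close>.\<close>

lemma cover_cross:
  assumes "x \<in> carrier G" "s \<in> S" "t \<in> T" "len (x \<otimes> t) = Suc (len x)" "asc s x" "\<not> asc s (x \<otimes> t)"
  shows "t = lab s x" "x \<otimes> t = s \<otimes> x"
proof -
  have "x \<otimes> t = s \<otimes> x"
  proof (rule ccontr)
    assume "x \<otimes> t \<noteq> s \<otimes> x"
    then have "len (s \<otimes> x) < len (s \<otimes> x \<otimes> t)" using step_left assms by simp
    then show False using assms asc_len[of x s] not_asc[of "x \<otimes> t" s] by (simp add: m_assoc)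
  qed
  then show "x \<otimes> t = s \<otimes> x" .
  then have "x \<otimes> t = x \<otimes> lab s x" using mult_lab assms by simp
  then show "t = lab s x" using assms lab_T[of s x] by simp
qed

lemma cover_neq_lab:
  assumes "x \<in> carrier G" "s \<in> S" "t \<in> T" "len (x \<otimes> t) = Suc (len x)" "\<not> (asc s x \<and> \<not> asc s (x \<otimes> t))"
  shows "t \<noteq> lab s x"
proof
  assume "t = lab s x"
  then have "x \<otimes> t = s \<otimes> x" using mult_lab assms by simp
  then show False using assms asc_left[of x s] not_asc[of x s] by auto
qed

lemma cover_left:
  assumes "x \<in> carrier G" "s \<in> S" "t \<in> T" "len (x \<otimes> t) = Suc (len x)" "asc s x = asc s (x \<otimes> t)"
  shows "len (s \<otimes> x \<otimes> t) = Suc (len (s \<otimes> x))"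
  using assms asc_len[of x s] asc_len[of "x \<otimes> t" s] not_asc[of x s] not_asc[of "x \<otimes> t" s]
  by (cases "asc s x") (auto simp: m_assoc)

text \<open>Saturated chains are stored as label lists: the start and the labels determine the
  vertices, and each step raises the length by one.\<close>

primrec chain :: "'a \<Rightarrow> 'a list \<Rightarrow> 'a \<Rightarrow> bool" where
  "chain x [] y \<longleftrightarrow> x = y"
| "chain x (t # ts) y \<longleftrightarrow> t \<in> T \<and> len (x \<otimes> t) = Suc (len x) \<and> chain (x \<otimes> t) ts y"

lemma chain_carrier: "chain x ts y \<Longrightarrow> x \<in> carrier G \<Longrightarrow> y \<in> carrier G"
  by (induction ts arbitrary: x) auto

lemma chain_T: "chain x ts y \<Longrightarrow> set ts \<subseteq> T"
  by (induction ts arbitrary: x) auto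

lemma chain_len: "chain x ts y \<Longrightarrow> len y = len x + length ts"
  by (induction ts arbitrary: x) auto

lemma chain_ble: "chain x ts y \<Longrightarrow> x \<in> carrier G \<Longrightarrow> ble x y"
proof (induction ts arbitrary: x)
  case (Cons t ts)
  then have "bstep x (x \<otimes> t)" unfolding bstep_iff by auto
  then show ?case using Cons by (auto intro: ble_trans bstep_ble)
qed simp

lemma chain_append: "chain x (as @ bs) z \<longleftrightarrow> (\<exists>y. chain x as y \<and> chain y bs z)"
  by (induction as arbitrary: x) auto

lemma chain_end_unique: "chain x ts y \<Longrightarrow> chain x ts z \<Longrightarrow> y = z"
  by (induction ts arbitrary: x) auto

end

section \<open>Increasing chains\<close>

context labelled_coxeter begin

abbreviation inc :: "'a list \<Rightarrow> bool" where "inc \<equiv> sorted_wrt (\<ll>)"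

lemma prec_neq: "t \<ll> r \<Longrightarrow> t \<noteq> r" using prec_irrefl by blast

lemma prec_asym: "t \<ll> r \<Longrightarrow> \<not> r \<ll> t" using prec_irrefl prec_trans by blast

text \<open>A cover can leave the ascents of \<open>s\<close> only through the crossing label. By
  \<open>prec_same\<close> that label, although it changes along the chain, stays below the step
  just made and so below all later ones.\<close>

lemma inc_chain_stays_asc:
  assumes "chain x bs y" "x \<in> carrier G" "s \<in> S" "asc s x" "inc bs" "\<forall>b \<in> set bs. lab s x \<ll> b"
  shows "asc s y \<and> chain (s \<otimes> x) bs (s \<otimes> y) \<and> (bs \<noteq> [] \<longrightarrow> lab s y \<ll> last bs)"
  using assms
proof (induction bs arbitrary: x)
  case Nil then show ?case by simp
next
  case (Cons b bs)
  have b: "b \<in> T" "len (x \<otimes> b) = Suc (len x)" "chain (x \<otimes> b) bs y" using Cons.prems by auto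
  have xb: "x \<otimes> b \<in> carrier G" using Cons.prems b by simp
  have lb: "lab s x \<ll> b" using Cons.prems by simp
  then have ne: "b \<noteq> lab s x" using prec_neq by blast
  then have a: "asc s (x \<otimes> b)" using cover_cross(1)[OF Cons.prems(2,3) b(1,2) Cons.prems(4)] by blast
  have "\<not> b \<ll> lab s (x \<otimes> b)" using prec_same[OF Cons.prems(2,3) b(1) ne] a Cons.prems(4) prec_asym[OF lb] by simp
  then have l: "lab s (x \<otimes> b) \<ll> b"
    using prec_total[OF lab_T[OF Cons.prems(3) xb] b(1)] lab_neq_self[OF Cons.prems(2,3) b(1) ne] by metis
  then have "\<forall>c \<in> set bs. lab s (x \<otimes> b) \<ll> c" using Cons.prems(5) prec_trans by auto
  then have IH: "asc s y \<and> chain (s \<otimes> (x \<otimes> b)) bs (s \<otimes> y) \<and> (bs \<noteq> [] \<longrightarrow> lab s y \<ll> last bs)"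
    using Cons.IH[OF b(3) xb Cons.prems(3) a] Cons.prems by simp
  have "len (s \<otimes> x \<otimes> b) = Suc (len (s \<otimes> x))"
    by (rule cover_left) (use Cons.prems a b in auto)
  moreover have "s \<otimes> x \<otimes> b = s \<otimes> (x \<otimes> b)" using Cons.prems b by (simp add: m_assoc)
  ultimately have "chain (s \<otimes> x) (b # bs) (s \<otimes> y)" using IH b by simp
  moreover have "lab s y \<ll> last (b # bs)" using IH l b by (cases bs) auto
  ultimately show ?case using IH by blast
qed

text \<open>An increasing chain from \<open>x\<close> to \<open>s w < w\<close> becomes one from \<open>x\<close> to \<open>w\<close> by crossing from \<open>y\<close> to
  \<open>s y\<close> at the only place that keeps the labels increasing; left multiplication by \<open>s\<close> does not
  change the later labels.\<close>

primrec ins :: "'a \<Rightarrow> 'a \<Rightarrow> 'a list \<Rightarrow> 'a list" where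
  "ins s x [] = [lab s x]"
| "ins s x (b # cs) = (if asc s x \<and> lab s x \<ll> b then lab s x # b # cs else b # ins s (x \<otimes> b) cs)"

lemma set_ins: "set cs \<subseteq> set (ins s x cs)"
  by (induction cs arbitrary: x) auto

text \<open>The alternative in the last hypothesis is the situation after the chain has crossed by
  itself; it persists until \<open>s\<close> ascends again. The clause on \<open>t\<close> is the
  invariant for prepending a label, and the clause on the last label serves the coatom condition in
  \<open>EL\<close>.\<close>

lemma ins_inc_chain:
  assumes "chain x cs y" "x \<in> carrier G" "s \<in> S" "asc s y" "inc cs"
    "asc s x \<or> (\<forall>b \<in> set cs. lab s x \<ll> b)"
  shows "inc (ins s x cs) \<and> chain x (ins s x cs) (s \<otimes> y)
    \<and> (\<forall>t. (\<forall>b \<in> set cs. t \<ll> b) \<and> (asc s x \<longrightarrow> t \<ll> lab s x) \<longrightarrow> (\<forall>b \<in> set (ins s x cs). t \<ll> b))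
    \<and> (ins s x cs = cs @ [lab s y] \<or> cs \<noteq> [] \<and> last (ins s x cs) = last cs \<and> lab s y \<ll> last cs)"
  using assms
proof (induction cs arbitrary: x)
  case Nil
  then show ?case using mult_lab[of s x] lab_T[of s x] asc_len[of x s] by auto
next
  case (Cons b cs)
  note p = Cons.prems(2,3)
  have b: "b \<in> T" "len (x \<otimes> b) = Suc (len x)" "chain (x \<otimes> b) cs y" using Cons.prems by auto
  have xb: "x \<otimes> b \<in> carrier G" using p b by simp
  have bc: "\<forall>c \<in> set cs. b \<ll> c" "inc cs" using Cons.prems by auto
  show ?case
  proof (cases "asc s x \<and> lab s x \<ll> b")
    case True
    then have all: "\<forall>c \<in> set (b # cs). lab s x \<ll> c" using bc prec_trans by auto
    have st: "chain (s \<otimes> x) (b # cs) (s \<otimes> y) \<and> lab s y \<ll> last (b # cs)"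
      using inc_chain_stays_asc[OF Cons.prems(1) p _ Cons.prems(5) all] True by blast
    have "chain x (lab s x # b # cs) (s \<otimes> y)"
      unfolding chain.simps(2)[of x "lab s x"] using st mult_lab[of s x] lab_T[of s x] asc_len[of x s] p True by simp
    then show ?thesis using True all st Cons.prems(5) by simp
  next
    case False
    \<comment> \<open>The hypothesis is restored at the next vertex; if \<open>s\<close> ascends
      there, \<open>b\<close> moreover precedes the new crossing label, so the label inserted later
      does not disturb the order.\<close>
    have step: "(asc s (x \<otimes> b) \<and> b \<ll> lab s (x \<otimes> b)) \<or> (\<not> asc s (x \<otimes> b) \<and> (\<forall>c \<in> set cs. lab s (x \<otimes> b) \<ll> c))"
    proof (cases "asc s x")
      case True
      show ?thesis
      proof (cases "asc s (x \<otimes> b)")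
        case True
        have ne: "b \<noteq> lab s x" using cover_neq_lab[OF p b(1,2)] True by blast
        then have "b \<ll> lab s x" using False \<open>asc s x\<close> prec_total lab_T p b by blast
        then show ?thesis using prec_same[OF p b(1) ne] True \<open>asc s x\<close> by simp
      next
        case f: False
        have "b = lab s x" "x \<otimes> b = s \<otimes> x" using cover_cross[OF p b(1,2) True f] by auto
        then show ?thesis using f bc lab_left p by simp
      qed
    next
      case na: False
      then have lb: "lab s x \<ll> b" using Cons.prems(6) by simp
      have ne: "b \<noteq> lab s x" using cover_neq_lab[OF p b(1,2)] na by blast
      have ne': "b \<noteq> lab s (x \<otimes> b)" using lab_neq_self[OF p b(1) ne] .
      have tot: "b \<ll> lab s (x \<otimes> b) \<or> lab s (x \<otimes> b) \<ll> b" using prec_total[OF b(1) lab_T[OF p(2) xb] ne'] .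
      show ?thesis
      proof (cases "asc s (x \<otimes> b)")
        case True
        then show ?thesis using prec_opp[OF p b(1) ne] na tot prec_asym[OF lb] by auto
      next
        case f: False
        then have "lab s (x \<otimes> b) \<ll> b" using prec_same[OF p b(1) ne] na tot prec_asym[OF lb] by auto
        then show ?thesis using f bc prec_trans by blast
      qed
    qed
    have IH: "inc (ins s (x \<otimes> b) cs) \<and> chain (x \<otimes> b) (ins s (x \<otimes> b) cs) (s \<otimes> y)
    \<and> (\<forall>t. (\<forall>b \<in> set cs. t \<ll> b) \<and> (asc s (x \<otimes> b) \<longrightarrow> t \<ll> lab s (x \<otimes> b)) \<longrightarrow> (\<forall>b \<in> set (ins s (x \<otimes> b) cs). t \<ll> b))
    \<and> (ins s (x \<otimes> b) cs = cs @ [lab s y] \<or> cs \<noteq> [] \<and> last (ins s (x \<otimes> b) cs) = last cs \<and> lab s y \<ll> last cs)"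
      using Cons.IH[OF b(3) xb p(2) Cons.prems(4) bc(2)] step by blast
    have e: "ins s x (b # cs) = b # ins s (x \<otimes> b) cs" using False by (simp only: ins.simps if_False)
    have i1: "inc (ins s (x \<otimes> b) cs)" and i2: "chain (x \<otimes> b) (ins s (x \<otimes> b) cs) (s \<otimes> y)"
      and i4: "ins s (x \<otimes> b) cs = cs @ [lab s y] \<or> cs \<noteq> [] \<and> last (ins s (x \<otimes> b) cs) = last cs \<and> lab s y \<ll> last cs"
      using IH by blast+
    have ball: "\<forall>c \<in> set (ins s (x \<otimes> b) cs). b \<ll> c" using IH step bc by blast
    have ne: "ins s (x \<otimes> b) cs \<noteq> []" by (cases cs) auto
    have 1: "inc (b # ins s (x \<otimes> b) cs)" using i1 ball by simp
    have 2: "chain x (b # ins s (x \<otimes> b) cs) (s \<otimes> y)" using i2 b by simp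
    have 3: "\<forall>c \<in> set (b # ins s (x \<otimes> b) cs). t \<ll> c" if "\<forall>c \<in> set (b # cs). t \<ll> c" for t
      using ball that prec_trans[of t b] by auto
    have 4: "b # ins s (x \<otimes> b) cs = (b # cs) @ [lab s y] \<or>
        b # cs \<noteq> [] \<and> last (b # ins s (x \<otimes> b) cs) = last (b # cs) \<and> lab s y \<ll> last (b # cs)"
      using i4 ne by (elim conjE disjE) simp_all
    show ?thesis unfolding e using 1 2 3 4 by blast
  qed
qed

text \<open>Surjectivity of insertion, from which uniqueness follows. The second half treats tails
  that start at a descent: either the whole tail can be moved down by \<open>s\<close>, and then the
  inserted crossing is the one just before it, or the crossing was inserted further up.\<close>

lemma inc_chain_is_ins:
  assumes "chain x ts w" "x \<in> carrier G" "s \<in> S" "\<not> asc s w" "inc ts"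
  shows "(asc s x \<longrightarrow> (\<exists>cs. chain x cs (s \<otimes> w) \<and> inc cs \<and> ins s x cs = ts)) \<and>
    (\<not> asc s x \<and> (\<forall>b \<in> set ts. lab s x \<ll> b) \<longrightarrow>
      chain (s \<otimes> x) ts (s \<otimes> w) \<or> (\<exists>cs. chain x cs (s \<otimes> w) \<and> inc cs \<and> ins s x cs = ts))"
  using assms
proof (induction ts arbitrary: x)
  case Nil then show ?case by auto
next
  case (Cons t ts)
  note p = Cons.prems(2,3)
  have t: "t \<in> T" "len (x \<otimes> t) = Suc (len x)" "chain (x \<otimes> t) ts w" using Cons.prems by auto
  have xt: "x \<otimes> t \<in> carrier G" using p t by simp
  have tc: "\<forall>c \<in> set ts. t \<ll> c" "inc ts" using Cons.prems by auto
  note IH = Cons.IH[OF t(3) xt p(2) Cons.prems(4) tc(2)]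
  have ext: "\<exists>cs. chain x cs (s \<otimes> w) \<and> inc cs \<and> ins s x cs = t # ts"
    if "\<exists>cs. chain (x \<otimes> t) cs (s \<otimes> w) \<and> inc cs \<and> ins s (x \<otimes> t) cs = ts" "\<not> (asc s x \<and> lab s x \<ll> t)"
  proof -
    obtain cs where cs: "chain (x \<otimes> t) cs (s \<otimes> w)" "inc cs" "ins s (x \<otimes> t) cs = ts" using \<open>\<exists>cs. _ cs\<close> by blast
    have "set cs \<subseteq> set ts" using set_ins cs(3) by blast
    then show ?thesis using cs t tc that(2) by (intro exI[of _ "t # cs"]) auto
  qed
  show ?case
  proof (intro conjI impI)
    assume a: "asc s x"
    show "\<exists>cs. chain x cs (s \<otimes> w) \<and> inc cs \<and> ins s x cs = t # ts"
    proof (cases "asc s (x \<otimes> t)")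
      case True
      \<comment> \<open>Otherwise all labels exceed the crossing label, and \<open>s\<close> would
        still ascend at \<open>w\<close>.\<close>
      have "\<not> lab s x \<ll> t"
      proof
        assume "lab s x \<ll> t"
        then have "\<forall>b \<in> set (t # ts). lab s x \<ll> b" using tc prec_trans by auto
        then show False using inc_chain_stays_asc[OF Cons.prems(1) p a Cons.prems(5)] Cons.prems(4) by blast
      qed
      then show ?thesis using ext IH True by blast
    next
      case False
      have e: "t = lab s x" "x \<otimes> t = s \<otimes> x" using cover_cross[OF p t(1,2) a False] by auto
      have "\<forall>b \<in> set ts. lab s (x \<otimes> t) \<ll> b" using tc e lab_left p by metis
      then consider "chain (s \<otimes> (x \<otimes> t)) ts (s \<otimes> w)" | "\<exists>cs. chain (x \<otimes> t) cs (s \<otimes> w) \<and> inc cs \<and> ins s (x \<otimes> t) cs = ts"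
        using IH False by blast
      then show ?thesis
      proof cases
        case 1
        then have "chain x ts (s \<otimes> w)" using e p by simp
        moreover have "ins s x ts = t # ts" using tc e a by (cases ts) auto
        ultimately show ?thesis using tc by blast
      next
        case 2
        then show ?thesis using ext e prec_irrefl by blast
      qed
    qed
  next
    assume a: "\<not> asc s x \<and> (\<forall>b \<in> set (t # ts). lab s x \<ll> b)"
    then have lt: "lab s x \<ll> t" by simp
    show "chain (s \<otimes> x) (t # ts) (s \<otimes> w) \<or> (\<exists>cs. chain x cs (s \<otimes> w) \<and> inc cs \<and> ins s x cs = t # ts)"
    proof (cases "asc s (x \<otimes> t)")
      case True
      then show ?thesis using ext IH a by blast
    next
      case False
      have ne: "t \<noteq> lab s x" using prec_neq[OF lt] by blast
      have "\<not> t \<ll> lab s (x \<otimes> t)" using prec_same[OF p t(1) ne] False a prec_asym[OF lt] by simp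
      then have "lab s (x \<otimes> t) \<ll> t"
        using prec_total[OF t(1) lab_T[OF p(2) xt]] lab_neq_self[OF p t(1) ne] by blast
      then have "\<forall>b \<in> set ts. lab s (x \<otimes> t) \<ll> b" using tc prec_trans by blast
      then consider "chain (s \<otimes> (x \<otimes> t)) ts (s \<otimes> w)" | "\<exists>cs. chain (x \<otimes> t) cs (s \<otimes> w) \<and> inc cs \<and> ins s (x \<otimes> t) cs = ts"
        using IH False by blast
      then show ?thesis
      proof cases
        case 1
        moreover have "len (s \<otimes> x \<otimes> t) = Suc (len (s \<otimes> x))" by (rule cover_left) (use p t a False in auto)
        moreover have "s \<otimes> x \<otimes> t = s \<otimes> (x \<otimes> t)" using p t by (simp add: m_assoc)
        ultimately show ?thesis using t by simp
      next
        case 2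
        then show ?thesis using ext a by blast
      qed
    qed
  qed
qed

text \<open>Dually, removing the first crossing turns a chain that starts at \<open>y < s y\<close> into one that starts
  at \<open>s y\<close>.\<close>

primrec del :: "'a \<Rightarrow> 'a \<Rightarrow> 'a list \<Rightarrow> 'a list" where
  "del s y [] = []"
| "del s y (t # e) = (if asc s (y \<otimes> t) then t # del s (y \<otimes> t) e else e)"

lemma set_del: "set (del s y e) \<subseteq> set e"
  by (induction e arbitrary: y) auto

lemma inc_del: "inc e \<Longrightarrow> inc (del s y e)"
  using set_del by (induction e arbitrary: y) fastforce+

text \<open>The top label survives unless the removed crossing is the last step. That exceptional
  case is kept apart, because the coatom condition is delicate there.\<close>

lemma del_chain:
  assumes "chain y e w" "y \<in> carrier G" "s \<in> S" "asc s y" "\<not> asc s w"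
  shows "chain (s \<otimes> y) (del s y e) w \<and> (del s y e \<noteq> [] \<and> last (del s y e) = last e \<or>
    e = del s y e @ [lab s w] \<and> chain y (del s y e) (s \<otimes> w))"
  using assms
proof (induction e arbitrary: y)
  case Nil then show ?case by simp
next
  case (Cons t e)
  note p = Cons.prems(2,3)
  have t: "t \<in> T" "len (y \<otimes> t) = Suc (len y)" "chain (y \<otimes> t) e w" using Cons.prems by auto
  have yt: "y \<otimes> t \<in> carrier G" using p t by simp
  show ?case
  proof (cases "asc s (y \<otimes> t)")
    case True
    have "len (s \<otimes> y \<otimes> t) = Suc (len (s \<otimes> y))" by (rule cover_left) (use p t True Cons.prems in auto)
    moreover have "s \<otimes> y \<otimes> t = s \<otimes> (y \<otimes> t)" using p t by (simp add: m_assoc)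
    ultimately show ?thesis using Cons.IH[OF t(3) yt p(2) True Cons.prems(5)] t True by auto
  next
    case False
    have e: "t = lab s y" "y \<otimes> t = s \<otimes> y" using cover_cross[OF p t(1,2) Cons.prems(4) False] by auto
    show ?thesis
    proof (cases "e = []")
      case True
      then have "w = s \<otimes> y" using t e by simp
      then show ?thesis using True t e False p lab_left by auto
    next
      case ne: False
      then show ?thesis using t e False by simp
    qed
  qed
qed

text \<open>The crossing is put back before the first label that exceeds it. Up to that place
  \<open>s\<close> remains a descent: once it ascended, the crossing label would precede all
  remaining labels, and \<open>s\<close> would ascend up to \<open>w\<close>.\<close>

lemma inc_chain_is_del:
  assumes "chain x c w" "x \<in> carrier G" "s \<in> S" "\<not> asc s x" "\<not> asc s w" "inc c"
  shows "\<exists>e. inc e \<and> chain (s \<otimes> x) e w \<and> del s (s \<otimes> x) e = c \<and>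
    (\<forall>t. t \<ll> lab s x \<and> (\<forall>b \<in> set c. t \<ll> b) \<longrightarrow> (\<forall>b \<in> set e. t \<ll> b))"
  using assms
proof (induction c arbitrary: x)
  case Nil
  have "s \<otimes> x \<otimes> lab s x = x" using mult_lab[of s "s \<otimes> x"] lab_left Nil by simp
  then show ?case using Nil lab_T[of s x] not_asc[of x s]
    by (intro exI[of _ "[lab s x]"]) auto
next
  case (Cons t c)
  note p = Cons.prems(2,3)
  have t: "t \<in> T" "len (x \<otimes> t) = Suc (len x)" "chain (x \<otimes> t) c w" using Cons.prems by auto
  have xt: "x \<otimes> t \<in> carrier G" using p t by simp
  have tc: "\<forall>b \<in> set c. t \<ll> b" "inc c" using Cons.prems by auto
  have ne: "t \<noteq> lab s x" using cover_neq_lab[OF p t(1,2)] Cons.prems(4) by blast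
  have bk: "s \<otimes> x \<otimes> lab s x = x" using mult_lab[of s "s \<otimes> x"] lab_left p by simp
  show ?case
  proof (cases "lab s x \<ll> t")
    case True
    have "chain (s \<otimes> x) (lab s x # t # c) w"
      unfolding chain.simps(2)[of "s \<otimes> x"] bk using Cons.prems lab_T[of s x] not_asc[of x s] by simp
    moreover have "inc (lab s x # t # c)" using True Cons.prems(6) prec_trans by auto
    moreover have "del s (s \<otimes> x) (lab s x # t # c) = t # c" using Cons.prems(4) bk by simp
    ultimately show ?thesis by (intro exI[of _ "lab s x # t # c"]) auto
  next
    case False
    then have tl: "t \<ll> lab s x" using prec_total t lab_T p ne by blast
    have d: "\<not> asc s (x \<otimes> t)"
    proof
      assume a: "asc s (x \<otimes> t)"
      then have "lab s (x \<otimes> t) \<ll> t" using prec_opp[OF p t(1) ne] Cons.prems(4) tl by simp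
      then have "\<forall>b \<in> set c. lab s (x \<otimes> t) \<ll> b" using tc prec_trans by blast
      then show False using inc_chain_stays_asc[OF t(3) xt p(2) a tc(2)] Cons.prems(5) by blast
    qed
    then have tl': "t \<ll> lab s (x \<otimes> t)" using prec_same[OF p t(1) ne] Cons.prems(4) tl by simp
    obtain e where e: "inc e" "chain (s \<otimes> (x \<otimes> t)) e w" "del s (s \<otimes> (x \<otimes> t)) e = c"
      "\<And>r. r \<ll> lab s (x \<otimes> t) \<Longrightarrow> (\<forall>b \<in> set c. r \<ll> b) \<Longrightarrow> (\<forall>b \<in> set e. r \<ll> b)"
      using Cons.IH[OF t(3) xt p(2) d Cons.prems(5) tc(2)] by blast
    have te: "\<forall>b \<in> set e. t \<ll> b" using e(4)[OF tl' tc(1)] .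
    have "len (s \<otimes> x \<otimes> t) = Suc (len (s \<otimes> x))" by (rule cover_left) (use p t d Cons.prems in auto)
    moreover have sxt: "s \<otimes> x \<otimes> t = s \<otimes> (x \<otimes> t)" using p t by (simp add: m_assoc)
    ultimately have "chain (s \<otimes> x) (t # e) w" using t e by simp
    moreover have "asc s (s \<otimes> x \<otimes> t)" unfolding sxt using asc_left[OF xt p(2)] d by simp
    then have "del s (s \<otimes> x) (t # e) = t # c" using e sxt by simp
    ultimately show ?thesis using te e(1) prec_trans by (intro exI[of _ "t # e"]) auto
  qed
qed

text \<open>The last clause is dual to the usual requirement that the first label is minimal among the atoms.
  It is the form that survives the induction, and it is why chains are compared from the top below.\<close>

definition EL :: "'a \<Rightarrow> 'a \<Rightarrow> bool" where
  "EL u w \<longleftrightarrow> (\<exists>ts. chain u ts w \<and> inc ts) \<and>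
    (\<forall>ts ts'. chain u ts w \<and> inc ts \<and> chain u ts' w \<and> inc ts' \<longrightarrow> ts = ts') \<and>
    (\<forall>ts v b. chain u ts w \<and> inc ts \<and> ble u v \<and> b \<in> T \<and> v \<otimes> b = w \<and> len w = Suc (len v)
      \<longrightarrow> ts \<noteq> [] \<and> (last ts = b \<or> b \<ll> last ts))"

lemma ELD: assumes "EL u w"
  shows "\<exists>ts. chain u ts w \<and> inc ts"
    "chain u ts w \<Longrightarrow> inc ts \<Longrightarrow> chain u ts' w \<Longrightarrow> inc ts' \<Longrightarrow> ts = ts'"
    "chain u ts w \<Longrightarrow> inc ts \<Longrightarrow> ble u v \<Longrightarrow> b \<in> T \<Longrightarrow> v \<otimes> b = w \<Longrightarrow> len w = Suc (len v)
      \<Longrightarrow> ts \<noteq> [] \<and> (last ts = b \<or> b \<ll> last ts)"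
  using assms unfolding EL_def by blast+

lemma coatom_cases:
  assumes "v \<in> carrier G" "w \<in> carrier G" "s \<in> S" "\<not> asc s w" "b \<in> T" "v \<otimes> b = w" "len w = Suc (len v)"
  obtains (cross) "v = s \<otimes> w" "b = lab s w"
  | (same) "\<not> asc s v" "s \<otimes> v \<otimes> b = s \<otimes> w" "len (s \<otimes> w) = Suc (len (s \<otimes> v))"
proof (cases "asc s v")
  case True
  then have "b = lab s v" "v \<otimes> b = s \<otimes> v" using cover_cross[of v s b] assms by auto
  then have w: "w = s \<otimes> v" and "b = lab s v" using assms(6) by auto
  then have "b = lab s w" using lab_left assms(1,3) by simp
  then show ?thesis using cross w assms(1,3) by simp
next
  case False
  have "len (s \<otimes> v \<otimes> b) = Suc (len (s \<otimes> v))" by (rule cover_left) (use assms False in auto)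
  moreover have "s \<otimes> v \<otimes> b = s \<otimes> (v \<otimes> b)" using assms(1,3,5) by (simp add: m_assoc)
  then have "s \<otimes> v \<otimes> b = s \<otimes> w" unfolding assms(6) .
  ultimately show ?thesis using same False by simp
qed

text \<open>Insertion is a bijection between the increasing chains to \<open>s \<otimes> w\<close>
  and those to \<open>w\<close>. A coatom of \<open>w\<close> is either \<open>s \<otimes> w\<close>
  or is carried by \<open>s\<close> to a coatom of \<open>s \<otimes> w\<close> with the same
  label.\<close>

lemma EL_asc:
  assumes c: "u \<in> carrier G" "w \<in> carrier G" "s \<in> S" and a: "asc s u" "\<not> asc s w" and E: "EL u (s \<otimes> w)"
  shows "EL u w"
proof -
  have ssw: "s \<otimes> (s \<otimes> w) = w" using c by simp
  have asw: "asc s (s \<otimes> w)" using asc_left c a by simp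
  have labw: "lab s (s \<otimes> w) = lab s w" using lab_left c by simp
  obtain cs where cs: "chain u cs (s \<otimes> w)" "inc cs" using ELD(1)[OF E] by blast
  have I: "inc (ins s u cs) \<and> chain u (ins s u cs) w"
    "ins s u cs = cs @ [lab s w] \<or> cs \<noteq> [] \<and> last (ins s u cs) = last cs \<and> lab s w \<ll> last cs"
    using ins_inc_chain[OF cs(1) c(1,3) asw cs(2)] a(1) unfolding ssw labw by blast+
  have uniq: "ts = ins s u cs" if "chain u ts w" "inc ts" for ts
    using inc_chain_is_ins[OF that(1) c(1,3) a(2) that(2)] a(1) ELD(2)[OF E cs] by blast
  have coat: "ts \<noteq> [] \<and> (last ts = b \<or> b \<ll> last ts)"
    if ts: "chain u ts w" "inc ts" and v: "ble u v" "b \<in> T" "v \<otimes> b = w" "len w = Suc (len v)" for ts v b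
  proof -
    have vc: "v \<in> carrier G" using v(1) c ble_carrier by blast
    have tse: "ts = ins s u cs" using uniq ts by blast
    \<comment> \<open>The last label is the larger one of the crossing label and the last label of
      \<open>cs\<close>.\<close>
    have last: "(last ts = lab s w \<and> (cs = [] \<or> last cs \<ll> last ts)) \<or> cs \<noteq> [] \<and> last ts = last cs \<and> lab s w \<ll> last cs"
      using I(2) ts(2) unfolding tse by (cases cs rule: rev_cases) (auto simp: sorted_wrt_append)
    have ne: "ts \<noteq> []" unfolding tse by (cases cs) auto
    from vc c(2,3) a(2) v(2-4) show ?thesis
    proof (cases rule: coatom_cases)
      case cross
      then show ?thesis using last ne by metis
    next
      case same
      have "ble (ldown s u) (ldown s v)" using ldown_mono v(1) c by blast
      then have "ble u (s \<otimes> v)" using a same by (simp add: ldown_def)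
      then have "cs \<noteq> [] \<and> (last cs = b \<or> b \<ll> last cs)" using ELD(3)[OF E cs] v(2) same by blast
      then show ?thesis using last ne prec_trans by metis
    qed
  qed
  show ?thesis unfolding EL_def using I uniq coat by blast
qed

text \<open>Here deletion relates the increasing chains from \<open>s \<otimes> u\<close> to those
  from \<open>u\<close>. The coatom condition is inherited from \<open>s \<otimes> u\<close>, except
  when the deleted crossing is the last step.\<close>

lemma EL_desc:
  assumes c: "u \<in> carrier G" "w \<in> carrier G" "s \<in> S" and a: "\<not> asc s u" "\<not> asc s w"
    and E1: "EL (s \<otimes> u) w" and E2: "EL (s \<otimes> u) (s \<otimes> w)" and E3: "ble u (s \<otimes> w) \<Longrightarrow> EL u (s \<otimes> w)"
  shows "EL u w"
proof -
  have ssu: "s \<otimes> (s \<otimes> u) = u" and ssw: "s \<otimes> (s \<otimes> w) = w" using c by simp_all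
  have asu: "asc s (s \<otimes> u)" and asw: "asc s (s \<otimes> w)" using asc_left c a by simp_all
  have suc: "s \<otimes> u \<in> carrier G" using c by simp
  obtain e where e: "chain (s \<otimes> u) e w" "inc e" using ELD(1)[OF E1] by blast
  let ?c = "del s (s \<otimes> u) e"
  have D: "chain u ?c w" "inc ?c"
    "?c \<noteq> [] \<and> last ?c = last e \<or> e = ?c @ [lab s w] \<and> chain (s \<otimes> u) ?c (s \<otimes> w)"
    using del_chain[OF e(1) suc c(3) asu a(2)] inc_del[OF e(2)] unfolding ssu by blast+
  have uniq: "ts = ?c" if ts: "chain u ts w" "inc ts" for ts
    using inc_chain_is_del[OF ts(1) c(1,3) a ts(2)] ELD(2)[OF E1 e] by blast
  have coat: "ts \<noteq> [] \<and> (last ts = b \<or> b \<ll> last ts)"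
    if ts: "chain u ts w" "inc ts" and v: "ble u v" "b \<in> T" "v \<otimes> b = w" "len w = Suc (len v)" for ts v b
  proof -
    have vc: "v \<in> carrier G" using v(1) c ble_carrier by blast
    have tse: "ts = ?c" using uniq ts by blast
    have suu: "ble (s \<otimes> u) u" using ldown_le[OF c(1,3)] a by (simp add: ldown_def)
    from D(3) show ?thesis
    proof
      assume "?c \<noteq> [] \<and> last ?c = last e"
      moreover have "e \<noteq> [] \<and> (last e = b \<or> b \<ll> last e)"
        using ELD(3)[OF E1 e ble_trans[OF suu v(1)] v(2-4)] .
      ultimately show ?thesis unfolding tse by simp
    next
      assume ec: "e = ?c @ [lab s w] \<and> chain (s \<otimes> u) ?c (s \<otimes> w)"
      from vc c(2,3) a(2) v(2-4) show ?thesis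
      proof (cases rule: coatom_cases)
        case same
        have "ble (ldown s u) (ldown s v)" using ldown_mono v(1) c by blast
        then have "ble (s \<otimes> u) (s \<otimes> v)" using a same by (simp add: ldown_def)
        then show ?thesis unfolding tse using ELD(3)[OF E2 _ D(2)] ec v(2) same by blast
      next
        case cross
        \<comment> \<open>This configuration is contradictory. The last label of the increasing
          chain \<open>f\<close> to \<open>s \<otimes> w\<close> does not exceed that of
          \<open>?c\<close>, by the coatom condition below \<open>s \<otimes> w\<close>, so
          \<open>f\<close> can be prolonged by the crossing. By uniqueness the result is
          \<open>?c\<close>, whose last label nevertheless precedes the crossing label.\<close>
        then have usw: "ble u (s \<otimes> w)" using v(1) by simp
        obtain f where f: "chain u f (s \<otimes> w)" "inc f" using ELD(1)[OF E3[OF usw]] by blast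
        have "f \<noteq> []" using f(1) asw a(1) by auto
        then obtain f' l where fl: "f = f' @ [l]" by (cases f rule: rev_cases) auto
        obtain y where y: "chain u f' y" "l \<in> T" "y \<otimes> l = s \<otimes> w" "len (s \<otimes> w) = Suc (len y)"
          using f(1) unfolding fl chain_append by auto
        have "ble (s \<otimes> u) y" using ble_trans[OF suu chain_ble[OF y(1) c(1)]] .
        then have cl: "?c \<noteq> [] \<and> (last ?c = l \<or> l \<ll> last ?c)"
          using ELD(3)[OF E2 _ D(2)] ec y by blast
        have "last ?c \<ll> lab s w" using e(2) ec cl by (metis sorted_wrt_append last_in_set list.set_intros(1))
        then have lw: "l \<ll> lab s w" using cl prec_trans by blast
        then have "\<forall>b \<in> set f. b \<ll> lab s w" using f(2) prec_trans unfolding fl by (auto simp: sorted_wrt_append)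
        then have "inc (f @ [lab s w])" using f(2) by (simp add: sorted_wrt_append)
        moreover have "s \<otimes> w \<otimes> lab s w = w" using mult_lab[of s "s \<otimes> w"] lab_left c by simp
        then have "chain u (f @ [lab s w]) w" unfolding chain_append
          using f(1) lab_T not_asc c a by (intro exI[of _ "s \<otimes> w"]) auto
        ultimately have "f @ [lab s w] = ?c" using uniq by blast
        then have "last ?c = lab s w" by (metis last_snoc)
        then show ?thesis using \<open>last ?c \<ll> lab s w\<close> prec_irrefl by simp
      qed
    qed
  qed
  show ?thesis unfolding EL_def using D(1,2) uniq coat by blast
qed

theorem EL_all: "u \<in> carrier G \<Longrightarrow> ble u w \<Longrightarrow> EL u w"
proof (induction "len w" arbitrary: u w rule: less_induct)
  case less
  have wc: "w \<in> carrier G" using ble_carrier less.prems by blast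
  show ?case
  proof (cases "w = \<one>")
    case True
    then have u: "u = w" using ble_len[OF less.prems(2)] by auto
    have "ts = []" if "chain u ts w" for ts using chain_len[OF that] u by simp
    then have nil: "chain u ts w \<longleftrightarrow> ts = []" for ts using u by auto
    have "len w = 0" using True by simp
    then show ?thesis unfolding EL_def nil by simp
  next
    case False
    obtain s where s: "s \<in> S" "len w = Suc (len (s \<otimes> w))" using ex_left_descent[OF wc False] .
    have dw: "\<not> asc s w" using not_asc s wc by simp
    have lt: "len (s \<otimes> w) < len w" using s by simp
    \<comment> \<open>Stated for all starts at which \<open>s\<close> ascends, so that it also
      applies to \<open>s \<otimes> u\<close> with the same \<open>w\<close>, where the induction
      hypothesis is silent.\<close>
    have A: "EL x w" if x: "x \<in> carrier G" "ble x w" "asc s x" for x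
    proof (rule EL_asc[OF x(1) wc s(1) x(3) dw])
      have "ble (ldown s x) (ldown s w)" using ldown_mono x(2) s by blast
      then have "ble x (s \<otimes> w)" using x(3) dw by (simp add: ldown_def)
      then show "EL x (s \<otimes> w)" using less.hyps lt x(1) by blast
    qed
    show ?thesis
    proof (cases "asc s u")
      case True then show ?thesis using A less.prems by blast
    next
      case nu: False
      have su: "s \<otimes> u \<in> carrier G" "asc s (s \<otimes> u)" using asc_left less.prems s nu by auto
      have "ble (s \<otimes> u) u" using ldown_le[OF less.prems(1) s(1)] nu by (simp add: ldown_def)
      then have "ble (s \<otimes> u) w" using less.prems ble_trans by blast
      moreover have "ble (s \<otimes> u) (s \<otimes> w)" using ldown_mono[OF less.prems(2) s(1)] nu dw by (simp add: ldown_def)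
      ultimately show ?thesis
        using EL_desc[OF less.prems(1) wc s(1) nu dw] A su less.hyps lt less.prems(1) by blast
    qed
  qed
qed

lemma ex_inc_chain: "u \<in> carrier G \<Longrightarrow> ble u w \<Longrightarrow> \<exists>ts. chain u ts w \<and> inc ts"
  using EL_all ELD(1) by blast

lemma inc_chain_unique:
  assumes "u \<in> carrier G" "chain u ts w" "inc ts" "chain u ts' w" "inc ts'" shows "ts = ts'"
  using ELD(2)[OF EL_all[OF assms(1) chain_ble[OF assms(2,1)]]] assms by blast

text \<open>The coatom condition for the increasing chain gives \<open>b' = b\<close> or the claim,
  and equality would force \<open>a' = a\<close>.\<close>

lemma descent_flip:
  assumes "x \<in> carrier G" "chain x [a, b] z" "b \<ll> a"
  obtains a' b' where "chain x [a', b'] z" "a' \<ll> b'" "b \<ll> b'"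
proof -
  have E: "EL x z" using EL_all chain_ble assms by blast
  obtain ts where ts: "chain x ts z" "inc ts" using ELD(1)[OF E] by blast
  have "length ts = length [a, b]" using chain_len[OF ts(1)] chain_len[OF assms(2)] by simp
  then obtain a' b' where t: "ts = [a', b']" by (auto simp: length_Suc_conv)
  have xa: "ble x (x \<otimes> a)" using chain_ble[of x "[a]" "x \<otimes> a"] assms by simp
  have "last ts = b \<or> b \<ll> last ts" using ELD(3)[OF E ts xa, of b] assms by auto
  moreover have "b' \<noteq> b"
  proof
    assume "b' = b"
    then have "x \<otimes> a' \<otimes> b = x \<otimes> a \<otimes> b" "a \<in> T" "a' \<in> T" "b \<in> T" using ts(1) assms(2) unfolding t by auto
    then have "a' = a" using assms(1) by simp
    then show False using ts(2) assms(3) \<open>b' = b\<close> prec_asym unfolding t by auto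
  qed
  ultimately have "b \<ll> b'" unfolding t by simp
  then show ?thesis using that ts unfolding t by simp
qed


section \<open>Right multiplication and finiteness of intervals\<close>

definition rdown :: "'a \<Rightarrow> 'a \<Rightarrow> 'a" where "rdown s x = (if len x < len (x \<otimes> s) then x else x \<otimes> s)"
definition rup :: "'a \<Rightarrow> 'a \<Rightarrow> 'a" where "rup s x = (if len x < len (x \<otimes> s) then x \<otimes> s else x)"

text \<open>Inversion preserves the Bruhat order, so the right-handed lifting property, the one
  compatible with left cosets, is inherited from the left-handed one.\<close>

lemma rdown_rup_inv: assumes "x \<in> carrier G" "s \<in> S"
  shows "rdown s x = inv (ldown s (inv x))" "rup s x = inv (lup s (inv x))"
  using assms len_left_right[of "inv x" s] len_inv[of x]
  by (simp_all add: rdown_def rup_def ldown_def lup_def asc_def inv_mult_group)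

lemma rdown_carrier [simp]: "x \<in> carrier G \<Longrightarrow> s \<in> S \<Longrightarrow> rdown s x \<in> carrier G"
  and rup_carrier [simp]: "x \<in> carrier G \<Longrightarrow> s \<in> S \<Longrightarrow> rup s x \<in> carrier G"
  by (simp_all add: rdown_def rup_def)

lemma rdown_mono: "ble x y \<Longrightarrow> x \<in> carrier G \<Longrightarrow> s \<in> S \<Longrightarrow> ble (rdown s x) (rdown s y)"
  and rup_mono: "ble x y \<Longrightarrow> x \<in> carrier G \<Longrightarrow> s \<in> S \<Longrightarrow> ble (rup s x) (rup s y)"
  using ble_carrier[of x y] by (auto simp: rdown_rup_inv intro!: ble_inv ldown_mono lup_mono)

lemma rup_ge: assumes "x \<in> carrier G" "s \<in> S" shows "ble x (rup s x)" "ble (x \<otimes> s) (rup s x)"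
proof -
  have a: "ble y (rup s y)" if "y \<in> carrier G" for y
    using ble_inv[OF lup_ge[of "inv y" s]] assms that by (simp add: rdown_rup_inv)
  show "ble x (rup s x)" using a assms by blast
  have "x \<otimes> s \<otimes> s = x" using assms by simp
  then have "rup s (x \<otimes> s) = rup s x" using len_right_cases[OF assms] unfolding rup_def by (elim disjE) simp_all
  then show "ble (x \<otimes> s) (rup s x)" using a[of "x \<otimes> s"] assms by simp
qed

lemma rdown_le: assumes "x \<in> carrier G" "s \<in> S" shows "ble (rdown s x) x" "ble (rdown s x) (x \<otimes> s)"
proof -
  have a: "ble (rdown s y) y" if "y \<in> carrier G" for y
    using ble_inv[OF ldown_le[of "inv y" s]] assms that by (simp add: rdown_rup_inv)
  show "ble (rdown s x) x" using a assms by blast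
  have "x \<otimes> s \<otimes> s = x" using assms by simp
  then have "rdown s (x \<otimes> s) = rdown s x" using len_right_cases[OF assms] unfolding rdown_def by (elim disjE) simp_all
  then show "ble (rdown s x) (x \<otimes> s)" using a[of "x \<otimes> s"] assms by simp
qed

text \<open>By lifting, every element below \<open>w\<close> is below \<open>s \<otimes> w\<close>
  up to left multiplication by \<open>s\<close>. The lower set at most doubles at each step,
  whatever the size of \<open>S\<close>.\<close>

lemma finite_below: "w \<in> carrier G \<Longrightarrow> finite {x \<in> carrier G. ble x w}"
proof (induction "len w" arbitrary: w rule: less_induct)
  case less
  show ?case
  proof (cases "w = \<one>")
    case True
    have "{x \<in> carrier G. ble x w} \<subseteq> {\<one>}" using ble_len[of _ w] True by fastforce
    then show ?thesis by (rule finite_subset) simp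
  next
    case False
    obtain s where s: "s \<in> S" "len w = Suc (len (s \<otimes> w))" using ex_left_descent[OF less.prems False] .
    let ?A = "{x \<in> carrier G. ble x (s \<otimes> w)}"
    have d: "ldown s w = s \<otimes> w" using s not_asc[OF less.prems s(1)] by (simp add: ldown_def)
    have "{x \<in> carrier G. ble x w} \<subseteq> ?A \<union> (\<lambda>x. s \<otimes> x) ` ?A"
    proof
      fix x assume "x \<in> {x \<in> carrier G. ble x w}"
      then have x: "x \<in> carrier G" "ble (ldown s x) (s \<otimes> w)" using ldown_mono[of x w s] s d by auto
      show "x \<in> ?A \<union> (\<lambda>x. s \<otimes> x) ` ?A"
      proof (cases "asc s x")
        case True then show ?thesis using x by (simp add: ldown_def)
      next
        case False
        then have "s \<otimes> x \<in> ?A" using x s by (simp add: ldown_def)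
        moreover have "x = s \<otimes> (s \<otimes> x)" using x s by simp
        ultimately show ?thesis by blast
      qed
    qed
    moreover have "finite ?A" using less.hyps[of "s \<otimes> w"] less.prems s by simp
    ultimately show ?thesis by (meson finite_Un finite_imageI finite_subset)
  qed
qed

lemma finite_interval: "w \<in> carrier G \<Longrightarrow> finite (bruhat_interval G S u w)"
  by (rule finite_subset[OF _ finite_below[of w]]) (auto simp: bruhat_interval_def)

section \<open>Vertices of a chain\<close>

primrec verts :: "'a \<Rightarrow> 'a list \<Rightarrow> 'a set" where
  "verts x [] = {x}"
| "verts x (t # ts) = insert x (verts (x \<otimes> t) ts)"

lemma start_in_verts [simp]: "x \<in> verts x ts" by (cases ts) auto

lemma verts_append: "chain x p y \<Longrightarrow> verts x (p @ q) = verts x p \<union> verts y q"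
  by (induction p arbitrary: x) auto

lemma end_in_verts: "chain x ts y \<Longrightarrow> y \<in> verts x ts"
  by (induction ts arbitrary: x) auto

lemma finite_verts [simp]: "finite (verts x ts)" by (induction ts arbitrary: x) auto

lemma verts_carrier: "chain x ts y \<Longrightarrow> x \<in> carrier G \<Longrightarrow> verts x ts \<subseteq> carrier G"
  by (induction ts arbitrary: x) auto

lemma cover_ble: "x \<in> carrier G \<Longrightarrow> t \<in> T \<Longrightarrow> len (x \<otimes> t) = Suc (len x) \<Longrightarrow> ble x (x \<otimes> t)"
  using chain_ble[of x "[t]" "x \<otimes> t"] by simp

lemma verts_split: "chain x ts y \<Longrightarrow> v \<in> verts x ts \<Longrightarrow> \<exists>p q. ts = p @ q \<and> chain x p v \<and> chain v q y"
proof (induction ts arbitrary: x)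
  case (Cons t ts)
  show ?case
  proof (cases "v = x")
    case True
    have "t # ts = [] @ t # ts \<and> chain x [] v \<and> chain v (t # ts) y" using True Cons.prems by simp
    then show ?thesis by blast
  next
    case False
    then have "\<exists>p q. ts = p @ q \<and> chain (x \<otimes> t) p v \<and> chain v q y" using Cons.prems by (intro Cons.IH) auto
    then obtain p q where "ts = p @ q" "chain (x \<otimes> t) p v" "chain v q y" by blast
    then show ?thesis using Cons.prems by (intro exI[of _ "t # p"] exI[of _ q]) auto
  qed
qed auto

lemma verts_ble: assumes "chain x ts y" "x \<in> carrier G" "v \<in> verts x ts" shows "ble x v" "ble v y"
  using verts_split[OF assms(1,3)] chain_ble chain_carrier assms(2) by blast+

lemma verts_total:
  assumes "chain x ts y" "x \<in> carrier G" "v \<in> verts x ts" "v' \<in> verts x ts" shows "ble v v' \<or> ble v' v"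
proof -
  obtain p q where pq: "ts = p @ q" "chain x p v" "chain v q y" using verts_split assms by blast
  then have "v' \<in> verts x p \<or> v' \<in> verts v q" using verts_append assms by auto
  then show ?thesis using verts_ble pq chain_carrier assms by blast
qed

end

section \<open>Projected chains\<close>

context labelled_coxeter begin

abbreviation H :: "'a set" where "H \<equiv> parabolic G J"
abbreviation proj :: "'a \<Rightarrow> 'a set" where "proj \<equiv> coset_proj G J"

lemma H_subgroup: "subgroup H G" using parabolic_subgroup J_sub by blast

sublocale sub_H: subgroup H G by (rule H_subgroup)

lemma H_carrier [simp]: "h \<in> H \<Longrightarrow> h \<in> carrier G" using sub_H.mem_carrier .

lemma J_H: "s \<in> J \<Longrightarrow> s \<in> H" unfolding parabolic_def by (rule generate.incl)

lemma J_S [simp]: "s \<in> J \<Longrightarrow> s \<in> S" using J_sub by blast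

lemma H_word: "h \<in> H \<longleftrightarrow> (\<exists>ws. set ws \<subseteq> J \<and> h = wp ws)" using parabolic_word J_sub by blast

lemma proj_mult [simp]: assumes "x \<in> carrier G" "h \<in> H" shows "proj (x \<otimes> h) = proj x"
proof -
  have "x \<otimes> h <#\<^bsub>G\<^esub> H = x <#\<^bsub>G\<^esub> H"
  proof (intro equalityI subsetI)
    fix y assume "y \<in> x \<otimes> h <#\<^bsub>G\<^esub> H"
    then obtain k where "k \<in> H" "y = x \<otimes> h \<otimes> k" by (auto simp: l_coset_def)
    then show "y \<in> x <#\<^bsub>G\<^esub> H" unfolding l_coset_def using assms by (auto simp: m_assoc)
  next
    fix y assume "y \<in> x <#\<^bsub>G\<^esub> H"
    then obtain k where "k \<in> H" "y = x \<otimes> k" by (auto simp: l_coset_def)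
    moreover from this have "y = x \<otimes> h \<otimes> (inv h \<otimes> k)" using assms by (simp add: m_assoc) (simp flip: m_assoc)
    moreover have "inv h \<otimes> k \<in> H" using assms \<open>k \<in> H\<close> by simp
    ultimately show "y \<in> x \<otimes> h <#\<^bsub>G\<^esub> H" unfolding l_coset_def by blast
  qed
  then show ?thesis by (simp add: coset_proj_def)
qed

lemma proj_eqD: assumes "x \<in> carrier G" "y \<in> carrier G" "proj x = proj y"
  obtains h where "h \<in> H" "y = x \<otimes> h"
proof -
  have "y \<in> proj y" using assms unfolding coset_proj_def l_coset_def by (auto intro!: bexI[of _ \<one>])
  then have "y \<in> proj x" using assms by simp
  then show ?thesis using that by (auto simp: coset_proj_def l_coset_def)
qed

lemma proj_step: assumes "x \<in> carrier G" "t \<in> carrier G" shows "proj (x \<otimes> t) = proj x \<longleftrightarrow> t \<in> H"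
proof
  assume "proj (x \<otimes> t) = proj x"
  then obtain h where h: "h \<in> H" "x \<otimes> t = x \<otimes> h" using proj_eqD[of x "x \<otimes> t"] assms by auto
  then have "t = h" using assms by simp
  then show "t \<in> H" using h by simp
qed (use assms in simp)

lemma proj_rdown: "x \<in> carrier G \<Longrightarrow> s \<in> J \<Longrightarrow> proj (rdown s x) = proj x"
  and proj_rup: "x \<in> carrier G \<Longrightarrow> s \<in> J \<Longrightarrow> proj (rup s x) = proj x"
  by (simp_all add: rdown_def rup_def J_H)

text \<open>Along a word for \<open>h\<close>, each letter \<open>a\<close> replaces
  \<open>x\<close> by \<open>rdown a x\<close>, which stays below \<open>y \<otimes> a\<close> and
  in the same coset.\<close>

lemma coset_lower:
  assumes "ble x y" "x \<in> carrier G" "h \<in> H"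
  shows "\<exists>g \<in> H. ble (x \<otimes> g) (y \<otimes> h)"
proof -
  have "\<exists>z. z \<in> carrier G \<and> proj z = proj x \<and> ble z (y \<otimes> wp ws)" if "set ws \<subseteq> J" "ble x y" "x \<in> carrier G" for ws x y
    using that
  proof (induction ws arbitrary: x y)
    case Nil then show ?case using ble_carrier by auto
  next
    case (Cons a ws)
    then have a: "a \<in> J" "set ws \<subseteq> J" and yc: "y \<in> carrier G" using ble_carrier by auto
    then have wc: "wp ws \<in> carrier G" using J_sub by blast
    have "ble (rdown a x) (y \<otimes> a)"
      using ble_trans[OF rdown_mono[OF Cons.prems(2,3)] rdown_le(2)[OF yc]] a by simp
    then obtain z where "z \<in> carrier G" "proj z = proj (rdown a x)" "ble z (y \<otimes> a \<otimes> wp ws)"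
      using Cons.IH[OF a(2)] Cons.prems a by (meson J_S rdown_carrier)
    then show ?case using proj_rdown Cons.prems a yc wc by (auto simp: m_assoc)
  qed
  then obtain z where "z \<in> carrier G" "proj z = proj x" "ble z (y \<otimes> h)" using H_word assms by metis
  then show ?thesis using proj_eqD[of x z] assms by metis
qed

text \<open>Starting from a shortest element of the coset of \<open>x'\<close>, go down into the
  coset of \<open>y\<close> and from there into that of \<open>x\<close>. This returns to the first
  coset, so by minimality nothing has moved.\<close>

lemma coset_antisym:
  assumes c: "x \<in> carrier G" "x' \<in> carrier G" "y' \<in> carrier G"
    and le: "ble x y" "ble y' x'" and p: "proj x = proj x'" "proj y = proj y'"
  shows "proj x = proj y"
proof -
  have yc: "y \<in> carrier G" using le c ble_carrier by blast
  define P where "P n \<longleftrightarrow> (\<exists>h \<in> H. len (x' \<otimes> h) = n)" for n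
  have "P (len (x' \<otimes> \<one>))" unfolding P_def using sub_H.one_closed by blast
  then have "P (LEAST n. P n)" by (rule LeastI)
  then obtain k where k: "k \<in> H" "len (x' \<otimes> k) = (LEAST n. P n)" unfolding P_def by blast
  have min: "len (x' \<otimes> k) \<le> len (x' \<otimes> g)" if "g \<in> H" for g
    unfolding k(2) by (rule Least_le) (use that P_def in blast)
  obtain g where g: "g \<in> H" "ble (y' \<otimes> g) (x' \<otimes> k)" using coset_lower[OF le(2) c(3) k(1)] by blast
  have "proj (y' \<otimes> g) = proj y" using g p c by simp
  then obtain h' where h': "h' \<in> H" "y' \<otimes> g = y \<otimes> h'" using proj_eqD[of y "y' \<otimes> g"] yc c g by auto
  obtain g' where g': "g' \<in> H" "ble (x \<otimes> g') (y \<otimes> h')" using coset_lower[OF le(1) c(1) h'(1)] by blast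
  have "proj (x \<otimes> g') = proj x'" using g' p c by simp
  then obtain k' where k': "k' \<in> H" "x \<otimes> g' = x' \<otimes> k'" using proj_eqD[of x' "x \<otimes> g'"] c g' by auto
  have "ble (x \<otimes> g') (x' \<otimes> k)" using ble_trans[OF g'(2)] g(2) unfolding h'(2) .
  then have "x \<otimes> g' = x' \<otimes> k" using ble_len min[OF k'(1)] k'(2) by fastforce
  then have "x \<otimes> g' = y \<otimes> h'" using ble_antisym[OF g'(2)] g(2) h'(2) by simp
  then have "proj (x \<otimes> g') = proj (y \<otimes> h')" by simp
  then show ?thesis using c yc g' h' by simp
qed

text \<open>The bound is built letter by letter with \<open>rup\<close>, because an infinite
  parabolic subgroup has no longest element that could serve for all.\<close>

lemma coset_upper:
  assumes "y \<in> carrier G" "y' \<in> carrier G" "proj y = proj y'"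
  obtains z where "z \<in> carrier G" "proj z = proj y" "ble y z" "ble y' z"
proof -
  have "\<exists>z. z \<in> carrier G \<and> proj z = proj y \<and> ble y z \<and> ble (y \<otimes> wp ws) z" if "set ws \<subseteq> J" for ws
    using that
  proof (induction ws rule: rev_induct)
    case Nil then show ?case using assms by auto
  next
    case (snoc a ws)
    then obtain z where z: "z \<in> carrier G" "proj z = proj y" "ble y z" "ble (y \<otimes> wp ws) z" by auto
    have a: "a \<in> J" "set ws \<subseteq> S" "a \<in> S" using snoc.prems J_sub by auto
    have c: "y \<otimes> wp ws \<in> carrier G" using a assms by blast
    have "y \<otimes> wp (ws @ [a]) = y \<otimes> wp ws \<otimes> a" using a assms by (simp add: wp_append m_assoc)
    then have "ble (y \<otimes> wp (ws @ [a])) (rup a z)"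
      using ble_trans[OF rup_ge(2)[OF c a(3)] rup_mono[OF z(4) c a(3)]] by simp
    moreover have "rup a z \<in> carrier G" "proj (rup a z) = proj y" using z a proj_rup by simp_all
    moreover have "ble y (rup a z)" using ble_trans[OF z(3) rup_ge(1)[OF z(1) a(3)]] .
    ultimately show ?case by blast
  qed
  moreover obtain h where "h \<in> H" "y' = y \<otimes> h" using proj_eqD assms by blast
  moreover from this obtain ws where "set ws \<subseteq> J" "h = wp ws" using H_word by blast
  ultimately show ?thesis using that by metis
qed

definition min_rep :: "'a \<Rightarrow> bool" where
  "min_rep w \<longleftrightarrow> w \<in> carrier G \<and> (\<forall>s \<in> J. len w < len (w \<otimes> s))"

text \<open>Minimality, tested only on single generators, makes \<open>w\<close> fixed under all
  \<open>rdown a\<close>; monotonicity then puts it below its whole coset.\<close>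

lemma min_rep_ble: assumes w: "min_rep w" and h: "h \<in> H" shows "ble w (w \<otimes> h)"
proof -
  have wc: "w \<in> carrier G" using w min_rep_def by blast
  have "ble w (x \<otimes> wp ws)" if "set ws \<subseteq> J" "ble w x" "x \<in> carrier G" for ws x
    using that
  proof (induction ws arbitrary: x)
    case (Cons a ws)
    then have a: "a \<in> J" "a \<in> S" "set ws \<subseteq> J" by auto
    then have c: "wp ws \<in> carrier G" using J_sub by blast
    have "rdown a w = w" using w a by (simp add: rdown_def min_rep_def)
    then have "ble w (x \<otimes> a)" using ble_trans[OF rdown_mono[OF Cons.prems(2) wc a(2)] rdown_le(2)[OF Cons.prems(3) a(2)]] by simp
    then have "ble w (x \<otimes> a \<otimes> wp ws)" using Cons.IH a Cons.prems by simp
    then show ?case using a c Cons.prems by (simp add: m_assoc)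
  qed auto
  moreover obtain ws where "set ws \<subseteq> J" "h = wp ws" using H_word h by blast
  ultimately show ?thesis using wc ble_refl by metis
qed

section \<open>Chains with distinct projections\<close>

definition pchain :: "'a \<Rightarrow> 'a list \<Rightarrow> 'a \<Rightarrow> bool" where
  "pchain x ts y \<longleftrightarrow> chain x ts y \<and> (\<forall>t \<in> set ts. t \<notin> H)"

lemma pchain_chain: "pchain x ts y \<Longrightarrow> chain x ts y" by (simp add: pchain_def)

text \<open>A return to the coset of \<open>x\<close> would, by antisymmetry on cosets, already keep
  the first step inside it.\<close>

lemma pchain_neq:
  assumes "pchain x (p @ q) w" "x \<in> carrier G" "p \<noteq> []" "chain x p v" shows "proj v \<noteq> proj x"
proof
  assume e: "proj v = proj x"
  obtain t p' where p: "p = t # p'" using assms(3) by (cases p) auto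
  have t: "t \<in> T" "t \<notin> H" "chain (x \<otimes> t) p' v" "len (x \<otimes> t) = Suc (len x)" using assms by (auto simp: p pchain_def)
  have c: "x \<otimes> t \<in> carrier G" "v \<in> carrier G" using assms t chain_carrier by auto
  have "proj x = proj (x \<otimes> t)"
    by (rule coset_antisym[of x v "x \<otimes> t"])
      (use assms(2) c e chain_ble[OF t(3)] cover_ble[of x t] t in auto)
  then show False using proj_step assms t by auto
qed

lemma pchain_start_notin:
  assumes "pchain x (t # ts) w" "x \<in> carrier G" shows "proj x \<notin> proj ` verts (x \<otimes> t) ts"
proof
  assume "proj x \<in> proj ` verts (x \<otimes> t) ts"
  then obtain v where v: "v \<in> verts (x \<otimes> t) ts" "proj x = proj v" by auto
  moreover have "chain (x \<otimes> t) ts w" using assms by (simp add: pchain_def)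
  ultimately obtain p q where "ts = p @ q" "chain (x \<otimes> t) p v" using verts_split by blast
  then have "chain x (t # p) v" "pchain x ((t # p) @ q) w" using assms by (auto simp: pchain_def)
  then show False using pchain_neq[of x "t # p" q w v] v assms by simp
qed

lemma card_pchain: "pchain x ts w \<Longrightarrow> x \<in> carrier G \<Longrightarrow> card (proj ` verts x ts) = Suc (length ts)"
proof (induction ts arbitrary: x)
  case (Cons t ts)
  have "pchain (x \<otimes> t) ts w" "x \<otimes> t \<in> carrier G" using Cons.prems by (auto simp: pchain_def)
  then have "card (proj ` verts (x \<otimes> t) ts) = Suc (length ts)" using Cons.IH by blast
  then show ?case using pchain_start_notin[OF Cons.prems] by simp
qed simp

lemma inc_split:
  assumes "inc ts" "set ts \<subseteq> T"
  obtains p g where "ts = p @ g" "\<forall>t \<in> set p. t \<notin> H" "set g \<subseteq> H"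
proof -
  have "\<exists>p g. ts = p @ g \<and> (\<forall>t \<in> set p. t \<notin> H) \<and> set g \<subseteq> H" using assms
  proof (induction ts)
    case Nil then show ?case by simp
  next
    case (Cons t ts)
    show ?case
    proof (cases "t \<in> H")
      case True
      have "r \<in> H" if "r \<in> set ts" for r
        using Cons.prems that True prec_parabolic[of t r] prec_asym by auto
      then have "t # ts = [] @ t # ts \<and> (\<forall>t \<in> set []. t \<notin> H) \<and> set (t # ts) \<subseteq> H" using True by auto
      then show ?thesis by blast
    next
      case False
      then obtain p g where "ts = p @ g" "\<forall>t \<in> set p. t \<notin> H" "set g \<subseteq> H" using Cons by auto
      then show ?thesis using False by (intro exI[of _ "t # p"] exI[of _ g]) auto
    qed
  qed
  then show ?thesis using that by blast
qed

lemma inc_append: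
  assumes "inc p" "inc g" "set g \<subseteq> H" "\<forall>t \<in> set p. t \<notin> H" "set p \<subseteq> T" "set g \<subseteq> T"
  shows "inc (p @ g)"
proof -
  have "r \<ll> t" if "r \<in> set p" "t \<in> set g" for r t
    using prec_parabolic[of t r] that assms by blast
  then show ?thesis using assms by (simp add: sorted_wrt_append)
qed

text \<open>A last label in \<open>H\<close> would lead to \<open>w\<close> from a smaller element
  of its own coset.\<close>

lemma min_rep_last:
  assumes "min_rep w" "chain x (p @ [l]) w" "x \<in> carrier G" shows "l \<notin> H"
proof
  assume l: "l \<in> H"
  obtain y where y: "chain x p y" "l \<in> T" "y \<otimes> l = w" "len w = Suc (len y)" using assms(2) by (auto simp: chain_append)
  have "w \<otimes> l = y" using y chain_carrier[OF y(1) assms(3)] by auto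
  then have "ble w y" using min_rep_ble[OF assms(1) l] by simp
  then show False using ble_len y by fastforce
qed

text \<open>Labels in \<open>H\<close> come at the end of an increasing chain, and the last label is
  not one of them.\<close>

lemma inc_chain_pchain:
  assumes "min_rep w" "chain x ts w" "inc ts" "x \<in> carrier G" shows "pchain x ts w"
proof -
  obtain p g where pg: "ts = p @ g" "\<forall>t \<in> set p. t \<notin> H" "set g \<subseteq> H" using inc_split chain_T assms by metis
  have "g = []"
  proof (rule ccontr)
    assume "g \<noteq> []"
    then obtain g' l where "g = g' @ [l]" by (cases g rule: rev_cases) auto
    then show False using min_rep_last[of w x "p @ g'" l] assms pg by simp
  qed
  then show ?thesis using pg assms by (simp add: pchain_def)
qed

lemma chain_H_proj: "chain z g x \<Longrightarrow> set g \<subseteq> H \<Longrightarrow> z \<in> carrier G \<Longrightarrow> proj x = proj z"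
  by (induction g arbitrary: z) auto

lemma chain_proj_H:
  "chain z g x \<Longrightarrow> proj x = proj z \<Longrightarrow> z \<in> carrier G \<Longrightarrow> set g \<subseteq> H"
proof (induction g arbitrary: z)
  case (Cons t g)
  have c: "z \<otimes> t \<in> carrier G" "x \<in> carrier G" "t \<in> carrier G" using Cons.prems chain_carrier by auto
  have "ble z (z \<otimes> t)" "ble (z \<otimes> t) x" using Cons.prems cover_ble[of z t] chain_ble[of "z \<otimes> t" g x] c by auto
  then have "proj z = proj (z \<otimes> t)"
    by (rule coset_antisym[OF Cons.prems(3) c(2,1) _ _ Cons.prems(2)[symmetric] HOL.refl])
  then show ?case using Cons.IH[of "z \<otimes> t"] Cons.prems c proj_step[of z t] by auto
qed simp

text \<open>Faces are lifted greedily from the bottom: each increasing chain runs first outside the parabolic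
  subgroup and then inside one coset, and the second part is discarded.\<close>

lemma face_in_pchain:
  assumes "min_rep w" "y \<in> carrier G" "ble y w" "sorted_wrt ble xs" "\<forall>x \<in> set xs. ble y x \<and> ble x w"
  shows "\<exists>ts. pchain y ts w \<and> proj ` set xs \<subseteq> proj ` verts y ts"
  using assms(2-)
proof (induction xs arbitrary: y)
  case Nil
  then show ?case using ex_inc_chain inc_chain_pchain assms(1) by fastforce
next
  case (Cons x xs)
  have "ble y x" using Cons.prems by simp
  then obtain ts where ts: "chain y ts x" "inc ts" using ex_inc_chain[OF Cons.prems(1)] by blast
  obtain p g where pg: "ts = p @ g" "\<forall>t \<in> set p. t \<notin> H" "set g \<subseteq> H" using inc_split chain_T ts by metis
  obtain z where z: "chain y p z" "chain z g x" using ts pg chain_append by auto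
  have zc: "z \<in> carrier G" using chain_carrier z Cons.prems by blast
  have zx: "ble z x" "proj x = proj z" using chain_ble chain_H_proj z pg zc by auto
  have "ble z w" using zx Cons.prems ble_trans by auto
  moreover have "\<forall>x' \<in> set xs. ble z x' \<and> ble x' w" using zx Cons.prems ble_trans by auto
  ultimately obtain ts' where ts': "pchain z ts' w" "proj ` set xs \<subseteq> proj ` verts z ts'"
    using Cons.IH[OF zc] Cons.prems by auto
  have "pchain y (p @ ts') w" using pg z ts' unfolding pchain_def chain_append by auto
  moreover have "proj ` set (x # xs) \<subseteq> proj ` verts y (p @ ts')"
    using ts'(2) zx(2) verts_append[OF z(1), of ts'] start_in_verts[of z ts'] by auto
  ultimately show ?case by blast
qed

section \<open>Comparison from the top, and flips\<close>

definition top_less :: "'a list \<Rightarrow> 'a list \<Rightarrow> bool" where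
  "top_less ts ts' \<longleftrightarrow> (rev ts, rev ts') \<in> lex {(a, b). a \<ll> b}"

lemma top_less_trans: "top_less a b \<Longrightarrow> top_less b c \<Longrightarrow> top_less a c"
proof -
  have "trans (lex {(a, b). a \<ll> b})" using prec_trans by (intro lex_transI) (auto intro!: transI)
  then show "top_less a b \<Longrightarrow> top_less b c \<Longrightarrow> top_less a c" unfolding top_less_def by (rule transD)
qed

lemma top_less_irrefl: "\<not> top_less a a"
  unfolding top_less_def lex_conv using prec_irrefl by auto

lemma top_less_prefix: "top_less q q' \<Longrightarrow> top_less (a @ q) (a @ q')"
  unfolding top_less_def by (simp add: lex_append_rightI)

lemma top_less_base: "b \<ll> b' \<Longrightarrow> top_less (a # b # q) (a' # b' # q)"
  unfolding top_less_def by (simp add: lex_append_leftI)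

text \<open>If the lower new label were in \<open>H\<close>, so would be the larger upper one, and
  the two steps would stay in one coset.\<close>

lemma flip_cases:
  assumes "x \<in> carrier G" "chain x [a, b] z" "b \<ll> a" "b \<notin> H" "proj z \<noteq> proj x"
  obtains a' b' where "chain x [a', b'] z" "a' \<notin> H" "b \<ll> b'"
proof -
  obtain a' b' where f: "chain x [a', b'] z" "a' \<ll> b'" "b \<ll> b'" using descent_flip assms by metis
  have T: "a' \<in> T" "b' \<in> T" using f by auto
  have "a' \<notin> H"
  proof
    assume a: "a' \<in> H"
    then have "b' \<in> H" using prec_parabolic[OF T(1) a T(2)] prec_asym f(2) by blast
    then have "proj z = proj x" using chain_H_proj[OF f(1)] a assms(1) by simp
    then show False using assms by simp
  qed
  then show ?thesis using that f by blast
qed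

text \<open>A label in \<open>H\<close> followed by one outside is always a descent, and flipping it
  either removes the label or moves it one step up. The vertex lost, \<open>x \<otimes> j\<close>,
  has the same image as \<open>x\<close>. The process stops because the last label of a chain to
  \<open>w\<close> is outside \<open>H\<close>.\<close>

lemma push_up:
  assumes "min_rep w" "chain x (j # ts) w" "x \<in> carrier G" "j \<in> H" "\<forall>t \<in> set ts. t \<notin> H"
  shows "\<exists>ts'. pchain x ts' w \<and> top_less (j # ts) ts' \<and> proj ` verts x (j # ts) \<subseteq> proj ` verts x ts'"
  using assms(2-)
proof (induction ts arbitrary: x j)
  case Nil
  then have "j \<notin> H" by (intro min_rep_last[OF assms(1), of x "[]" j]) auto
  then show ?case using Nil by simp
next
  case (Cons t ts)
  let ?z = "x \<otimes> j \<otimes> t"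
  have jt: "j \<in> T" "t \<in> T" "t \<notin> H" "chain ?z ts w" using Cons.prems by auto
  have tj: "t \<ll> j" using prec_parabolic jt Cons.prems by blast
  have zx: "proj ?z \<noteq> proj x" using proj_step[of "x \<otimes> j" t] jt Cons.prems by auto
  have ch: "chain x [j, t] ?z" using Cons.prems by simp
  obtain a b where ab: "chain x [a, b] ?z" "a \<notin> H" "t \<ll> b" using flip_cases[OF Cons.prems(2) ch tj jt(3) zx] .
  have xa: "x \<otimes> a \<in> carrier G" "chain x [a] (x \<otimes> a)" "chain (x \<otimes> a) [b] ?z" "x \<otimes> a \<otimes> b = ?z" using ab Cons.prems by auto
  have lt: "top_less (j # t # ts) (a # b # ts)" using top_less_base ab by blast
  have sub: "proj ` verts x (j # t # ts) \<subseteq> insert (proj x) (proj ` verts ?z ts)"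
    using Cons.prems by auto
  show ?case
  proof (cases "b \<in> H")
    case False
    have "pchain x (a # b # ts) w" using ab jt False Cons.prems by (auto simp: pchain_def)
    moreover note lt
    moreover have "insert (proj x) (proj ` verts ?z ts) \<subseteq> proj ` verts x (a # b # ts)" using xa by auto
    ultimately show ?thesis by (intro exI conjI subset_trans[OF sub])
  next
    case True
    have "chain (x \<otimes> a) (b # ts) w" using ab jt by auto
    then obtain ts' where ts': "pchain (x \<otimes> a) ts' w" "top_less (b # ts) ts'"
      "proj ` verts (x \<otimes> a) (b # ts) \<subseteq> proj ` verts (x \<otimes> a) ts'"
      using Cons.IH[OF _ xa(1) True] Cons.prems by auto
    have "pchain x (a # ts') w" using ts' ab by (auto simp: pchain_def)
    moreover have "top_less (j # t # ts) (a # ts')"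
      using top_less_trans[OF lt] top_less_prefix[OF ts'(2), of "[a]"] by simp
    moreover have "insert (proj x) (proj ` verts ?z ts) \<subseteq> proj ` verts x (a # ts')" using ts'(3) xa by auto
    ultimately show ?thesis by (intro exI conjI subset_trans[OF sub])
  qed
qed

lemma pchain_flip:
  assumes w: "min_rep w" and p: "pchain u (as @ a # b # bs) w" and u: "u \<in> carrier G"
    and d: "b \<ll> a" and x: "chain u as x"
  shows "\<exists>ts'. pchain u ts' w \<and> top_less (as @ a # b # bs) ts' \<and>
    proj ` verts u (as @ a # b # bs) - {proj (x \<otimes> a)} \<subseteq> proj ` verts u ts'"
proof -
  let ?z = "x \<otimes> a \<otimes> b"
  have xc: "x \<in> carrier G" using chain_carrier x u by blast
  have pH: "a \<notin> H" "b \<notin> H" "\<forall>t \<in> set as. t \<notin> H" "\<forall>t \<in> set bs. t \<notin> H" using p by (auto simp: pchain_def)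
  have ch: "chain x (a # b # bs) w"
  proof -
    obtain x' where "chain u as x'" "chain x' (a # b # bs) w" using p unfolding pchain_def chain_append by blast
    then show ?thesis using chain_end_unique x by blast
  qed
  then have ch2: "chain x [a, b] ?z" "chain ?z bs w" by auto
  have "pchain x ([a, b] @ bs) w" using ch pH by (auto simp: pchain_def)
  then have zx: "proj ?z \<noteq> proj x" using pchain_neq[OF _ xc _ ch2(1)] by blast
  obtain a' b' where ab: "chain x [a', b'] ?z" "a' \<notin> H" "b \<ll> b'" using flip_cases[OF xc ch2(1) d pH(2) zx] .
  have xa: "x \<otimes> a' \<in> carrier G" "x \<otimes> a' \<otimes> b' = ?z" using ab xc by auto
  have lt: "top_less (as @ a # b # bs) (as @ a' # b' # bs)" using top_less_prefix top_less_base ab by blast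
  have sub: "proj ` verts u (as @ a # b # bs) - {proj (x \<otimes> a)} \<subseteq> proj ` verts u as \<union> insert (proj x) (proj ` verts ?z bs)"
    unfolding verts_append[OF x] by auto
  show ?thesis
  proof (cases "b' \<in> H")
    case False
    have "pchain u (as @ a' # b' # bs) w" using ab ch2 False pH x unfolding pchain_def chain_append by auto
    moreover note lt
    moreover have "proj ` verts u as \<union> insert (proj x) (proj ` verts ?z bs) \<subseteq> proj ` verts u (as @ a' # b' # bs)"
      unfolding verts_append[OF x] using xa by auto
    ultimately show ?thesis by (intro exI conjI subset_trans[OF sub])
  next
    case True
    have "chain (x \<otimes> a') (b' # bs) w" using ab ch2 by auto
    then obtain ts' where ts': "pchain (x \<otimes> a') ts' w" "top_less (b' # bs) ts'"
      "proj ` verts (x \<otimes> a') (b' # bs) \<subseteq> proj ` verts (x \<otimes> a') ts'"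
      using push_up[OF w _ xa(1) True pH(4)] by blast
    have "pchain u (as @ a' # ts') w" using ts' ab pH x unfolding pchain_def chain_append by auto
    moreover have "top_less (as @ a # b # bs) (as @ a' # ts')"
      using top_less_trans[OF lt] top_less_prefix[OF ts'(2), of "as @ [a']"] by simp
    moreover have "proj ` verts u as \<union> insert (proj x) (proj ` verts ?z bs) \<subseteq> proj ` verts u (as @ a' # ts')"
      unfolding verts_append[OF x] using ts'(3) xa by auto
    ultimately show ?thesis by (intro exI conjI subset_trans[OF sub])
  qed
qed

section \<open>Descents, and uniqueness of the facet\<close>

definition descents_in :: "'a set set \<Rightarrow> 'a \<Rightarrow> 'a list \<Rightarrow> bool" where
  "descents_in \<sigma> x ts \<longleftrightarrow> (\<forall>as a b bs y. ts = as @ a # b # bs \<and> b \<ll> a \<and> chain x as y \<longrightarrow> proj (y \<otimes> a) \<in> \<sigma>)"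

lemma no_descent_inc: "(\<And>as a b bs. ts = as @ a # b # bs \<Longrightarrow> a \<ll> b) \<Longrightarrow> inc ts"
proof (induction ts)
  case (Cons t ts)
  have i: "inc ts"
  proof (rule Cons.IH)
    fix as a b bs assume "ts = as @ a # b # bs"
    then show "a \<ll> b" using Cons.prems[of "t # as" a b bs] by simp
  qed
  show ?case
  proof (cases ts)
    case (Cons r rs)
    then have "t \<ll> r" using Cons.prems[of "[]" t r rs] by simp
    moreover have "\<forall>x \<in> set rs. r \<ll> x" using i Cons by simp
    ultimately have "\<forall>x \<in> set (r # rs). t \<ll> x" using prec_trans[of t r] by auto
    then show ?thesis using i Cons by simp
  qed simp
qed simp

text \<open>Cuts the chain at the first vertex after the start whose image is in
  \<open>\<sigma>\<close>. If all descents lie over \<open>\<sigma>\<close>, the part before the cut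
  has none and is increasing.\<close>

lemma first_in_face:
  assumes "chain x ts w" "ts \<noteq> []" "proj w \<in> \<sigma>"
  shows "\<exists>p q y. ts = p @ q \<and> p \<noteq> [] \<and> chain x p y \<and> chain y q w \<and> proj y \<in> \<sigma> \<and>
    (\<forall>p1 p2 v. p = p1 @ p2 \<and> p1 \<noteq> [] \<and> p2 \<noteq> [] \<and> chain x p1 v \<longrightarrow> proj v \<notin> \<sigma>) \<and>
    (\<forall>v \<in> verts x ts. proj v \<in> \<sigma> \<longrightarrow> v = x \<or> v \<in> verts y q)"
  using assms
proof (induction ts arbitrary: x)
  case (Cons t ts)
  have t: "t \<in> T" "len (x \<otimes> t) = Suc (len x)" "chain (x \<otimes> t) ts w" using Cons.prems by auto
  show ?case
  proof (cases "proj (x \<otimes> t) \<in> \<sigma>")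
    case True
    then show ?thesis using t
      by (intro exI[of _ "[t]"] exI[of _ ts] exI[of _ "x \<otimes> t"]) (auto simp: Cons_eq_append_conv)
  next
    case False
    then have "ts \<noteq> []" using t Cons.prems by auto
    then obtain p q y where IH: "ts = p @ q" "p \<noteq> []" "chain (x \<otimes> t) p y" "chain y q w" "proj y \<in> \<sigma>"
      "\<And>p1 p2 v. p = p1 @ p2 \<Longrightarrow> p1 \<noteq> [] \<Longrightarrow> p2 \<noteq> [] \<Longrightarrow> chain (x \<otimes> t) p1 v \<Longrightarrow> proj v \<notin> \<sigma>"
      "\<And>v. v \<in> verts (x \<otimes> t) ts \<Longrightarrow> proj v \<in> \<sigma> \<Longrightarrow> v = x \<otimes> t \<or> v \<in> verts y q"
      using Cons.IH[OF t(3) _ Cons.prems(3)] by metis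
    have "proj v \<notin> \<sigma>" if "t # p = p1 @ p2" "p1 \<noteq> []" "p2 \<noteq> []" "chain x p1 v" for p1 p2 v
    proof -
      from that(1,2) obtain p1' where p1: "p1 = t # p1'" "p = p1' @ p2" by (cases p1) auto
      show ?thesis
      proof (cases "p1' = []")
        case True then show ?thesis using that p1 False by auto
      next
        case ne: False then show ?thesis using IH(6)[OF p1(2) ne that(3)] that p1 by auto
      qed
    qed
    moreover have "v = x \<or> v \<in> verts y q" if "v \<in> verts x (t # ts)" "proj v \<in> \<sigma>" for v
      using that IH(7)[of v] False by auto
    ultimately show ?thesis using IH(1-5) t
      by (intro exI[of _ "t # p"] exI[of _ q] exI[of _ y]) auto
  qed
qed simp

text \<open>Both lifts reach the coset of the next vertex of \<open>\<sigma>\<close> by increasing chains. Prolonged inside that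
  coset to a common upper bound, they stay increasing, so they coincide.\<close>

lemma pchain_unique:
  assumes "pchain x ts w" "pchain x ts' w" "x \<in> carrier G"
    and "\<sigma> \<subseteq> proj ` verts x ts" "\<sigma> \<subseteq> proj ` verts x ts'" "proj w \<in> \<sigma>"
    and "descents_in \<sigma> x ts" "descents_in \<sigma> x ts'"
  shows "ts = ts'"
  using assms
proof (induction "length ts" arbitrary: x ts ts' \<sigma> rule: less_induct)
  case less
  note ch = pchain_chain[OF less.prems(1)] pchain_chain[OF less.prems(2)]
  note xc = less.prems(3)
  have len: "length ts = length ts'" using chain_len[OF ch(1)] chain_len[OF ch(2)] by simp
  show ?case
  proof (cases "ts = []")
    case True then show ?thesis using len by simp
  next
    case ne: False
    then have ne': "ts' \<noteq> []" using len by auto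
    obtain p q y where A: "ts = p @ q" "p \<noteq> []" "chain x p y" "chain y q w" "proj y \<in> \<sigma>"
      "\<And>p1 p2 v. p = p1 @ p2 \<Longrightarrow> p1 \<noteq> [] \<Longrightarrow> p2 \<noteq> [] \<Longrightarrow> chain x p1 v \<Longrightarrow> proj v \<notin> \<sigma>"
      "\<And>v. v \<in> verts x ts \<Longrightarrow> proj v \<in> \<sigma> \<Longrightarrow> v = x \<or> v \<in> verts y q"
      using first_in_face[OF ch(1) ne less.prems(6)] by metis
    obtain p' q' y' where B: "ts' = p' @ q'" "p' \<noteq> []" "chain x p' y'" "chain y' q' w" "proj y' \<in> \<sigma>"
      "\<And>p1 p2 v. p' = p1 @ p2 \<Longrightarrow> p1 \<noteq> [] \<Longrightarrow> p2 \<noteq> [] \<Longrightarrow> chain x p1 v \<Longrightarrow> proj v \<notin> \<sigma>"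
      "\<And>v. v \<in> verts x ts' \<Longrightarrow> proj v \<in> \<sigma> \<Longrightarrow> v = x \<or> v \<in> verts y' q'"
      using first_in_face[OF ch(2) ne' less.prems(6)] by metis
    have yc: "y \<in> carrier G" "y' \<in> carrier G" using A B chain_carrier xc by blast+
    have inc: "inc r" if "ts0 = r @ q0" "chain x ts0 w" "descents_in \<sigma> x ts0"
        "\<And>p1 p2 v. r = p1 @ p2 \<Longrightarrow> p1 \<noteq> [] \<Longrightarrow> p2 \<noteq> [] \<Longrightarrow> chain x p1 v \<Longrightarrow> proj v \<notin> \<sigma>" for r q0 ts0
    proof (rule no_descent_inc)
      fix as a b bs assume r: "r = as @ a # b # bs"
      have "chain x (as @ a # b # bs @ q0) w" using that(1,2) r by simp
      then obtain z where z: "chain x as z" "chain z (a # b # bs @ q0) w" unfolding chain_append by blast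
      have zc: "z \<in> carrier G" using z chain_carrier xc by blast
      have ab: "a \<in> T" "b \<in> T" "len (z \<otimes> a) = Suc (len z)" "len (z \<otimes> a \<otimes> b) = Suc (len (z \<otimes> a))" using z by auto
      have "chain x (as @ [a]) (z \<otimes> a)" unfolding chain_append using z by auto
      then have "proj (z \<otimes> a) \<notin> \<sigma>" using that(4)[of "as @ [a]" "b # bs"] r by simp
      then have "\<not> b \<ll> a" using that(1,3) z(1) r unfolding descents_in_def by auto
      moreover have "a \<noteq> b" using ab zc by auto
      ultimately show "a \<ll> b" using prec_total ab by blast
    qed
    have ip: "inc p" using inc[OF A(1) ch(1) less.prems(7) A(6)] .
    have ip': "inc p'" using inc[OF B(1) ch(2) less.prems(8) B(6)] .
    have yx: "proj y \<noteq> proj x" using pchain_neq[of x p q w y] less.prems(1) A xc by simp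
    have yx': "proj y' \<noteq> proj x" using pchain_neq[of x p' q' w y'] less.prems(2) B xc by simp
    obtain v where v: "v \<in> verts x ts'" "proj y = proj v" using A(5) less.prems(5) by blast
    then have "v \<in> verts y' q'" using B(7)[of v] A(5) yx by auto
    then have v2: "ble y' v" "v \<in> carrier G" using verts_ble[OF B(4)] verts_carrier[OF B(4)] yc by auto
    obtain v' where v': "v' \<in> verts x ts" "proj y' = proj v'" using B(5) less.prems(4) by blast
    then have "v' \<in> verts y q" using A(7)[of v'] B(5) yx' by auto
    then have v2': "ble y v'" using verts_ble[OF A(4)] yc by auto
    \<comment> \<open>Each of \<open>y\<close> and \<open>y'\<close> lies below a vertex in the
      coset of the other.\<close>
    have yy: "proj y = proj y'"
      using coset_antisym[of y v y' v'] yc v2 v2' v v' by simp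
    obtain z where z: "z \<in> carrier G" "proj z = proj y" "ble y z" "ble y' z" using coset_upper[OF yc yy] .
    obtain g where g: "chain y g z" "inc g" using ex_inc_chain[OF yc(1) z(3)] by blast
    obtain g' where g': "chain y' g' z" "inc g'" using ex_inc_chain[OF yc(2) z(4)] by blast
    have gH: "set g \<subseteq> H" "set g' \<subseteq> H" using chain_proj_H g g' z yc yy by simp_all
    have pH: "\<forall>t \<in> set p. t \<notin> H" "\<forall>t \<in> set p'. t \<notin> H" using less.prems(1,2) A(1) B(1) by (auto simp: pchain_def)
    have T: "set p \<subseteq> T" "set p' \<subseteq> T" "set g \<subseteq> T" "set g' \<subseteq> T" using chain_T A(3) B(3) g g' by blast+
    have "inc (p @ g)" using inc_append ip g(2) gH(1) pH(1) T(1,3) .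
    moreover have "inc (p' @ g')" using inc_append ip' g'(2) gH(2) pH(2) T(2,4) .
    moreover have "chain x (p @ g) z" "chain x (p' @ g') z" unfolding chain_append using A(3) B(3) g g' by blast+
    ultimately have "p @ g = p' @ g'" using inc_chain_unique[OF xc] by blast
    \<comment> \<open>The labels of \<open>p\<close> avoid \<open>H\<close> and those of
      \<open>g\<close> lie in it, so \<open>p\<close> can be recovered from the joint chain.\<close>
    moreover have "takeWhile (\<lambda>t. t \<notin> H) (p @ g) = p"
      using pH gH by (subst takeWhile_append2) (cases g; auto)+
    moreover have "takeWhile (\<lambda>t. t \<notin> H) (p' @ g') = p'"
      using pH gH by (subst takeWhile_append2) (cases g'; auto)+
    ultimately have pp: "p = p'" by simp
    then have y: "y = y'" using chain_end_unique A(3) B(3) by blast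
    \<comment> \<open>The remaining chains never return to the coset of \<open>x\<close>, so it has
      to leave the face, and the descents of the tails still lie over what remains.\<close>
    let ?\<sigma> = "\<sigma> - {proj x}"
    have "q = q'"
    proof (rule less.hyps[of q y q' ?\<sigma>])
      show "length q < length ts" using A by simp
      show "pchain y q w" "pchain y q' w" using less.prems(1,2) A B y by (auto simp: pchain_def)
      show "y \<in> carrier G" by fact
      show "?\<sigma> \<subseteq> proj ` verts y q" using less.prems(4) A(7) by blast
      show "?\<sigma> \<subseteq> proj ` verts y q'" using less.prems(5) B(7) y by blast
      have "proj w \<noteq> proj x" using pchain_neq[of x ts "[]" w w] less.prems(1) ch ne xc by simp
      then show "proj w \<in> ?\<sigma>" using less.prems(6) by simp
      have desc: "descents_in ?\<sigma> y q0" if "pchain x ts0 w" "ts0 = p @ q0" "descents_in \<sigma> x ts0" for ts0 q0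
        unfolding descents_in_def
      proof (intro allI impI)
        fix as a b bs z assume h: "q0 = as @ a # b # bs \<and> b \<ll> a \<and> chain y as z"
        then have xz: "chain x (p @ as) z" unfolding chain_append using A(3) by blast
        then have "proj (z \<otimes> a) \<in> \<sigma>" using that(2,3) h unfolding descents_in_def by (metis append.assoc)
        moreover have "chain x ((p @ as @ [a]) @ (b # bs)) w" using that h by (simp add: pchain_def)
        then obtain z' where z': "chain x (p @ as @ [a]) z'" unfolding chain_append[of x "p @ as @ [a]"] by blast
        then have "z' = z \<otimes> a" using xz chain_end_unique[of x "p @ as" z]
          by (metis append.assoc chain.simps chain_append)
        then have "proj (z \<otimes> a) \<noteq> proj x"
          using pchain_neq[of x "p @ as @ [a]" "b # bs" w z'] that h xc z' by simp
        ultimately show "proj (z \<otimes> a) \<in> ?\<sigma>" by simp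
      qed
      show "descents_in ?\<sigma> y q" using desc less.prems(1,7) A(1) by blast
      show "descents_in ?\<sigma> y q'" using desc less.prems(2,8) B(1) pp by blast
    qed
    then show ?thesis using A(1) B(1) pp by simp
  qed
qed

end

section \<open>Shellability\<close>

lemma abstract_image_order_complex: "abstract_complex (image_complex f (order_complex R Q))"
  unfolding abstract_complex_def
proof (intro conjI ballI allI impI)
  show "{} \<in> image_complex f (order_complex R Q)"
    unfolding image_complex_def order_complex_def by (intro image_eqI[of _ _ "{}"]) auto
next
  fix F assume "F \<in> image_complex f (order_complex R Q)"
  then show "finite F" unfolding image_complex_def order_complex_def by auto
next
  fix F F' assume F: "F \<in> image_complex f (order_complex R Q)" "F' \<subseteq> F"
  then obtain A where A: "A \<in> order_complex R Q" "F = f ` A" unfolding image_complex_def by blast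
  have "A \<inter> f -` F' \<in> order_complex R Q" using A(1) unfolding order_complex_def by auto
  moreover have "F' = f ` (A \<inter> f -` F')" using F(2) A(2) by auto
  ultimately show "F' \<in> image_complex f (order_complex R Q)" unfolding image_complex_def by blast
qed

text \<open>Facets that are larger for \<open>R\<close> are listed earlier. In \<open>flip\<close>
  either \<open>p\<close> has a ridge in an earlier facet that contains its intersection with
  \<open>q\<close>, or \<open>q\<close> can be exchanged for an earlier facet without shrinking that
  intersection.\<close>

lemma shellable_criterion:
  fixes F :: "'b \<Rightarrow> 'v set" and K :: "'v set set" and n :: nat and R :: "'b \<Rightarrow> 'b \<Rightarrow> bool"
  assumes K: "abstract_complex K" "finite K" and P: "finite P" and inj: "inj_on F P"
    and face: "\<And>p. p \<in> P \<Longrightarrow> F p \<in> K" and card: "\<And>p. p \<in> P \<Longrightarrow> card (F p) = Suc n"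
    and cover: "\<And>A. A \<in> K \<Longrightarrow> \<exists>p \<in> P. A \<subseteq> F p"
    and R: "\<And>p. \<not> R p p" "\<And>p q r. R p q \<Longrightarrow> R q r \<Longrightarrow> R p r"
    and flip: "\<And>p q. p \<in> P \<Longrightarrow> q \<in> P \<Longrightarrow> p \<noteq> q \<Longrightarrow>
      (\<exists>r \<in> P. R p r \<and> (\<exists>c. c \<in> F p \<and> c \<notin> F q \<and> F p - {c} \<subseteq> F r)) \<or>
      (\<exists>r \<in> P. R q r \<and> F p \<inter> F q \<subseteq> F r)"
  shows "shellable K"
proof -
  have fin: "finite (F p)" if "p \<in> P" for p using face[OF that] K(1) by (auto simp: abstract_complex_def)
  have facets: "facets K = F ` P"
  proof (intro equalityI subsetI)
    fix A assume A: "A \<in> facets K"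
    then obtain p where p: "p \<in> P" "A \<subseteq> F p" using cover unfolding facets_def by blast
    then have "F p = A" using A face unfolding facets_def by blast
    then show "A \<in> F ` P" using p by blast
  next
    fix A assume "A \<in> F ` P"
    then obtain p where p: "p \<in> P" "A = F p" by blast
    have "B = A" if B: "B \<in> K" "A \<subseteq> B" for B
    proof -
      obtain q where q: "q \<in> P" "B \<subseteq> F q" using cover B by blast
      then have "A = F q" using card_subset_eq[of "F q" A] fin card p B by auto
      then show ?thesis using q B by blast
    qed
    then show "A \<in> facets K" using p face unfolding facets_def by blast
  qed
  \<comment> \<open>Counting the larger elements turns the partial order \<open>R\<close> into a
    numerical key, so sorting gives a linear extension.\<close>
  define rank where "rank p = card {q \<in> P. R p q}" for p
  have rank: "rank q < rank p" if "p \<in> P" "q \<in> P" "R p q" for p q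
    unfolding rank_def
  proof (rule psubset_card_mono)
    show "{r \<in> P. R q r} \<subset> {r \<in> P. R p r}" using that R by blast
  qed (use P in simp)
  obtain ps0 where ps0: "set ps0 = P" "distinct ps0" using finite_distinct_list P by blast
  define ps where "ps = sort_key rank ps0"
  have ps: "set ps = P" "distinct ps" using ps0 by (simp_all add: ps_def)
  have sorted: "sorted (map rank ps)" unfolding ps_def by (rule sorted_sort_key)
  have before: "\<exists>k<i. ps ! k = r" if i: "i < length ps" "r \<in> P" "R (ps ! i) r" for i r
  proof -
    obtain k where k: "k < length ps" "ps ! k = r" using i(2) ps(1) by (metis in_set_conv_nth)
    have "k < i"
    proof (rule ccontr)
      assume "\<not> k < i"
      then have "rank (ps ! i) \<le> rank (ps ! k)" using sorted k(1) by (auto simp: sorted_iff_nth_mono)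
      then show False using rank[of "ps ! i" r] i k ps(1) by (metis leD nth_mem)
    qed
    then show ?thesis using k by blast
  qed
  have ridge: "\<exists>c k. k < i \<and> c \<in> F (ps ! i) \<and> c \<notin> F (ps ! j) \<and> F (ps ! i) - {c} \<subseteq> F (ps ! k)"
    if ij: "i < length ps" "j < i" for i j
    using ij(2)
  \<comment> \<open>The second alternative of \<open>flip\<close> replaces \<open>j\<close> by a
    smaller index, so the first one is reached eventually.\<close>
  proof (induction j rule: less_induct)
    case (less j)
    have in_P: "ps ! i \<in> P" "ps ! j \<in> P" using ps(1) ij less.prems by auto
    have ne: "ps ! i \<noteq> ps ! j" using ps(2) ij less.prems nth_eq_iff_index_eq by fastforce
    show ?case
    proof (cases "\<exists>r \<in> P. R (ps ! i) r \<and> (\<exists>c. c \<in> F (ps ! i) \<and> c \<notin> F (ps ! j) \<and> F (ps ! i) - {c} \<subseteq> F r)")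
      case True
      then show ?thesis using before[OF ij(1)] by blast
    next
      case False
      then obtain r where r: "r \<in> P" "R (ps ! j) r" "F (ps ! i) \<inter> F (ps ! j) \<subseteq> F r"
        using flip[OF in_P ne] by blast
      have "j < length ps" using ij less.prems by simp
      then obtain k where k: "k < j" "ps ! k = r" using before r by blast
      have "k < i" using k less.prems by simp
      then obtain c l where "l < i" "c \<in> F (ps ! i)" "c \<notin> F (ps ! k)" "F (ps ! i) - {c} \<subseteq> F (ps ! l)"
        using less.IH[OF k(1)] by blast
      then show ?thesis using k r by blast
    qed
  qed
  define \<sigma> where "\<sigma> = map F ps"
  have "shelling_order K \<sigma>"
    unfolding shelling_order_def
  proof (intro conjI exI[of _ "int n + 1"] allI impI)
    show "distinct \<sigma>" using ps inj by (simp add: \<sigma>_def distinct_map)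
    show "set \<sigma> = facets K" using ps facets by (simp add: \<sigma>_def)
    show "pure_of_dim K (int n + 1 - 1)"
      unfolding pure_of_dim_def facets face_dim_def using card by simp
    fix i assume i: "1 \<le> i \<and> i < length \<sigma>"
    let ?L = "Pow (\<sigma> ! i) \<inter> (\<Union>j<i. Pow (\<sigma> ! j))"
    have il: "i < length ps" using i by (simp add: \<sigma>_def)
    then have iP: "ps ! i \<in> P" using ps by auto
    have nth: "\<sigma> ! j = F (ps ! j)" if "j \<le> i" for j using that il by (simp add: \<sigma>_def)
    show "pure_of_dim ?L (int n + 1 - 2)" unfolding pure_of_dim_def
    proof
      fix \<tau> assume \<tau>: "\<tau> \<in> facets ?L"
      then obtain j where j: "j < i" "\<tau> \<subseteq> F (ps ! i)" "\<tau> \<subseteq> F (ps ! j)"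
        using nth unfolding facets_def by auto
      obtain c k where c: "k < i" "c \<in> F (ps ! i)" "c \<notin> F (ps ! j)" "F (ps ! i) - {c} \<subseteq> F (ps ! k)"
        using ridge[OF il j(1)] by blast
      have "F (ps ! i) - {c} \<in> ?L" using c nth[of i] nth[of k] by auto
      moreover have "\<tau> \<subseteq> F (ps ! i) - {c}" using j c by blast
      ultimately have "F (ps ! i) - {c} = \<tau>" using \<tau> unfolding facets_def by blast
      then have "card \<tau> = n" using c card[OF iP] by (metis card_Diff_singleton diff_Suc_1)
      then show "face_dim \<tau> = int n + 1 - 2" by (simp add: face_dim_def)
    qed
  qed
  then show ?thesis using K unfolding shellable_def by blast
qed

section \<open>Shelling the projected complex\<close>

context labelled_coxeter begin

abbreviation proj_complex :: "'a \<Rightarrow> 'a \<Rightarrow> 'a set set set" where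
  "proj_complex u w \<equiv> image_complex proj (order_complex ble (bruhat_interval G S u w))"

lemma sorted_chain:
  assumes "finite A" "\<And>x y. x \<in> A \<Longrightarrow> y \<in> A \<Longrightarrow> ble x y \<or> ble y x"
  obtains xs where "set xs = A" "sorted_wrt ble xs"
proof -
  obtain ys where ys: "set ys = A" using finite_list assms(1) by blast
  let ?xs = "sort_key len ys"
  have "sorted (map len ?xs)" by (rule sorted_sort_key)
  then have "sorted_wrt (\<lambda>x y. len x \<le> len y) ?xs" by (simp add: sorted_map)
  then have "sorted_wrt ble ?xs"
  proof (rule sorted_wrt_mono_rel[rotated])
    fix x y assume "x \<in> set ?xs" "y \<in> set ?xs" "len x \<le> len y"
    then show "ble x y" using assms(2)[of x y] ys ble_len[of y x] by auto
  qed
  then show ?thesis using that[of ?xs] ys by simp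
qed

lemma shellable_min_rep:
  assumes u: "u \<in> carrier G" and w: "min_rep w" and uw: "ble u w"
  shows "shellable (proj_complex u w)"
proof -
  have wc: "w \<in> carrier G" using w min_rep_def by blast
  let ?I = "bruhat_interval G S u w"
  define P where "P = {ts. pchain u ts w}"
  define F where "F ts = proj ` verts u ts" for ts
  have finI: "finite ?I" using finite_interval wc by blast
  have len: "length ts = len w - len u" if "ts \<in> P" for ts
    using chain_len[of u ts w] that by (simp add: P_def pchain_def)
  have vI: "verts u ts \<subseteq> ?I" if "ts \<in> P" for ts
    using that verts_ble[OF pchain_chain u] verts_carrier[OF pchain_chain u] unfolding P_def bruhat_interval_def by blast
  \<comment> \<open>Labels are quotients of vertices. Hence only finitely many labels occur over a
    finite interval, even if there are infinitely many reflections.\<close>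
  have sub: "set ts \<subseteq> (\<lambda>(x, y). inv x \<otimes> y) ` (verts x ts \<times> verts x ts)" if "chain x ts y" "x \<in> carrier G" for x y ts
    using that
  proof (induction ts arbitrary: x)
    case (Cons t ts)
    have "set ts \<subseteq> (\<lambda>(x, y). inv x \<otimes> y) ` (verts x (t # ts) \<times> verts x (t # ts))" using Cons by fastforce
    moreover have "t = inv x \<otimes> (x \<otimes> t)" using Cons.prems by (simp flip: m_assoc)
    then have "t \<in> (\<lambda>(x, y). inv x \<otimes> y) ` (verts x (t # ts) \<times> verts x (t # ts))"
      by (intro image_eqI[of _ _ "(x, x \<otimes> t)"]) auto
    ultimately show ?case by simp
  qed simp
  have "P \<subseteq> {ts. set ts \<subseteq> (\<lambda>(x, y). inv x \<otimes> y) ` (?I \<times> ?I) \<and> length ts = len w - len u}"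
  proof
    fix ts assume ts: "ts \<in> P"
    then have "set ts \<subseteq> (\<lambda>(x, y). inv x \<otimes> y) ` (verts u ts \<times> verts u ts)"
      using sub[of u ts w] u by (simp add: P_def pchain_def)
    then show "ts \<in> {ts. set ts \<subseteq> (\<lambda>(x, y). inv x \<otimes> y) ` (?I \<times> ?I) \<and> length ts = len w - len u}"
      using vI[OF ts] len[OF ts] by blast
  qed
  then have finP: "finite P"
    by (rule finite_subset) (intro finite_lists_length_eq finite_imageI finite_cartesian_product finI)
  have wF: "proj w \<in> F ts" if "ts \<in> P" for ts
    using that end_in_verts unfolding P_def F_def pchain_def by blast
  have uniq: "ts = ts'" if "ts \<in> P" "ts' \<in> P" "\<sigma> \<subseteq> F ts" "\<sigma> \<subseteq> F ts'" "proj w \<in> \<sigma>" "descents_in \<sigma> u ts" "descents_in \<sigma> u ts'" for ts ts' \<sigma>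
    using pchain_unique[OF _ _ u, of ts w ts' \<sigma>] that unfolding P_def F_def by blast
  have all_desc: "descents_in (F ts) u ts" if "ts \<in> P" for ts
    unfolding descents_in_def
  proof (intro allI impI)
    fix as a b bs y assume h: "ts = as @ a # b # bs \<and> b \<ll> a \<and> chain u as y"
    then show "proj (y \<otimes> a) \<in> F ts" unfolding F_def using verts_append[of u as y "a # b # bs"] by auto
  qed
  have fl: "\<exists>r \<in> P. top_less ts r \<and> (\<exists>c. c \<in> F ts \<and> c \<notin> \<sigma> \<and> F ts - {c} \<subseteq> F r)"
    if ts: "ts \<in> P" "\<not> descents_in \<sigma> u ts" for ts \<sigma>
  proof -
    obtain as a b bs y where d: "ts = as @ a # b # bs" "b \<ll> a" "chain u as y" "proj (y \<otimes> a) \<notin> \<sigma>"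
      using ts(2) unfolding descents_in_def by blast
    have "proj (y \<otimes> a) \<in> F ts" using all_desc[OF ts(1)] d unfolding descents_in_def by blast
    then show ?thesis using pchain_flip[OF w _ u d(2,3), of bs] ts(1) d(1,4) unfolding P_def F_def by blast
  qed
  show ?thesis
  proof (rule shellable_criterion[where F = F and P = P and n = "len w - len u" and R = top_less])
    show "abstract_complex (proj_complex u w)" by (rule abstract_image_order_complex)
    have "order_complex ble ?I \<subseteq> Pow ?I" unfolding order_complex_def by blast
    then have "finite (order_complex ble ?I)" using finI by (meson finite_Pow_iff finite_subset)
    then show "finite (proj_complex u w)" unfolding image_complex_def by simp
    show "finite P" by fact
    show "inj_on F P"
    proof (rule inj_onI)
      fix ts ts' assume h: "ts \<in> P" "ts' \<in> P" "F ts = F ts'"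
      then show "ts = ts'" using uniq[of ts ts' "F ts"] all_desc[OF h(1)] all_desc[OF h(2)] wF[OF h(1)] by simp
    qed
    show "F ts \<in> proj_complex u w" if "ts \<in> P" for ts
    proof -
      have "verts u ts \<in> order_complex ble ?I" using vI[OF that] verts_total[OF pchain_chain u] that
        unfolding order_complex_def P_def by auto
      then show ?thesis unfolding F_def image_complex_def by blast
    qed
    show "card (F ts) = Suc (len w - len u)" if "ts \<in> P" for ts
      using card_pchain[of u ts w] len that u by (simp add: F_def P_def)
    show "\<exists>p \<in> P. A \<subseteq> F p" if A: "A \<in> proj_complex u w" for A
    proof -
      obtain B where B: "A = proj ` B" "finite B" "B \<subseteq> ?I" "\<And>x y. x \<in> B \<Longrightarrow> y \<in> B \<Longrightarrow> ble x y \<or> ble y x"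
        using A unfolding image_complex_def order_complex_def by blast
      obtain xs where xs: "set xs = B" "sorted_wrt ble xs" using sorted_chain B by blast
      have "\<forall>x \<in> set xs. ble u x \<and> ble x w" using xs B unfolding bruhat_interval_def by blast
      then show ?thesis using face_in_pchain[OF w u uw xs(2)] xs(1) B(1) unfolding P_def F_def by blast
    qed
    show "\<not> top_less p p" for p by (rule top_less_irrefl)
    show "top_less p r" if "top_less p q" "top_less q r" for p q r using top_less_trans that by blast
    fix p q assume pq: "p \<in> P" "q \<in> P" "p \<noteq> q"
    let ?\<sigma> = "F p \<inter> F q"
    \<comment> \<open>Distinct facets cannot both have all their descents over the common face. A
      bad descent of \<open>p\<close> yields a ridge of \<open>p\<close> that contains the
      intersection, a bad descent of \<open>q\<close> an earlier facet that contains it.\<close>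
    have "\<not> descents_in ?\<sigma> u p \<or> \<not> descents_in ?\<sigma> u q" using uniq[of p q ?\<sigma>] pq wF by blast
    then show "(\<exists>r \<in> P. top_less p r \<and> (\<exists>c. c \<in> F p \<and> c \<notin> F q \<and> F p - {c} \<subseteq> F r)) \<or>
      (\<exists>r \<in> P. top_less q r \<and> F p \<inter> F q \<subseteq> F r)"
    proof
      assume "\<not> descents_in ?\<sigma> u p"
      from fl[OF pq(1) this] show ?thesis by blast
    next
      assume "\<not> descents_in ?\<sigma> u q"
      from fl[OF pq(2) this] show ?thesis by blast
    qed
  qed
qed

text \<open>The maps \<open>rdown s\<close> and \<open>rup s\<close> are monotone and preserve
  cosets, so they carry chains of one interval to chains of the other with the same image.\<close>

lemma proj_complex_shift:
  assumes u: "u \<in> carrier G" and uw: "ble u w" and s: "s \<in> J" and d: "len (w \<otimes> s) < len w"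
  shows "ble (rdown s u) (w \<otimes> s)" "proj_complex u w = proj_complex (rdown s u) (w \<otimes> s)"
proof -
  have wc: "w \<in> carrier G" using ble_carrier u uw by blast
  have sS: "s \<in> S" using s by simp
  have rw: "rdown s w = w \<otimes> s" using d by (simp add: rdown_def)
  have rww: "rup s (w \<otimes> s) = w" using d wc sS by (simp add: rup_def)
  have wsw: "ble (w \<otimes> s) w" using rdown_le(1)[OF wc sS] rw by simp
  show "ble (rdown s u) (w \<otimes> s)" using rdown_mono[OF uw u sS] rw by simp
  have image: "\<exists>B \<in> order_complex ble (bruhat_interval G S u' w'). proj ` B = proj ` A"
    if A: "A \<in> order_complex ble (bruhat_interval G S u0 w0)"
      and f: "\<And>x. x \<in> carrier G \<Longrightarrow> f x \<in> carrier G \<and> proj (f x) = proj x"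
      and mono: "\<And>x y. x \<in> carrier G \<Longrightarrow> ble x y \<Longrightarrow> ble (f x) (f y)"
      and ends: "f u0 = u'" "f w0 = w'" "u0 \<in> carrier G" for A f u0 w0 u' w'
  proof (intro bexI)
    have c: "A \<subseteq> carrier G" using A by (auto simp: order_complex_def bruhat_interval_def)
    show "proj ` f ` A = proj ` A" using f c by (auto simp: image_image subset_iff intro!: image_cong)
    show "f ` A \<in> order_complex ble (bruhat_interval G S u' w')"
      unfolding order_complex_def
    proof (intro CollectI conjI ballI)
      show "finite (f ` A)" using A by (simp add: order_complex_def)
      have "f x \<in> bruhat_interval G S u' w'" if "x \<in> A" for x
      proof -
        have "x \<in> carrier G" "ble u0 x" "ble x w0"
          using A that by (auto simp: order_complex_def bruhat_interval_def)
        then show ?thesis using f mono[OF ends(3), of x] mono[of x w0] ends(1,2) by (simp add: bruhat_interval_def)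
      qed
      then show "f ` A \<subseteq> bruhat_interval G S u' w'" by blast
      fix y y' assume "y \<in> f ` A" "y' \<in> f ` A"
      then obtain x x' where x: "x \<in> A" "x' \<in> A" "y = f x" "y' = f x'" by blast
      then have "ble x x' \<or> ble x' x" using A by (simp add: order_complex_def)
      then show "ble y y' \<or> ble y' y" using mono c x by blast
    qed
  qed
  have 1: "\<exists>B \<in> order_complex ble (bruhat_interval G S (rdown s u) (w \<otimes> s)). proj ` B = proj ` A"
    if "A \<in> order_complex ble (bruhat_interval G S u w)" for A
    using that by (rule image[where f = "rdown s"]) (use rw u sS s proj_rdown rdown_mono in auto)
  have 2: "\<exists>B \<in> order_complex ble (bruhat_interval G S u w). proj ` B = proj ` A"
    if A: "A \<in> order_complex ble (bruhat_interval G S (rdown s u) (w \<otimes> s))" for A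
  \<comment> \<open>If \<open>u\<close> ascends at \<open>s\<close>, the second interval is
    contained in the first. Otherwise \<open>rup s\<close> takes its lower end back to
    \<open>u\<close>.\<close>
  proof (cases "len u < len (u \<otimes> s)")
    case True
    then have "rdown s u = u" by (simp add: rdown_def)
    then have "bruhat_interval G S (rdown s u) (w \<otimes> s) \<subseteq> bruhat_interval G S u w"
      using wsw ble_trans unfolding bruhat_interval_def by auto
    then have "A \<in> order_complex ble (bruhat_interval G S u w)" using A unfolding order_complex_def by blast
    then show ?thesis by blast
  next
    case False
    then have "rup s (rdown s u) = u" using u sS len_right_cases[OF u sS] by (auto simp: rup_def rdown_def)
    then show ?thesis
      by (intro image[OF A, where f = "rup s"]) (use rww u sS s proj_rup rup_mono in auto)
  qed
  show "proj_complex u w = proj_complex (rdown s u) (w \<otimes> s)"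
    unfolding image_complex_def
  proof (intro equalityI image_subsetI)
    fix A assume "A \<in> order_complex ble (bruhat_interval G S u w)"
    from 1[OF this] show "proj ` A \<in> (`) proj ` order_complex ble (bruhat_interval G S (rdown s u) (w \<otimes> s))"
      by (metis imageI)
  next
    fix A assume "A \<in> order_complex ble (bruhat_interval G S (rdown s u) (w \<otimes> s))"
    from 2[OF this] show "proj ` A \<in> (`) proj ` order_complex ble (bruhat_interval G S u w)"
      by (metis imageI)
  qed
qed

theorem shellable_proj_complex:
  "u \<in> carrier G \<Longrightarrow> ble u w \<Longrightarrow> shellable (proj_complex u w)"
proof (induction "len w" arbitrary: u w rule: less_induct)
  case less
  have wc: "w \<in> carrier G" using less.prems ble_carrier by blast
  show ?case
  proof (cases "min_rep w")
    case True then show ?thesis using shellable_min_rep less.prems by blast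
  next
    case False
    then obtain s where s: "s \<in> J" "\<not> len w < len (w \<otimes> s)" using wc min_rep_def by blast
    then have d: "len (w \<otimes> s) < len w" using len_right_cases[OF wc, of s] by auto
    have "rdown s u \<in> carrier G" using less.prems s by simp
    then show ?thesis using less.hyps[OF d] proj_complex_shift[OF less.prems s(1) d] by simp
  qed
qed

end

theorem theorem6p1:
  fixes G :: "('a, 'b) monoid_scheme"
    and S J :: "'a set"
    and m :: "'a \<Rightarrow> 'a \<Rightarrow> nat"
    and u w :: 'a
  assumes "coxeter_system G S m"
    and "J \<subseteq> S"
    and "u \<in> carrier G" and "w \<in> carrier G"
    and "bruhat_le G S u w"
  shows "shellable (image_complex (coset_proj G J)
           (order_complex (bruhat_le G S) (bruhat_interval G S u w)))"
proof -
  obtain prec where "labelled_coxeter G S m J prec"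
    using coxeter_system.ex_reflection_order[OF assms(1,2)] by blast
  then show ?thesis by (rule labelled_coxeter.shellable_proj_complex) fact+
qed

end
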